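(* For every integer $n\geq1$, $\Gamma^{\mathrm{spl}}(n)=(\varnothing,\varnothing,\{\Omega_\tau\mid\tau\in\mathfrak S_n\})$ is a collapsible part of the $(3,1)$-polygraph $\Sigma^{\mathrm{row,coh}}(n)$. Hence the homotopical reduction $$\Sigma^{\mathrm{row,scoh}}(n):=R_{\Gamma^{\mathrm{spl}}(n)}\bigl(\Sigma^{\mathrm{row,coh}}(n)\bigr)$$ is a finite coherent presentation of the stylic monoid $\mathrm{Styl}_n$. Its underlying $2$-polygraph is $\Sigma^{\mathrm{row}}(n)$, and its generating $3$-cells are $$\Sigma^{\mathrm{row,scoh}}_3(n)=\{\mathcal X_{u,v,t}\mid(u,v,t)\in\mathfrak C_n\setminus\mathfrak S_n\}.$$
   Context: **Rows and $N$-tableaux.** Fix $n\geq1$, $[n]=\{1<2<\cdots<n\}$. For a word $w$ over $[n]$, $\ell(w)$ is its length and $\mathrm{supp}(w)$ its set of letters. A row is a nonempty strictly increasing word over $[n]$, identified with its support; $\mathcal R_n$ is the set of rows. For rows $u,v$, $u\triangleleft v$ means $\mathrm{supp}(u)\subseteq\mathrm{supp}(v)$ and $\min(v)<\min(u)$. An $N$-tableau $T$ is a finite sequence of rows $u_k,\dots,u_1$ (top to bottom) with $u_{i+1}\triangleleft u_i$ for all $i$; $\mathcal R(T):=r_{u_k}\cdots r_{u_1}$. Right $N$-insertion of a letter $x$: insert $x$ in the bottom row $u_1$, i.e. replace $u_1$ by the row with support $\mathrm{supp}(u_1)\cup\{x\}$; if $u_1$ has a letter $>x$, the smallest such letter $y$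 is bumped (it also stays in the row) and is inserted in the same way into the next row above, and so on; a letter bumped from the top row creates a new top row consisting of that letter. $N(w)$ is obtained by inserting the letters of $w$ from left to right starting from the empty tableau. For rows $u,v$, $N(uv)$ has at most two rows. $\mathrm{Styl}_n$ is the monoid generated by $[n]$ subject to $xx=x$, $zxy=xzy$ ($x\leq y<z$), $yzx=yxz$ ($x<y\leq z$). **Polygraphs.** A $2$-polygraph $\Sigma=(\Sigma_1,\Sigma_2)$ is a set $\Sigma_1$ with a set $\Sigma_2$ of $2$-cells between words of $\Sigma_1^*$; it presents the quotient of $\Sigma_1^*$ by the congruence generated by $\Sigma_2$. $\Sigma_2^\top$ is the free $(2,1)$-category on $\Sigma$. A $(3,1)$-polygraph adds a set $\Sigma_3$ of generating $3$-cells $A\colon f\Rrightarrow g$ between parallel $2$-cells of $\Sigma_2^\top$; $\Sigma_3^\top$ is the free $(3,1)$-category it generates. $0$-composition is juxtaposition; $\star_1,\star_2$ are $1$- and $2$-composition; $1_f$ is the identity on $f$. It is a coherent presentation of $M$ if the $2$-polygraph presents $M$ and every pair of parallel $2$-cells $(f,g)$ of $\Sigma_2^\top$ is filled by a $3$-cell of $\Sigma_3^\top$; finite if all generating sets are finite. **Collapsible parts and reduction.** A $3$-sphere of $\Sigma_3^\top$ is a pair of parallel $3$-cells. A collapsible part of a $(3,1)$-polygraph $\Sigma$ is a triple $\Gamma=(\Gamma_2,\Gamma_3,\Gamma_4)$, where $\Gamma_2,\Gamma_3$ are families of generating $2$- and $3$-cells and $\Gamma_4$ a family of $3$-spheres,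 an element $\gamma\in\Gamma_4$ being regarded as a $4$-cell from its first component $s_3(\gamma)$ to its second $t_3(\gamma)$, such that: (i) every $\gamma\in\Gamma_k$ is collapsible, i.e. $t_{k-1}(\gamma)$ is a generating $(k-1)$-cell and $s_{k-1}(\gamma)$ belongs to the free $(3,1)$-category generated by $\Sigma\setminus\{t_{k-1}(\gamma)\}$ (possibly after a Nielsen transformation, i.e. replacement of a generating cell by one parallel to an invertible whiskering of it or its inverse); (ii) no element of $\Gamma_k$ is the target of an element of $\Gamma_{k+1}$, $k=2,3$; (iii) there are well-founded orders on generating $1$-, $2$-, $3$-cells such that for $\gamma\in\Gamma_k$ the target $t_{k-1}(\gamma)$ is strictly greater than every generating $(k-1)$-cell occurring in $s_{k-1}(\gamma)$. The homotopical reduction $R_\Gamma(\Sigma)$ removes the cells of $\Gamma_2\cup\Gamma_3$ and all targets $t_{k-1}(\gamma)$, $\gamma\in\Gamma_k$, the boundaries of remaining cells being transformed by the functor $R_\Gamma$ that sends $t_{k-1}(\gamma)$ to $R_\Gamma(s_{k-1}(\gamma))$, sends $\gamma\in\Gamma_2\cup\Gamma_3$ to identities, and fixes other generators. **Coherent row presentation.** $\Sigma^{\mathrm{row}}(n)$ has $1$-cells $r_u$ ($u\in\mathcal R_n$) and $2$-cells $\alpha_{u,v}\colon r_ur_v\Rightarrow\mathcal R(N(uv))$ for $u\not\triangleleft v$. It is known to be convergent and to present $\mathrm{Styl}_n$. $\Lambda_w\colon w\Rightarrow\widehat w$ is the leftmost normalization path of a word $w$. $\mathfrak C_n=\{(u,v,t)\in\mathcal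 R_n^3\mid u\not\triangleleft v,\ v\not\triangleleft t\}$ (critical triples); $\operatorname{NF}(u,v,t)=\mathcal R(N(uvt))$ is the normal form of $r_ur_vr_t$. $\Sigma^{\mathrm{row,coh}}(n)$ is $\Sigma^{\mathrm{row}}(n)$ with one generating $3$-cell $\mathcal X_{u,v,t}\colon(\alpha_{u,v}1_{r_t})\star_1\Lambda_{\mathcal R(N(uv))r_t}\Rrightarrow(1_{r_u}\alpha_{v,t})\star_1\Lambda_{r_u\mathcal R(N(vt))}$ for each $(u,v,t)\in\mathfrak C_n$. For a word $w$, $\widehat{\mathcal X}^{\,w}_{u,v,t}:=(\mathcal X_{u,v,t}1_w)\star_11_{\Lambda_{\operatorname{NF}(u,v,t)w}}$. **Splittable triples.** For a row $u=x_1\cdots x_k$, $k\geq2$, $\partial u=x_2\cdots x_k$. $\mathfrak S_n=\{(u,v,t)\in\mathfrak C_n\mid\ell(u)\geq2,\ \partial u\not\triangleleft v\}$. **The spheres $\Omega_\tau$.** Let $\tau=(u,v,t)\in\mathfrak S_n$, $u=x\,\partial u$ ($x$ a letter). Put $\mathbf M=\mathcal R(N(uv))$, $\mathbf U=\mathcal R(N(\partial u\,v))$, $\mathbf V=\mathcal R(N(vt))$, $\mathbf Z=\operatorname{NF}(\partial u,v,t)$; $p_\tau=\Lambda_{r_x\mathbf U}$, $f^L_\tau=\Lambda_{\mathbf Ur_t}$, $q_\tau=\Lambda_{r_x\mathbf Z}$, $h_\tau=\Lambda_{\mathbf Mr_t}$, $f^R_\tau=\Lambda_{r_{\partial u}\mathbf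 V}$, $\rho_\tau=\Lambda_{r_u\mathbf V}$; $A_\tau=\alpha_{x,\partial u}1_{r_v}1_{r_t}$, $B_\tau=1_{r_x}\alpha_{\partial u,v}1_{r_t}$, $C_\tau=1_{r_x}1_{r_{\partial u}}\alpha_{v,t}$. If $a$ is a row with $x<\min(a)$, $xa$ denotes the row obtained by prefixing $x$. Equalities of $2$-cells given by the exchange law are used as identity $3$-cells ("Peiffer"). $\Theta^L_\tau\colon(p_\tau1_{r_t})\star_1h_\tau\Rrightarrow(1_{r_x}f^L_\tau)\star_1q_\tau$ is defined as follows. If $\mathbf U=r_b$: $\Theta^L_\tau=\mathcal X_{x,b,t}$. If $\mathbf U=r_ar_b$: let $K^L_\tau$ be the identity if $xa\triangleleft b$ and $\mathcal X_{xa,b,t}$ otherwise; $\Theta^L_\tau$ is $1_{\alpha_{x,a}1_{r_b}1_{r_t}}\star_1K^L_\tau$, followed ($\star_2$) by the Peiffer identity exchanging the steps on $(x,a)$ and $(b,t)$, and, if $f^L_\tau$ has a second step $\alpha_{a,e}1_{r_f}$ (where $\mathcal R(N(bt))=r_er_f$), followed by $1_{1_{r_x}1_{r_a}\alpha_{b,t}}\star_1\widehat{\mathcal X}^{\,r_f}_{x,a,e}$. $\Theta^R_\tau\colon(\alpha_{x,\partial u}1_{\mathbf V})\star_1\rho_\tau\Rrightarrow(1_{r_x}f^R_\tau)\star_1q_\tau$ is defined as follows. If $\mathbf V=r_d$: identity if $f^R_\tau$ is an identity, and $\mathcal X_{x,\partial u,d}$ if $f^R_\tau=\alpha_{\partial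 u,d}$. If $\mathbf V=r_cr_d$: let $K_0=\widehat{\mathcal X}^{\,r_d}_{x,\partial u,c}$ and $\mathbf J=\mathcal R(N(\partial u\,c))$. If $\mathbf J=r_g$: $\Theta^R_\tau=K_0$ when $g\triangleleft d$, and otherwise $K_0\star_2(1_{1_{r_x}\alpha_{\partial u,c}1_{r_d}}\star_1\mathcal X_{x,g,d})$. If $\mathbf J=r_ir_j$: $\Theta^R_\tau=K_0$ when $j\triangleleft d$; otherwise let $K_1$ be the identity if $xi\triangleleft j$ and $\mathcal X_{xi,j,d}$ otherwise, and $\Theta^R_\tau$ is $K_0$, followed by $1_{(1_{r_x}\alpha_{\partial u,c}1_{r_d})\star_1(\alpha_{x,i}1_{r_j}1_{r_d})}\star_1K_1$, followed by the Peiffer identity exchanging the steps on $(x,i)$ and $(j,d)$. Put $F_1=(\mathcal X_{x,\partial u,v}1_{r_t})\star_11_{h_\tau}$, $F_2=1_{B_\tau}\star_1\Theta^L_\tau$, $F_3=(1_{r_x}\mathcal X_{\partial u,v,t})\star_11_{q_\tau}$, $F_4=1_{C_\tau}\star_1(\Theta^R_\tau)^{-1}$, $F_5=\Pi_\tau\star_11_{\rho_\tau}$ with $\Pi_\tau\colon C_\tau\star_1(\alpha_{x,\partial u}1_{\mathbf V})\Rrightarrow A_\tau\star_1(1_{r_u}\alpha_{v,t})$ the Peiffer identity. Then $\Psi_\tau=F_1\star_2F_2\star_2F_3\star_2F_4\star_2F_5$ is parallel to $1_{A_\tau}\star_1\mathcal X_{u,v,t}$; set $S_\tau=1_{A_\tau^{-1}}\star_1\Psi_\tau$,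 which is parallel to $\mathcal X_{u,v,t}$, and $\Omega_\tau=(S_\tau,\mathcal X_{u,v,t})$, a $3$-sphere with source $S_\tau$ and target $\mathcal X_{u,v,t}$. *)

theory Defs
  imports "HOL-Algebra.Group"
begin

section \<open>Monoids presented by generators and relations\<close>

inductive word_cong :: "'a set \<Rightarrow> ('a list \<times> 'a list) set \<Rightarrow> 'a list \<Rightarrow> 'a list \<Rightarrow> bool"
  for X R where
  refl: "w \<in> lists X \<Longrightarrow> word_cong X R w w"
| sym: "word_cong X R v w \<Longrightarrow> word_cong X R w v"
| trans: "word_cong X R u v \<Longrightarrow> word_cong X R v w \<Longrightarrow> word_cong X R u w"
| rel: "(l, r) \<in> R \<Longrightarrow> l \<in> lists X \<Longrightarrow> r \<in> lists X \<Longrightarrow> p \<in> lists X \<Longrightarrow> s \<in> lists X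
        \<Longrightarrow> word_cong X R (p @ l @ s) (p @ r @ s)"

definition presented_monoid :: "'a set \<Rightarrow> ('a list \<times> 'a list) set \<Rightarrow> 'a list set monoid" where
  "presented_monoid X R =
    \<lparr>carrier = {{w. word_cong X R v w} | v. v \<in> lists X},
     mult = (\<lambda>A B. {w. \<exists>a\<in>A. \<exists>b\<in>B. word_cong X R (a @ b) w}),
     one = {w. word_cong X R [] w}\<rparr>"

definition stylic_monoid :: "nat \<Rightarrow> nat list set monoid" where
  "stylic_monoid n = presented_monoid {1..n}
    ({([x, x], [x]) | x. x \<in> {1..n}} \<union>
     {([z, x, y], [x, z, y]) | x y z. {x, y, z} \<subseteq> {1..n} \<and> x \<le> y \<and> y < z} \<union>
     {([y, z, x], [y, x, z]) | x y z. {x, y, z} \<subseteq> {1..n} \<and> x < y \<and> y \<le> z})"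

section \<open>Polygraphs\<close>

text \<open>Cells of free categories are represented by formal composites.  A formal composite is a cell
  only if it is well-typed (\<open>is_cell2\<close>, \<open>is_cell3\<close>), and two composites denote the same cell iff they
  are related by \<open>eq2\<close>, respectively \<open>eq3\<close>, the congruence generated by the axioms of strict
  categories together with invertibility.  Words are lists, so they need no quotient.  Composition is
  written in diagrammatic order.\<close>

datatype (letters2: 'a, gens2: 'b) cell2 =
  Id1 "'a list"
| Gen2 'b
| Comp20 "('a, 'b) cell2" "('a, 'b) cell2"  (infixr \<open>\<star>\<^sub>0\<close> 80)
| Comp21 "('a, 'b) cell2" "('a, 'b) cell2"  (infixr \<open>\<star>\<^sub>1\<close> 75)
| Inv2 "('a, 'b) cell2"

datatype (letters3: 'a, gens32: 'b, gens3: 'c) cell3 =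
  Id2 "('a, 'b) cell2"
| Gen3 'c
| Comp30 "('a, 'b, 'c) cell3" "('a, 'b, 'c) cell3"  (infixr \<open>\<bullet>\<^sub>0\<close> 80)
| Comp31 "('a, 'b, 'c) cell3" "('a, 'b, 'c) cell3"  (infixr \<open>\<bullet>\<^sub>1\<close> 75)
| Comp32 "('a, 'b, 'c) cell3" "('a, 'b, 'c) cell3"  (infixr \<open>\<bullet>\<^sub>2\<close> 70)
| Inv3 "('a, 'b, 'c) cell3"

record ('a, 'b) polygraph2 =
  gen1 :: "'a set"
  gen2 :: "'b set"
  dom2 :: "'b \<Rightarrow> 'a list"
  cod2 :: "'b \<Rightarrow> 'a list"

record ('a, 'b, 'c) polygraph3 = "('a, 'b) polygraph2" +
  gen3 :: "'c set"
  dom3 :: "'c \<Rightarrow> ('a, 'b) cell2"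
  cod3 :: "'c \<Rightarrow> ('a, 'b) cell2"

subsection \<open>The free (2,1)-category on a 2-polygraph\<close>

fun src1 tgt1 :: "('a, 'b, 'z) polygraph2_scheme \<Rightarrow> ('a, 'b) cell2 \<Rightarrow> 'a list" where
  "src1 P (Id1 w) = w"
| "src1 P (Gen2 b) = dom2 P b"
| "src1 P (f \<star>\<^sub>0 g) = src1 P f @ src1 P g"
| "src1 P (f \<star>\<^sub>1 g) = src1 P f"
| "src1 P (Inv2 f) = tgt1 P f"
| "tgt1 P (Id1 w) = w"
| "tgt1 P (Gen2 b) = cod2 P b"
| "tgt1 P (f \<star>\<^sub>0 g) = tgt1 P f @ tgt1 P g"
| "tgt1 P (f \<star>\<^sub>1 g) = tgt1 P g"
| "tgt1 P (Inv2 f) = src1 P f"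

primrec is_cell2 :: "('a, 'b, 'z) polygraph2_scheme \<Rightarrow> ('a, 'b) cell2 \<Rightarrow> bool" where
  "is_cell2 P (Id1 w) \<longleftrightarrow> w \<in> lists (gen1 P)"
| "is_cell2 P (Gen2 b) \<longleftrightarrow> b \<in> gen2 P"
| "is_cell2 P (f \<star>\<^sub>0 g) \<longleftrightarrow> is_cell2 P f \<and> is_cell2 P g"
| "is_cell2 P (f \<star>\<^sub>1 g) \<longleftrightarrow> is_cell2 P f \<and> is_cell2 P g \<and> tgt1 P f = src1 P g"
| "is_cell2 P (Inv2 f) \<longleftrightarrow> is_cell2 P f"

inductive eq2 :: "('a, 'b, 'z) polygraph2_scheme \<Rightarrow> ('a, 'b) cell2 \<Rightarrow> ('a, 'b) cell2 \<Rightarrow> bool"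
  for P where
  refl: "is_cell2 P f \<Longrightarrow> eq2 P f f"
| sym: "eq2 P f g \<Longrightarrow> eq2 P g f"
| trans: "eq2 P f g \<Longrightarrow> eq2 P g h \<Longrightarrow> eq2 P f h"
| cong0: "eq2 P f f' \<Longrightarrow> eq2 P g g' \<Longrightarrow> eq2 P (f \<star>\<^sub>0 g) (f' \<star>\<^sub>0 g')"
| cong1: "eq2 P f f' \<Longrightarrow> eq2 P g g' \<Longrightarrow> is_cell2 P (f \<star>\<^sub>1 g) \<Longrightarrow> eq2 P (f \<star>\<^sub>1 g) (f' \<star>\<^sub>1 g')"
| cong_inv: "eq2 P f f' \<Longrightarrow> eq2 P (Inv2 f) (Inv2 f')"
| assoc0: "is_cell2 P (f \<star>\<^sub>0 g \<star>\<^sub>0 h) \<Longrightarrow> eq2 P ((f \<star>\<^sub>0 g) \<star>\<^sub>0 h) (f \<star>\<^sub>0 g \<star>\<^sub>0 h)"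
| unit0_left: "is_cell2 P f \<Longrightarrow> eq2 P (Id1 [] \<star>\<^sub>0 f) f"
| unit0_right: "is_cell2 P f \<Longrightarrow> eq2 P (f \<star>\<^sub>0 Id1 []) f"
| assoc1: "is_cell2 P (f \<star>\<^sub>1 g \<star>\<^sub>1 h) \<Longrightarrow> eq2 P ((f \<star>\<^sub>1 g) \<star>\<^sub>1 h) (f \<star>\<^sub>1 g \<star>\<^sub>1 h)"
| unit1_left: "is_cell2 P f \<Longrightarrow> eq2 P (Id1 (src1 P f) \<star>\<^sub>1 f) f"
| unit1_right: "is_cell2 P f \<Longrightarrow> eq2 P (f \<star>\<^sub>1 Id1 (tgt1 P f)) f"
| inv_right: "is_cell2 P f \<Longrightarrow> eq2 P (f \<star>\<^sub>1 Inv2 f) (Id1 (src1 P f))"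
| inv_left: "is_cell2 P f \<Longrightarrow> eq2 P (Inv2 f \<star>\<^sub>1 f) (Id1 (tgt1 P f))"
| id_comp0: "is_cell2 P (Id1 v \<star>\<^sub>0 Id1 w) \<Longrightarrow> eq2 P (Id1 v \<star>\<^sub>0 Id1 w) (Id1 (v @ w))"
| exchange: "is_cell2 P ((f \<star>\<^sub>1 f') \<star>\<^sub>0 (g \<star>\<^sub>1 g'))
    \<Longrightarrow> eq2 P ((f \<star>\<^sub>1 f') \<star>\<^sub>0 (g \<star>\<^sub>1 g')) ((f \<star>\<^sub>0 g) \<star>\<^sub>1 (f' \<star>\<^sub>0 g'))"

definition parallel2 :: "('a, 'b, 'z) polygraph2_scheme \<Rightarrow> ('a, 'b) cell2 \<Rightarrow> ('a, 'b) cell2 \<Rightarrow> bool" where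
  "parallel2 P f g \<longleftrightarrow> is_cell2 P f \<and> is_cell2 P g \<and> src1 P f = src1 P g \<and> tgt1 P f = tgt1 P g"

definition presents :: "('a, 'b, 'z) polygraph2_scheme \<Rightarrow> ('m, 'y) monoid_scheme \<Rightarrow> bool" where
  "presents P M \<longleftrightarrow>
    presented_monoid (gen1 P) ((\<lambda>b. (dom2 P b, cod2 P b)) ` gen2 P) \<cong> M"

subsection \<open>The free (3,1)-category on a (3,1)-polygraph\<close>

fun src2 tgt2 :: "('a, 'b, 'c, 'z) polygraph3_scheme \<Rightarrow> ('a, 'b, 'c) cell3 \<Rightarrow> ('a, 'b) cell2" where
  "src2 P (Id2 f) = f"
| "src2 P (Gen3 c) = dom3 P c"
| "src2 P (A \<bullet>\<^sub>0 B) = src2 P A \<star>\<^sub>0 src2 P B"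
| "src2 P (A \<bullet>\<^sub>1 B) = src2 P A \<star>\<^sub>1 src2 P B"
| "src2 P (A \<bullet>\<^sub>2 B) = src2 P A"
| "src2 P (Inv3 A) = tgt2 P A"
| "tgt2 P (Id2 f) = f"
| "tgt2 P (Gen3 c) = cod3 P c"
| "tgt2 P (A \<bullet>\<^sub>0 B) = tgt2 P A \<star>\<^sub>0 tgt2 P B"
| "tgt2 P (A \<bullet>\<^sub>1 B) = tgt2 P A \<star>\<^sub>1 tgt2 P B"
| "tgt2 P (A \<bullet>\<^sub>2 B) = tgt2 P B"
| "tgt2 P (Inv3 A) = src2 P A"

text \<open>Boundaries of 3-cells are compared modulo \<open>eq2\<close>.  In particular an identity 3-cell \<open>Id2 f\<close> may
  be composed with a 3-cell whose source is \<open>f\<close> only up to the exchange law; this is how identity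
  3-cells between exchange-equivalent composites are written below.\<close>

primrec is_cell3 :: "('a, 'b, 'c, 'z) polygraph3_scheme \<Rightarrow> ('a, 'b, 'c) cell3 \<Rightarrow> bool" where
  "is_cell3 P (Id2 f) \<longleftrightarrow> is_cell2 P f"
| "is_cell3 P (Gen3 c) \<longleftrightarrow> c \<in> gen3 P"
| "is_cell3 P (A \<bullet>\<^sub>0 B) \<longleftrightarrow> is_cell3 P A \<and> is_cell3 P B"
| "is_cell3 P (A \<bullet>\<^sub>1 B) \<longleftrightarrow> is_cell3 P A \<and> is_cell3 P B \<and> tgt1 P (src2 P A) = src1 P (src2 P B)"
| "is_cell3 P (A \<bullet>\<^sub>2 B) \<longleftrightarrow> is_cell3 P A \<and> is_cell3 P B \<and> eq2 P (tgt2 P A) (src2 P B)"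
| "is_cell3 P (Inv3 A) \<longleftrightarrow> is_cell3 P A"

inductive eq3 ::
  "('a, 'b, 'c, 'z) polygraph3_scheme \<Rightarrow> ('a, 'b, 'c) cell3 \<Rightarrow> ('a, 'b, 'c) cell3 \<Rightarrow> bool"
  for P where
  refl: "is_cell3 P A \<Longrightarrow> eq3 P A A"
| sym: "eq3 P A B \<Longrightarrow> eq3 P B A"
| trans: "eq3 P A B \<Longrightarrow> eq3 P B C \<Longrightarrow> eq3 P A C"
| cong_id: "eq2 P f g \<Longrightarrow> eq3 P (Id2 f) (Id2 g)"
| cong0: "eq3 P A A' \<Longrightarrow> eq3 P B B' \<Longrightarrow> eq3 P (A \<bullet>\<^sub>0 B) (A' \<bullet>\<^sub>0 B')"
| cong1: "eq3 P A A' \<Longrightarrow> eq3 P B B' \<Longrightarrow> is_cell3 P (A \<bullet>\<^sub>1 B) \<Longrightarrow> eq3 P (A \<bullet>\<^sub>1 B) (A' \<bullet>\<^sub>1 B')"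
| cong2: "eq3 P A A' \<Longrightarrow> eq3 P B B' \<Longrightarrow> is_cell3 P (A \<bullet>\<^sub>2 B) \<Longrightarrow> eq3 P (A \<bullet>\<^sub>2 B) (A' \<bullet>\<^sub>2 B')"
| cong_inv: "eq3 P A A' \<Longrightarrow> eq3 P (Inv3 A) (Inv3 A')"
| assoc0: "is_cell3 P (A \<bullet>\<^sub>0 B \<bullet>\<^sub>0 C) \<Longrightarrow> eq3 P ((A \<bullet>\<^sub>0 B) \<bullet>\<^sub>0 C) (A \<bullet>\<^sub>0 B \<bullet>\<^sub>0 C)"
| unit0_left: "is_cell3 P A \<Longrightarrow> eq3 P (Id2 (Id1 []) \<bullet>\<^sub>0 A) A"
| unit0_right: "is_cell3 P A \<Longrightarrow> eq3 P (A \<bullet>\<^sub>0 Id2 (Id1 [])) A"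
| assoc1: "is_cell3 P (A \<bullet>\<^sub>1 B \<bullet>\<^sub>1 C) \<Longrightarrow> eq3 P ((A \<bullet>\<^sub>1 B) \<bullet>\<^sub>1 C) (A \<bullet>\<^sub>1 B \<bullet>\<^sub>1 C)"
| unit1_left: "is_cell3 P A \<Longrightarrow> eq3 P (Id2 (Id1 (src1 P (src2 P A))) \<bullet>\<^sub>1 A) A"
| unit1_right: "is_cell3 P A \<Longrightarrow> eq3 P (A \<bullet>\<^sub>1 Id2 (Id1 (tgt1 P (src2 P A)))) A"
| assoc2: "is_cell3 P (A \<bullet>\<^sub>2 B \<bullet>\<^sub>2 C) \<Longrightarrow> eq3 P ((A \<bullet>\<^sub>2 B) \<bullet>\<^sub>2 C) (A \<bullet>\<^sub>2 B \<bullet>\<^sub>2 C)"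
| unit2_left: "is_cell3 P A \<Longrightarrow> eq3 P (Id2 (src2 P A) \<bullet>\<^sub>2 A) A"
| unit2_right: "is_cell3 P A \<Longrightarrow> eq3 P (A \<bullet>\<^sub>2 Id2 (tgt2 P A)) A"
| inv_right: "is_cell3 P A \<Longrightarrow> eq3 P (A \<bullet>\<^sub>2 Inv3 A) (Id2 (src2 P A))"
| inv_left: "is_cell3 P A \<Longrightarrow> eq3 P (Inv3 A \<bullet>\<^sub>2 A) (Id2 (tgt2 P A))"
| id_comp0: "is_cell2 P (f \<star>\<^sub>0 g) \<Longrightarrow> eq3 P (Id2 f \<bullet>\<^sub>0 Id2 g) (Id2 (f \<star>\<^sub>0 g))"
| id_comp1: "is_cell2 P (f \<star>\<^sub>1 g) \<Longrightarrow> eq3 P (Id2 f \<bullet>\<^sub>1 Id2 g) (Id2 (f \<star>\<^sub>1 g))"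
| exchange01: "is_cell3 P ((A \<bullet>\<^sub>1 A') \<bullet>\<^sub>0 (B \<bullet>\<^sub>1 B'))
    \<Longrightarrow> eq3 P ((A \<bullet>\<^sub>1 A') \<bullet>\<^sub>0 (B \<bullet>\<^sub>1 B')) ((A \<bullet>\<^sub>0 B) \<bullet>\<^sub>1 (A' \<bullet>\<^sub>0 B'))"
| exchange02: "is_cell3 P ((A \<bullet>\<^sub>2 A') \<bullet>\<^sub>0 (B \<bullet>\<^sub>2 B'))
    \<Longrightarrow> eq3 P ((A \<bullet>\<^sub>2 A') \<bullet>\<^sub>0 (B \<bullet>\<^sub>2 B')) ((A \<bullet>\<^sub>0 B) \<bullet>\<^sub>2 (A' \<bullet>\<^sub>0 B'))"
| exchange12: "is_cell3 P ((A \<bullet>\<^sub>2 A') \<bullet>\<^sub>1 (B \<bullet>\<^sub>2 B'))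
    \<Longrightarrow> eq3 P ((A \<bullet>\<^sub>2 A') \<bullet>\<^sub>1 (B \<bullet>\<^sub>2 B')) ((A \<bullet>\<^sub>1 B) \<bullet>\<^sub>2 (A' \<bullet>\<^sub>1 B'))"

definition sphere3 :: "('a, 'b, 'c, 'z) polygraph3_scheme
    \<Rightarrow> ('a, 'b, 'c) cell3 \<times> ('a, 'b, 'c) cell3 \<Rightarrow> bool" where
  "sphere3 P = (\<lambda>(A, B). is_cell3 P A \<and> is_cell3 P B \<and>
     eq2 P (src2 P A) (src2 P B) \<and> eq2 P (tgt2 P A) (tgt2 P B))"

definition is_polygraph3 :: "('a, 'b, 'c, 'z) polygraph3_scheme \<Rightarrow> bool" where
  "is_polygraph3 P \<longleftrightarrow>
    (\<forall>b\<in>gen2 P. dom2 P b \<in> lists (gen1 P) \<and> cod2 P b \<in> lists (gen1 P)) \<and>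
    (\<forall>c\<in>gen3 P. parallel2 P (dom3 P c) (cod3 P c))"

definition finite_polygraph :: "('a, 'b, 'c, 'z) polygraph3_scheme \<Rightarrow> bool" where
  "finite_polygraph P \<longleftrightarrow> finite (gen1 P) \<and> finite (gen2 P) \<and> finite (gen3 P)"

definition coherent_presentation ::
  "('a, 'b, 'c, 'z) polygraph3_scheme \<Rightarrow> ('m, 'y) monoid_scheme \<Rightarrow> bool" where
  "coherent_presentation P M \<longleftrightarrow> is_polygraph3 P \<and> presents P M \<and>
    (\<forall>f g. parallel2 P f g \<longrightarrow> (\<exists>A. is_cell3 P A \<and> eq2 P (src2 P A) f \<and> eq2 P (tgt2 P A) g))"

section \<open>Collapsible parts and homotopical reduction\<close>

text \<open>A part \<open>(\<Gamma>2, \<Gamma>3, \<Gamma>4)\<close> comes with the boundaries \<open>(\<nu>2, \<nu>3, \<nu>4)\<close> of its elements after an (optional)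
  Nielsen transformation: \<open>\<nu>k \<gamma>\<close> is the pair (source, target) of the cell that replaces \<open>\<gamma>\<close>.  The
  representative of each boundary may be chosen freely in its \<open>eq2\<close>- or \<open>eq3\<close>-class, so that the
  occurrence conditions of \<open>collapsible_part\<close> can be imposed on these representatives.\<close>

type_synonym ('a, 'b, 'c) sphere = "('a, 'b, 'c) cell3 \<times> ('a, 'b, 'c) cell3"

type_synonym ('a, 'b, 'c) part = "'b set \<times> 'c set \<times> ('a, 'b, 'c) sphere set"

type_synonym ('a, 'b, 'c) nielsen =
  "('b \<Rightarrow> 'a list \<times> 'a list) \<times> ('c \<Rightarrow> ('a, 'b) cell2 \<times> ('a, 'b) cell2) \<times>
   (('a, 'b, 'c) sphere \<Rightarrow> ('a, 'b, 'c) sphere)"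

text \<open>The only invertible 1-cell is the empty word, hence 2-cells have no non-trivial invertible
  whiskerings, 3-cells have only the 1-compositions with 2-cells, and 4-cells only the
  1-compositions with 2-cells and the 2-compositions with 3-cells.\<close>

definition nielsen2 :: "'a list \<times> 'a list \<Rightarrow> 'a list \<times> 'a list \<Rightarrow> bool" where
  "nielsen2 = (\<lambda>(u, v) (u', v'). (u', v') \<in> {(u, v), (v, u)})"

definition nielsen3 :: "('a, 'b, 'z) polygraph2_scheme
    \<Rightarrow> ('a, 'b) cell2 \<times> ('a, 'b) cell2 \<Rightarrow> ('a, 'b) cell2 \<times> ('a, 'b) cell2 \<Rightarrow> bool" where
  "nielsen3 P = (\<lambda>(f, g) (f', g'). \<exists>(s, t)\<in>{(f, g), (g, f)}. \<exists>h k.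
     eq2 P f' (h \<star>\<^sub>1 s \<star>\<^sub>1 k) \<and> eq2 P g' (h \<star>\<^sub>1 t \<star>\<^sub>1 k))"

definition nielsen4 :: "('a, 'b, 'c, 'z) polygraph3_scheme
    \<Rightarrow> ('a, 'b, 'c) sphere \<Rightarrow> ('a, 'b, 'c) sphere \<Rightarrow> bool" where
  "nielsen4 P = (\<lambda>(A, B) (A', B'). \<exists>(S, T)\<in>{(A, B), (B, A)}. \<exists>h k H K.
     eq3 P A' (H \<bullet>\<^sub>2 (Id2 h \<bullet>\<^sub>1 S \<bullet>\<^sub>1 Id2 k) \<bullet>\<^sub>2 K) \<and>
     eq3 P B' (H \<bullet>\<^sub>2 (Id2 h \<bullet>\<^sub>1 T \<bullet>\<^sub>1 Id2 k) \<bullet>\<^sub>2 K))"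

definition no_nielsen :: "('a, 'b, 'c, 'z) polygraph3_scheme \<Rightarrow> ('a, 'b, 'c) nielsen" where
  "no_nielsen P = (\<lambda>b. (dom2 P b, cod2 P b), \<lambda>c. (dom3 P c, cod3 P c), \<lambda>\<gamma>. \<gamma>)"

fun collapsible_part :: "('a, 'b, 'c, 'z) polygraph3_scheme
    \<Rightarrow> ('a, 'b, 'c) nielsen \<Rightarrow> ('a, 'b, 'c) part \<Rightarrow> bool" where
  "collapsible_part P (\<nu>2, \<nu>3, \<nu>4) (\<Gamma>2, \<Gamma>3, \<Gamma>4) \<longleftrightarrow>
    is_polygraph3 P \<and>
    \<Gamma>2 \<subseteq> gen2 P \<and> \<Gamma>3 \<subseteq> gen3 P \<and> (\<forall>\<gamma>\<in>\<Gamma>4. sphere3 P \<gamma>) \<and>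
    (\<forall>\<gamma>\<in>\<Gamma>2. nielsen2 (dom2 P \<gamma>, cod2 P \<gamma>) (\<nu>2 \<gamma>)) \<and>
    (\<forall>\<gamma>\<in>\<Gamma>3. nielsen3 P (dom3 P \<gamma>, cod3 P \<gamma>) (\<nu>3 \<gamma>)) \<and>
    (\<forall>\<gamma>\<in>\<Gamma>4. nielsen4 P \<gamma> (\<nu>4 \<gamma>)) \<and>
    (\<forall>\<gamma>\<in>\<Gamma>2. \<exists>x\<in>gen1 P. snd (\<nu>2 \<gamma>) = [x] \<and> fst (\<nu>2 \<gamma>) \<in> lists (gen1 P - {x})) \<and>
    (\<forall>\<gamma>\<in>\<Gamma>3. \<exists>x\<in>gen2 P. snd (\<nu>3 \<gamma>) = Gen2 x \<and> is_cell2 (P\<lparr>gen2 := gen2 P - {x}\<rparr>) (fst (\<nu>3 \<gamma>))) \<and>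
    (\<forall>\<gamma>\<in>\<Gamma>4. \<exists>x\<in>gen3 P. snd (\<nu>4 \<gamma>) = Gen3 x \<and> is_cell3 (P\<lparr>gen3 := gen3 P - {x}\<rparr>) (fst (\<nu>4 \<gamma>))) \<and>
    (\<forall>\<gamma>\<in>\<Gamma>3. \<forall>x\<in>\<Gamma>2. snd (\<nu>3 \<gamma>) \<noteq> Gen2 x) \<and>
    (\<forall>\<gamma>\<in>\<Gamma>4. \<forall>x\<in>\<Gamma>3. snd (\<nu>4 \<gamma>) \<noteq> Gen3 x) \<and>
    (\<exists>R. R \<subseteq> gen1 P \<times> gen1 P \<and> wf R \<and> trans R \<and>
      (\<forall>\<gamma>\<in>\<Gamma>2. \<forall>x. snd (\<nu>2 \<gamma>) = [x] \<longrightarrow> (\<forall>y\<in>set (fst (\<nu>2 \<gamma>)). (y, x) \<in> R))) \<and>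
    (\<exists>R. R \<subseteq> gen2 P \<times> gen2 P \<and> wf R \<and> trans R \<and>
      (\<forall>\<gamma>\<in>\<Gamma>3. \<forall>x. snd (\<nu>3 \<gamma>) = Gen2 x \<longrightarrow> (\<forall>y\<in>gens2 (fst (\<nu>3 \<gamma>)). (y, x) \<in> R))) \<and>
    (\<exists>R. R \<subseteq> gen3 P \<times> gen3 P \<and> wf R \<and> trans R \<and>
      (\<forall>\<gamma>\<in>\<Gamma>4. \<forall>x. snd (\<nu>4 \<gamma>) = Gen3 x \<longrightarrow> (\<forall>y\<in>gens3 (fst (\<nu>4 \<gamma>)). (y, x) \<in> R)))"

text \<open>The reduction functor on generating 1- and 2-cells, by recursion along \<open>target \<mapsto> source\<close>; the
  orders of \<open>collapsible_part\<close> make the recursion well-founded.  Only its values on 1- and 2-cells are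
  needed, since these determine the boundaries of the remaining generating cells.\<close>

definition red1 :: "('b \<Rightarrow> 'a list \<times> 'a list) \<Rightarrow> 'b set \<Rightarrow> 'a \<Rightarrow> 'a list" where
  "red1 \<nu>2 \<Gamma>2 = wfrec {(y, x). \<exists>\<gamma>\<in>\<Gamma>2. snd (\<nu>2 \<gamma>) = [x] \<and> y \<in> set (fst (\<nu>2 \<gamma>))}
    (\<lambda>r x. if \<exists>\<gamma>\<in>\<Gamma>2. snd (\<nu>2 \<gamma>) = [x]
           then concat (map r (fst (\<nu>2 (SOME \<gamma>. \<gamma> \<in> \<Gamma>2 \<and> snd (\<nu>2 \<gamma>) = [x]))))
           else [x])"

primrec subst2 :: "('a \<Rightarrow> 'a list) \<Rightarrow> ('b \<Rightarrow> ('a, 'b) cell2) \<Rightarrow> ('a, 'b) cell2 \<Rightarrow> ('a, 'b) cell2" where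
  "subst2 \<rho> \<sigma> (Id1 w) = Id1 (concat (map \<rho> w))"
| "subst2 \<rho> \<sigma> (Gen2 b) = \<sigma> b"
| "subst2 \<rho> \<sigma> (f \<star>\<^sub>0 g) = subst2 \<rho> \<sigma> f \<star>\<^sub>0 subst2 \<rho> \<sigma> g"
| "subst2 \<rho> \<sigma> (f \<star>\<^sub>1 g) = subst2 \<rho> \<sigma> f \<star>\<^sub>1 subst2 \<rho> \<sigma> g"
| "subst2 \<rho> \<sigma> (Inv2 f) = Inv2 (subst2 \<rho> \<sigma> f)"

definition red2 :: "('a, 'b, 'z) polygraph2_scheme \<Rightarrow> ('a \<Rightarrow> 'a list) \<Rightarrow> 'b set
    \<Rightarrow> ('c \<Rightarrow> ('a, 'b) cell2 \<times> ('a, 'b) cell2) \<Rightarrow> 'c set \<Rightarrow> 'b \<Rightarrow> ('a, 'b) cell2" where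
  "red2 P \<rho> \<Gamma>2 \<nu>3 \<Gamma>3 = wfrec {(y, x). \<exists>\<gamma>\<in>\<Gamma>3. snd (\<nu>3 \<gamma>) = Gen2 x \<and> y \<in> gens2 (fst (\<nu>3 \<gamma>))}
    (\<lambda>r x. if \<exists>\<gamma>\<in>\<Gamma>3. snd (\<nu>3 \<gamma>) = Gen2 x
           then subst2 \<rho> r (fst (\<nu>3 (SOME \<gamma>. \<gamma> \<in> \<Gamma>3 \<and> snd (\<nu>3 \<gamma>) = Gen2 x)))
           else if x \<in> \<Gamma>2 then Id1 (concat (map \<rho> (dom2 P x)))
           else Gen2 x)"

fun homotopical_reduction :: "('a, 'b, 'c) polygraph3
    \<Rightarrow> ('a, 'b, 'c) nielsen \<Rightarrow> ('a, 'b, 'c) part \<Rightarrow> ('a, 'b, 'c) polygraph3" where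
  "homotopical_reduction P (\<nu>2, \<nu>3, \<nu>4) (\<Gamma>2, \<Gamma>3, \<Gamma>4) =
    (let \<rho> = red1 \<nu>2 \<Gamma>2; \<sigma> = red2 P \<rho> \<Gamma>2 \<nu>3 \<Gamma>3 in
     \<lparr>gen1 = gen1 P - {x. \<exists>\<gamma>\<in>\<Gamma>2. snd (\<nu>2 \<gamma>) = [x]},
      gen2 = gen2 P - \<Gamma>2 - {x. \<exists>\<gamma>\<in>\<Gamma>3. snd (\<nu>3 \<gamma>) = Gen2 x},
      dom2 = (\<lambda>b. concat (map \<rho> (dom2 P b))),
      cod2 = (\<lambda>b. concat (map \<rho> (cod2 P b))),
      gen3 = gen3 P - \<Gamma>3 - {x. \<exists>\<gamma>\<in>\<Gamma>4. snd (\<nu>4 \<gamma>) = Gen3 x},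
      dom3 = (\<lambda>c. subst2 \<rho> \<sigma> (dom3 P c)),
      cod3 = (\<lambda>c. subst2 \<rho> \<sigma> (cod3 P c))\<rparr>)"

section \<open>Rows and right N-insertion\<close>

type_synonym row = "nat list"

definition rows :: "nat \<Rightarrow> row set" where
  "rows n = {u. u \<noteq> [] \<and> sorted_wrt (<) u \<and> set u \<subseteq> {1..n}}"

definition below :: "row \<Rightarrow> row \<Rightarrow> bool"  (infix \<open>\<triangleleft>\<close> 50) where
  "u \<triangleleft> v \<longleftrightarrow> set u \<subseteq> set v \<and> Min (set v) < Min (set u)"

text \<open>Insertion acts on the list of rows from bottom to top, whereas \<open>N\<close> returns it from top to
  bottom.  As the generator \<open>r\<^sub>u\<close> is identified with the row \<open>u\<close>, the list \<open>N w\<close> is also the word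
  \<open>\<R>(N(w))\<close>.\<close>

fun ins :: "nat \<Rightarrow> row list \<Rightarrow> row list" where
  "ins x [] = [[x]]"
| "ins x (u # us) = insort_insert x u #
     (if \<exists>y\<in>set u. x < y then ins (Min {y \<in> set u. x < y}) us else us)"

definition N :: "nat list \<Rightarrow> row list" where
  "N w = rev (foldl (\<lambda>T x. ins x T) [] w)"

section \<open>The coherent row presentation\<close>

type_synonym rcell2 = "(row, row \<times> row) cell2"
type_synonym rcell3 = "(row, row \<times> row, row \<times> row \<times> row) cell3"

definition row_pres :: "nat \<Rightarrow> (row, row \<times> row) polygraph2" where
  "row_pres n =
    \<lparr>gen1 = rows n,
     gen2 = {(u, v). u \<in> rows n \<and> v \<in> rows n \<and> \<not> u \<triangleleft> v},
     dom2 = (\<lambda>(u, v). [u, v]),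
     cod2 = (\<lambda>(u, v). N (u @ v))\<rparr>"

abbreviation \<alpha> :: "row \<Rightarrow> row \<Rightarrow> rcell2" where
  "\<alpha> u v \<equiv> Gen2 (u, v)"

text \<open>\<open>leftmost_path w f\<close>: the path \<open>f\<close> rewrites \<open>w\<close> to its normal form, reducing the leftmost reducible
  pair of adjacent rows at each step.\<close>

inductive leftmost_path :: "row list \<Rightarrow> rcell2 \<Rightarrow> bool" where
  "successively (\<triangleleft>) w \<Longrightarrow> leftmost_path w (Id1 w)"
| "successively (\<triangleleft>) (p @ [u]) \<Longrightarrow> \<not> u \<triangleleft> v \<Longrightarrow> leftmost_path (p @ N (u @ v) @ s) f
   \<Longrightarrow> leftmost_path (p @ [u, v] @ s) ((Id1 p \<star>\<^sub>0 \<alpha> u v \<star>\<^sub>0 Id1 s) \<star>\<^sub>1 f)"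

definition \<Lambda> :: "row list \<Rightarrow> rcell2" where
  "\<Lambda> w = (THE f. leftmost_path w f)"

definition critical :: "nat \<Rightarrow> (row \<times> row \<times> row) set" where
  "critical n = {(u, v, t). u \<in> rows n \<and> v \<in> rows n \<and> t \<in> rows n \<and> \<not> u \<triangleleft> v \<and> \<not> v \<triangleleft> t}"

definition row_coh :: "nat \<Rightarrow> (row, row \<times> row, row \<times> row \<times> row) polygraph3" where
  "row_coh n = polygraph2.extend (row_pres n)
    \<lparr>gen3 = critical n,
     dom3 = (\<lambda>(u, v, t). (\<alpha> u v \<star>\<^sub>0 Id1 [t]) \<star>\<^sub>1 \<Lambda> (N (u @ v) @ [t])),
     cod3 = (\<lambda>(u, v, t). (Id1 [u] \<star>\<^sub>0 \<alpha> v t) \<star>\<^sub>1 \<Lambda> ([u] @ N (v @ t)))\<rparr>"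

abbreviation \<X> :: "row \<Rightarrow> row \<Rightarrow> row \<Rightarrow> rcell3" where
  "\<X> u v t \<equiv> Gen3 (u, v, t)"

definition Xhat :: "row list \<Rightarrow> row \<Rightarrow> row \<Rightarrow> row \<Rightarrow> rcell3" where
  "Xhat w u v t = (\<X> u v t \<bullet>\<^sub>0 Id2 (Id1 w)) \<bullet>\<^sub>1 Id2 (\<Lambda> (N (u @ v @ t) @ w))"

section \<open>Splittable triples and their spheres\<close>

definition splittable :: "nat \<Rightarrow> (row \<times> row \<times> row) set" where
  "splittable n = {(u, v, t). (u, v, t) \<in> critical n \<and> length u \<ge> 2 \<and> \<not> tl u \<triangleleft> v}"

text \<open>In \<open>\<Theta>L\<close> and \<open>\<Theta>R\<close>, \<open>x\<close> is a letter and \<open>u'\<close> stands for \<open>\<partial>u\<close>, so that \<open>u = x # u'\<close>.  The normal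
  forms inspected by the case distinctions have one or two rows, so the \<open>undefined\<close> branches are never
  reached.  In \<open>\<Theta>L\<close>, the path \<open>\<Lambda> [a, b, t]\<close> starts with the step on \<open>(b, t)\<close>; if \<open>N (b @ t) = [e, f]\<close>, it
  has a second step exactly when \<open>a\<close> and \<open>e\<close> can be reduced.  The Peiffer identities are the identity
  3-cells on the composite that performs the two exchanged steps side by side (\<open>\<alpha> [x] a \<star>\<^sub>0 \<alpha> b t\<close>,
  \<open>\<alpha> [x] i \<star>\<^sub>0 \<alpha> j d\<close>); both sequential orders are \<open>eq2\<close>-equal to it.\<close>

definition \<Theta>L :: "nat \<Rightarrow> row \<Rightarrow> row \<Rightarrow> row \<Rightarrow> rcell3" where
  "\<Theta>L x u' v t =
    (case N (u' @ v) of
       [b] \<Rightarrow> \<X> [x] b t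
     | [a, b] \<Rightarrow>
        (let K = (if x # a \<triangleleft> b then Id2 (\<Lambda> [x # a, b, t]) else \<X> (x # a) b t);
             first = Id2 (\<alpha> [x] a \<star>\<^sub>0 Id1 [b] \<star>\<^sub>0 Id1 [t]) \<bullet>\<^sub>1 K;
             peiffer = Id2 ((\<alpha> [x] a \<star>\<^sub>0 \<alpha> b t) \<star>\<^sub>1 \<Lambda> ([x # a] @ N (b @ t)))
         in case N (b @ t) of
              [e, f] \<Rightarrow>
                if a \<triangleleft> e then first \<bullet>\<^sub>2 peiffer
                else first \<bullet>\<^sub>2 peiffer \<bullet>\<^sub>2
                     (Id2 (Id1 [[x]] \<star>\<^sub>0 Id1 [a] \<star>\<^sub>0 \<alpha> b t) \<bullet>\<^sub>1 Xhat [f] [x] a e)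
            | _ \<Rightarrow> first \<bullet>\<^sub>2 peiffer)
     | _ \<Rightarrow> undefined)"

definition \<Theta>R :: "nat \<Rightarrow> row \<Rightarrow> row \<Rightarrow> row \<Rightarrow> rcell3" where
  "\<Theta>R x u' v t =
    (case N (v @ t) of
       [d] \<Rightarrow>
         if u' \<triangleleft> d then Id2 ((\<alpha> [x] u' \<star>\<^sub>0 Id1 [d]) \<star>\<^sub>1 \<Lambda> [x # u', d])
         else \<X> [x] u' d
     | [c, d] \<Rightarrow>
        (let K0 = Xhat [d] [x] u' c;
             step = Id1 [[x]] \<star>\<^sub>0 \<alpha> u' c \<star>\<^sub>0 Id1 [d]
         in case N (u' @ c) of
              [g] \<Rightarrow> if g \<triangleleft> d then K0 else K0 \<bullet>\<^sub>2 (Id2 step \<bullet>\<^sub>1 \<X> [x] g d)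
            | [i, j] \<Rightarrow>
                if j \<triangleleft> d then K0
                else
                 (let K1 = (if x # i \<triangleleft> j then Id2 (\<Lambda> [x # i, j, d]) else \<X> (x # i) j d);
                      peiffer = Id2 (step \<star>\<^sub>1 (\<alpha> [x] i \<star>\<^sub>0 \<alpha> j d) \<star>\<^sub>1 \<Lambda> ([x # i] @ N (j @ d)))
                  in K0 \<bullet>\<^sub>2
                     (Id2 (step \<star>\<^sub>1 (\<alpha> [x] i \<star>\<^sub>0 Id1 [j] \<star>\<^sub>0 Id1 [d])) \<bullet>\<^sub>1 K1) \<bullet>\<^sub>2
                     peiffer)
            | _ \<Rightarrow> undefined)
     | _ \<Rightarrow> undefined)"

fun \<Psi> :: "row \<times> row \<times> row \<Rightarrow> rcell3" where
  "\<Psi> (u, v, t) =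
    (let x = hd u; u' = tl u;
         M = N (u @ v); V = N (v @ t); Z = N (u' @ v @ t);
         q = \<Lambda> ([x] # Z); h = \<Lambda> (M @ [t]); \<rho> = \<Lambda> ([u] @ V);
         B = Id1 [[x]] \<star>\<^sub>0 \<alpha> u' v \<star>\<^sub>0 Id1 [t];
         C = Id1 [[x]] \<star>\<^sub>0 Id1 [u'] \<star>\<^sub>0 \<alpha> v t;
         F1 = (\<X> [x] u' v \<bullet>\<^sub>0 Id2 (Id1 [t])) \<bullet>\<^sub>1 Id2 h;
         F2 = Id2 B \<bullet>\<^sub>1 \<Theta>L x u' v t;
         F3 = (Id2 (Id1 [[x]]) \<bullet>\<^sub>0 \<X> u' v t) \<bullet>\<^sub>1 Id2 q;
         F4 = Id2 C \<bullet>\<^sub>1 Inv3 (\<Theta>R x u' v t);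
         peiffer = Id2 (C \<star>\<^sub>1 (\<alpha> [x] u' \<star>\<^sub>0 Id1 V));
         F5 = peiffer \<bullet>\<^sub>1 Id2 \<rho>
     in F1 \<bullet>\<^sub>2 F2 \<bullet>\<^sub>2 F3 \<bullet>\<^sub>2 F4 \<bullet>\<^sub>2 F5)"

fun \<Omega> :: "row \<times> row \<times> row \<Rightarrow> rcell3 \<times> rcell3" where
  "\<Omega> (u, v, t) =
    (let A = \<alpha> [hd u] (tl u) \<star>\<^sub>0 Id1 [v] \<star>\<^sub>0 Id1 [t]
     in (Id2 (Inv2 A) \<bullet>\<^sub>1 \<Psi> (u, v, t), \<X> u v t))"

definition spl_part :: "nat \<Rightarrow> (row, row \<times> row, row \<times> row \<times> row) part" where
  "spl_part n = ({}, {}, {\<Omega> \<tau> | \<tau>. \<tau> \<in> splittable n})"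

definition row_scoh :: "nat \<Rightarrow> (row, row \<times> row, row \<times> row \<times> row) polygraph3" where
  "row_scoh n = homotopical_reduction (row_coh n) (no_nielsen (row_coh n)) (spl_part n)"

end

theory Submission
  imports Defs
begin

text \<open>
  Inserting a row \<open>v\<close> below a row \<open>u\<close> unites the two supports and bumps a subset of \<open>u\<close>.
  Since insertion respects the stylic relations, every row word has the reading of its \<open>N\<close>-tableau
  as its normal form, and this gives the presentation and the confluence of the row rewriting system.
  Squier's argument, a Noetherian induction over reductions, then shows that two parallel 2-cells are
  filled as soon as the boundary of every critical triple is.

  The source of \<open>\<Omega> \<tau>\<close> is parallel to the generator of \<open>\<tau>\<close>, and all triples \<open>(u, v, t)\<close> occurring in it
  are smaller than \<open>\<tau>\<close> when compared first by the length of \<open>u\<close>, and then, in reverse, by the sums of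
  letters of \<open>t\<close> and of \<open>v\<close>.  By well-founded induction the boundaries of splittable triples are thus
  filled by means of the remaining generators.
\<close>

section \<open>Calculus of cells\<close>

text \<open>Only 3-cells are collapsed, so the reduction functor is the identity on 1- and 2-cells
  and the reduced polygraph is \<open>row_coh n\<close> with fewer generating 3-cells. Its coherence
  is proved directly: Squier's argument is run over an arbitrary set \<open>C\<close> of critical
  triples, assuming that the boundaries of all critical triples are filled, not that each has a
  generator of its own. The obstacle is that 2-cells are formal composites modulo
  \<open>eq2\<close>. Apart from the one inverse in each sphere, the composites to be compared
  contain no formal inverses, and they are told apart by the sequence of generators they perform;
  only the Peiffer identities need an exchange of neighbouring steps. Confluence needs no inspection
  of critical pairs, because the tableau of a word is unchanged by every reduction. Termination and
  the order on triples need a genuine measure each, since a product of rows may copy letters and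
  enlarge rows.\<close>

definition bounded2 :: "('a, 'b, 'z) polygraph2_scheme \<Rightarrow> bool" where
  "bounded2 P \<longleftrightarrow> (\<forall>b\<in>gen2 P. dom2 P b \<in> lists (gen1 P) \<and> cod2 P b \<in> lists (gen1 P))"

lemmas [trans] = eq2.trans eq3.trans

lemma eq2_cong0_right: "is_cell2 P f \<Longrightarrow> eq2 P g g' \<Longrightarrow> eq2 P (f \<star>\<^sub>0 g) (f \<star>\<^sub>0 g')"
  by (intro eq2.cong0 eq2.refl)

lemma eq2_cong0_left: "is_cell2 P g \<Longrightarrow> eq2 P f f' \<Longrightarrow> eq2 P (f \<star>\<^sub>0 g) (f' \<star>\<^sub>0 g)"
  by (intro eq2.cong0 eq2.refl)

lemma eq2_cong1_right: "eq2 P g g' \<Longrightarrow> is_cell2 P (f \<star>\<^sub>1 g) \<Longrightarrow> eq2 P (f \<star>\<^sub>1 g) (f \<star>\<^sub>1 g')"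
  by (intro eq2.cong1 eq2.refl) auto

lemma eq2_cong1_left: "eq2 P f f' \<Longrightarrow> is_cell2 P (f \<star>\<^sub>1 g) \<Longrightarrow> eq2 P (f \<star>\<^sub>1 g) (f' \<star>\<^sub>1 g)"
  by (intro eq2.cong1 eq2.refl) auto

section \<open>Positive cells as sequences of whiskered generators\<close>

primrec positive :: "('a, 'b) cell2 \<Rightarrow> bool" where
  "positive (Id1 w) \<longleftrightarrow> True"
| "positive (Gen2 b) \<longleftrightarrow> True"
| "positive (f \<star>\<^sub>0 g) \<longleftrightarrow> positive f \<and> positive g"
| "positive (f \<star>\<^sub>1 g) \<longleftrightarrow> positive f \<and> positive g"
| "positive (Inv2 f) \<longleftrightarrow> False"

text \<open>A positive cell is a sequence of elementary steps, each a whiskered generator.  Two positive cells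
  with the same sequence are equal, which decides all identities below except the Peiffer ones.\<close>

type_synonym ('a, 'b) step = "'a list \<times> 'b \<times> 'a list"

abbreviation whisker :: "'a list \<Rightarrow> 'a list \<Rightarrow> ('a, 'b) step list \<Rightarrow> ('a, 'b) step list" where
  "whisker u v \<equiv> map (\<lambda>(p, b, s). (u @ p, b, s @ v))"

lemma whisker_Nil [simp]: "whisker [] [] l = l"
  by (induction l) auto

text \<open>In a product the steps of the left factor come first, each beside the source of the
  right factor. The value at \<open>Inv2\<close> is a default: \<open>flat_steps\<close> assumes
  \<open>positive\<close>.\<close>

primrec flat :: "('a, 'b, 'z) polygraph2_scheme \<Rightarrow> ('a, 'b) cell2 \<Rightarrow> ('a, 'b) step list" where
  "flat P (Id1 w) = []"
| "flat P (Gen2 b) = [([], b, [])]"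
| "flat P (f \<star>\<^sub>0 g) = whisker [] (src1 P g) (flat P f) @ whisker (tgt1 P f) [] (flat P g)"
| "flat P (f \<star>\<^sub>1 g) = flat P f @ flat P g"
| "flat P (Inv2 f) = []"

primrec steps :: "('a, 'b, 'z) polygraph2_scheme \<Rightarrow> 'a list \<Rightarrow> ('a, 'b) step list \<Rightarrow> ('a, 'b) cell2" where
  "steps P w [] = Id1 w"
| "steps P w (e # l) =
    (case e of (p, b, s) \<Rightarrow> (Id1 p \<star>\<^sub>0 Gen2 b \<star>\<^sub>0 Id1 s) \<star>\<^sub>1 steps P (p @ cod2 P b @ s) l)"

fun chain :: "('a, 'b, 'z) polygraph2_scheme \<Rightarrow> 'a list \<Rightarrow> ('a, 'b) step list \<Rightarrow> 'a list \<Rightarrow> bool" where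
  "chain P w [] w' \<longleftrightarrow> w = w' \<and> w \<in> lists (gen1 P)"
| "chain P w ((p, b, s) # l) w' \<longleftrightarrow> w = p @ dom2 P b @ s \<and> b \<in> gen2 P \<and> p \<in> lists (gen1 P) \<and>
     s \<in> lists (gen1 P) \<and> chain P (p @ cod2 P b @ s) l w'"

context
  fixes P :: "('a, 'b, 'z) polygraph2_scheme"
  assumes bounded: "bounded2 P"
begin

lemma is_cell2_lists: "is_cell2 P f \<Longrightarrow> src1 P f \<in> lists (gen1 P) \<and> tgt1 P f \<in> lists (gen1 P)"
  by (induction f) (use bounded in \<open>auto simp: bounded2_def\<close>)

text \<open>The unit and inverse laws introduce identities on boundary words. These are cells
  because generators have their boundaries over \<open>gen1\<close>, which is where
  \<open>bounded2\<close> enters.\<close>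

lemma eq2_parallel:
  "eq2 P f g \<Longrightarrow> is_cell2 P f \<and> is_cell2 P g \<and> src1 P f = src1 P g \<and> tgt1 P f = tgt1 P g"
proof (induction rule: eq2.induct)
  case (unit1_left f)
  then show ?case using is_cell2_lists[of f] by simp
next
  case (unit1_right f)
  then show ?case using is_cell2_lists[of f] by simp
next
  case (inv_left f)
  then show ?case using is_cell2_lists[of f] by simp
next
  case (inv_right f)
  then show ?case using is_cell2_lists[of f] by simp
qed auto

lemma chain_steps: "chain P w l w' \<Longrightarrow> is_cell2 P (steps P w l) \<and> src1 P (steps P w l) = w \<and> tgt1 P (steps P w l) = w'"
  by (induction l arbitrary: w) auto

lemma chain_lists: "chain P w l w' \<Longrightarrow> w \<in> lists (gen1 P) \<and> w' \<in> lists (gen1 P)"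
  using chain_steps[of w l w'] is_cell2_lists[of "steps P w l"] by simp

lemma chain_append: "chain P w (l1 @ l2) w'' \<longleftrightarrow> (\<exists>w'. chain P w l1 w' \<and> chain P w' l2 w'')"
proof (induction l1 arbitrary: w)
  case Nil
  show ?case using chain_lists[of w l2 w''] by auto
qed auto

lemma chain_whisker: "chain P w l w' \<Longrightarrow> u \<in> lists (gen1 P) \<Longrightarrow> v \<in> lists (gen1 P) \<Longrightarrow>
    chain P (u @ w @ v) (whisker u v l) (u @ w' @ v)"
proof (induction l arbitrary: w)
  case (Cons e l)
  obtain p b s where "e = (p, b, s)" by (cases e) auto
  then show ?case using Cons.prems Cons.IH[of "p @ cod2 P b @ s"] by simp
qed auto

lemma steps_append:
  "chain P w l1 w' \<Longrightarrow> chain P w' l2 w'' \<Longrightarrow> eq2 P (steps P w (l1 @ l2)) (steps P w l1 \<star>\<^sub>1 steps P w' l2)"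
proof (induction l1 arbitrary: w)
  case Nil
  then show ?case using chain_steps[OF Nil(2)] eq2.unit1_left[of P "steps P w l2"]
    by (auto intro: eq2.sym)
next
  case (Cons e l)
  then obtain p b s where e: "e = (p, b, s)" by (cases e) auto
  note 2 = Cons[unfolded e]
  let ?s = "Id1 p \<star>\<^sub>0 Gen2 b \<star>\<^sub>0 Id1 s"
  have c: "is_cell2 P (?s \<star>\<^sub>1 steps P (p @ cod2 P b @ s) l \<star>\<^sub>1 steps P w' l2)"
    using 2 chain_steps[of "p @ cod2 P b @ s" l w'] chain_steps[of w' l2 w''] by auto
  have c': "is_cell2 P (?s \<star>\<^sub>1 steps P (p @ cod2 P b @ s) (l @ l2))"
  proof -
    have "chain P (p @ cod2 P b @ s) (l @ l2) w''" using 2 by (auto simp: chain_append)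
    from chain_steps[OF this] 2 show ?thesis by auto
  qed
  have "eq2 P (?s \<star>\<^sub>1 steps P (p @ cod2 P b @ s) (l @ l2))
     (?s \<star>\<^sub>1 steps P (p @ cod2 P b @ s) l \<star>\<^sub>1 steps P w' l2)"
    using 2 c' by (intro eq2_cong1_right) auto
  from eq2.trans[OF this eq2.sym[OF eq2.assoc1[OF c]]] show ?case by (simp add: e)
qed

lemma steps_whisker_right:
  "chain P w l w' \<Longrightarrow> v \<in> lists (gen1 P) \<Longrightarrow> eq2 P (steps P w l \<star>\<^sub>0 Id1 v) (steps P (w @ v) (whisker [] v l))"
proof (induction l arbitrary: w)
  case Nil
  then show ?case using eq2.id_comp0[of P w v] by auto
next
  case (Cons e l)
  then obtain p b s where e: "e = (p, b, s)" by (cases e) auto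
  note 2 = Cons[unfolded e]
  let ?s = "Id1 p \<star>\<^sub>0 Gen2 b \<star>\<^sub>0 Id1 s" and ?w = "p @ cod2 P b @ s"
  have c: "chain P ?w l w'" using 2 by simp
  note cs = chain_steps[OF c]
  \<comment> \<open>Splitting the identity lets the exchange law separate the first step from the
    rest.\<close>
  have v: "eq2 P (Id1 v) (Id1 v \<star>\<^sub>1 Id1 v)"
    using eq2.unit1_left[of P "Id1 v"] 2 by (auto intro: eq2.sym)
  have "eq2 P ((?s \<star>\<^sub>1 steps P ?w l) \<star>\<^sub>0 Id1 v) ((?s \<star>\<^sub>1 steps P ?w l) \<star>\<^sub>0 (Id1 v \<star>\<^sub>1 Id1 v))"
    using 2 cs by (intro eq2_cong0_right v) auto
  also have "eq2 P ((?s \<star>\<^sub>1 steps P ?w l) \<star>\<^sub>0 (Id1 v \<star>\<^sub>1 Id1 v))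
      ((?s \<star>\<^sub>0 Id1 v) \<star>\<^sub>1 (steps P ?w l \<star>\<^sub>0 Id1 v))"
    using 2 cs by (intro eq2.exchange) auto
  also have "eq2 P ((?s \<star>\<^sub>0 Id1 v) \<star>\<^sub>1 (steps P ?w l \<star>\<^sub>0 Id1 v))
      ((Id1 p \<star>\<^sub>0 Gen2 b \<star>\<^sub>0 Id1 (s @ v)) \<star>\<^sub>1 steps P (?w @ v) (whisker [] v l))"
  proof (rule eq2.cong1)
    have "eq2 P (?s \<star>\<^sub>0 Id1 v) (Id1 p \<star>\<^sub>0 (Gen2 b \<star>\<^sub>0 Id1 s) \<star>\<^sub>0 Id1 v)"
      using 2 by (intro eq2.assoc0) auto
    also have "eq2 P (Id1 p \<star>\<^sub>0 (Gen2 b \<star>\<^sub>0 Id1 s) \<star>\<^sub>0 Id1 v) (Id1 p \<star>\<^sub>0 Gen2 b \<star>\<^sub>0 Id1 s \<star>\<^sub>0 Id1 v)"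
      using 2 by (intro eq2_cong0_right eq2.assoc0) auto
    also have "eq2 P (Id1 p \<star>\<^sub>0 Gen2 b \<star>\<^sub>0 Id1 s \<star>\<^sub>0 Id1 v) (Id1 p \<star>\<^sub>0 Gen2 b \<star>\<^sub>0 Id1 (s @ v))"
      using 2 by (intro eq2_cong0_right eq2.id_comp0) auto
    finally show "eq2 P (?s \<star>\<^sub>0 Id1 v) (Id1 p \<star>\<^sub>0 Gen2 b \<star>\<^sub>0 Id1 (s @ v))" .
  qed (use 2 cs 2(1)[OF c] in auto)
  finally show ?case by (simp add: e)
qed

lemma steps_whisker_left:
  "chain P w l w' \<Longrightarrow> u \<in> lists (gen1 P) \<Longrightarrow> eq2 P (Id1 u \<star>\<^sub>0 steps P w l) (steps P (u @ w) (whisker u [] l))"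
proof (induction l arbitrary: w)
  case Nil
  then show ?case using eq2.id_comp0[of P u w] by auto
next
  case (Cons e l)
  then obtain p b s where e: "e = (p, b, s)" by (cases e) auto
  note 2 = Cons[unfolded e]
  let ?s = "Id1 p \<star>\<^sub>0 Gen2 b \<star>\<^sub>0 Id1 s" and ?w = "p @ cod2 P b @ s"
  have c: "chain P ?w l w'" using 2 by simp
  note cs = chain_steps[OF c]
  have u: "eq2 P (Id1 u) (Id1 u \<star>\<^sub>1 Id1 u)"
    using eq2.unit1_left[of P "Id1 u"] 2 by (auto intro: eq2.sym)
  have "eq2 P (Id1 u \<star>\<^sub>0 (?s \<star>\<^sub>1 steps P ?w l)) ((Id1 u \<star>\<^sub>1 Id1 u) \<star>\<^sub>0 (?s \<star>\<^sub>1 steps P ?w l))"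
    using 2 cs by (intro eq2_cong0_left u) auto
  also have "eq2 P ((Id1 u \<star>\<^sub>1 Id1 u) \<star>\<^sub>0 (?s \<star>\<^sub>1 steps P ?w l))
      ((Id1 u \<star>\<^sub>0 ?s) \<star>\<^sub>1 (Id1 u \<star>\<^sub>0 steps P ?w l))"
    using 2 cs by (intro eq2.exchange) auto
  also have "eq2 P ((Id1 u \<star>\<^sub>0 ?s) \<star>\<^sub>1 (Id1 u \<star>\<^sub>0 steps P ?w l))
      ((Id1 (u @ p) \<star>\<^sub>0 Gen2 b \<star>\<^sub>0 Id1 s) \<star>\<^sub>1 steps P (u @ ?w) (whisker u [] l))"
  proof (rule eq2.cong1)
    have "eq2 P (Id1 u \<star>\<^sub>0 ?s) ((Id1 u \<star>\<^sub>0 Id1 p) \<star>\<^sub>0 Gen2 b \<star>\<^sub>0 Id1 s)"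
      using 2 by (intro eq2.sym[OF eq2.assoc0]) auto
    also have "eq2 P ((Id1 u \<star>\<^sub>0 Id1 p) \<star>\<^sub>0 Gen2 b \<star>\<^sub>0 Id1 s) (Id1 (u @ p) \<star>\<^sub>0 Gen2 b \<star>\<^sub>0 Id1 s)"
      using 2 by (intro eq2_cong0_left eq2.id_comp0) auto
    finally show "eq2 P (Id1 u \<star>\<^sub>0 ?s) (Id1 (u @ p) \<star>\<^sub>0 Gen2 b \<star>\<^sub>0 Id1 s)" .
  qed (use 2 cs 2(1)[OF c] in auto)
  finally show ?case by (simp add: e)
qed


text \<open>Units are added on opposite sides of the two factors before exchanging, which makes the
  left factor act first. Adding them the other way round gives \<open>interchange_right\<close>, and
  comparing the two results is the Peiffer law.\<close>

lemma interchange_left: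
  assumes "is_cell2 P f" "is_cell2 P g"
  shows "eq2 P (f \<star>\<^sub>0 g) ((f \<star>\<^sub>0 Id1 (src1 P g)) \<star>\<^sub>1 (Id1 (tgt1 P f) \<star>\<^sub>0 g))"
proof -
  have "eq2 P (f \<star>\<^sub>0 g) ((f \<star>\<^sub>1 Id1 (tgt1 P f)) \<star>\<^sub>0 (Id1 (src1 P g) \<star>\<^sub>1 g))"
    using assms by (intro eq2.cong0 eq2.sym[OF eq2.unit1_left] eq2.sym[OF eq2.unit1_right])
  also have "eq2 P ((f \<star>\<^sub>1 Id1 (tgt1 P f)) \<star>\<^sub>0 (Id1 (src1 P g) \<star>\<^sub>1 g))
     ((f \<star>\<^sub>0 Id1 (src1 P g)) \<star>\<^sub>1 (Id1 (tgt1 P f) \<star>\<^sub>0 g))"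
    using assms by (intro eq2.exchange) (simp add: is_cell2_lists del: in_lists_conv_set)
  finally show ?thesis .
qed

lemma interchange_right:
  assumes "is_cell2 P f" "is_cell2 P g"
  shows "eq2 P (f \<star>\<^sub>0 g) ((Id1 (src1 P f) \<star>\<^sub>0 g) \<star>\<^sub>1 (f \<star>\<^sub>0 Id1 (tgt1 P g)))"
proof -
  have "eq2 P (f \<star>\<^sub>0 g) ((Id1 (src1 P f) \<star>\<^sub>1 f) \<star>\<^sub>0 (g \<star>\<^sub>1 Id1 (tgt1 P g)))"
    using assms by (intro eq2.cong0 eq2.sym[OF eq2.unit1_left] eq2.sym[OF eq2.unit1_right])
  also have "eq2 P ((Id1 (src1 P f) \<star>\<^sub>1 f) \<star>\<^sub>0 (g \<star>\<^sub>1 Id1 (tgt1 P g)))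
     ((Id1 (src1 P f) \<star>\<^sub>0 g) \<star>\<^sub>1 (f \<star>\<^sub>0 Id1 (tgt1 P g)))"
    using assms by (intro eq2.exchange) (simp add: is_cell2_lists del: in_lists_conv_set)
  finally show ?thesis .
qed

text \<open>A normal form for positive cells: associativity and units are absorbed by the list, and
  products are sequentialized by \<open>interchange_left\<close>, in the order fixed by
  \<open>flat\<close>.\<close>

lemma flat_steps:
  shows "is_cell2 P f \<Longrightarrow> positive f \<Longrightarrow>
    chain P (src1 P f) (flat P f) (tgt1 P f) \<and> eq2 P f (steps P (src1 P f) (flat P f))"
proof (induction f)
  case (Id1 w)
  then show ?case by (auto intro: eq2.refl)
next
  case (Gen2 b)
  then have b: "cod2 P b \<in> lists (gen1 P)" "dom2 P b \<in> lists (gen1 P)"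
    using bounded by (auto simp: bounded2_def)
  then have c: "chain P (src1 P (Gen2 b)) (flat P (Gen2 b)) (tgt1 P (Gen2 b))"
    using Gen2 by auto
  have "eq2 P (Id1 [] \<star>\<^sub>0 Gen2 b \<star>\<^sub>0 Id1 []) (Gen2 b \<star>\<^sub>0 Id1 [])"
    using Gen2 by (intro eq2.unit0_left) auto
  also have "eq2 P (Gen2 b \<star>\<^sub>0 Id1 []) (Gen2 b)"
    using Gen2 by (intro eq2.unit0_right) auto
  finally have 1: "eq2 P (Id1 [] \<star>\<^sub>0 Gen2 b \<star>\<^sub>0 Id1 []) (Gen2 b)" .
  have "eq2 P ((Id1 [] \<star>\<^sub>0 Gen2 b \<star>\<^sub>0 Id1 []) \<star>\<^sub>1 Id1 (cod2 P b)) (Gen2 b \<star>\<^sub>1 Id1 (cod2 P b))"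
    using Gen2 b by (intro eq2_cong1_left 1) auto
  also have "eq2 P (Gen2 b \<star>\<^sub>1 Id1 (cod2 P b)) (Gen2 b)"
    using Gen2 eq2.unit1_right[of P "Gen2 b"] by auto
  finally show ?case using c by (auto intro: eq2.sym)
next
  case (Comp20 f g)
  then have f: "is_cell2 P f" "chain P (src1 P f) (flat P f) (tgt1 P f)" "eq2 P f (steps P (src1 P f) (flat P f))"
   and g: "is_cell2 P g" "chain P (src1 P g) (flat P g) (tgt1 P g)" "eq2 P g (steps P (src1 P g) (flat P g))" by auto
  note l = is_cell2_lists[OF f(1)] is_cell2_lists[OF g(1)]
  have c1: "chain P (src1 P f @ src1 P g) (whisker [] (src1 P g) (flat P f)) (tgt1 P f @ src1 P g)"
    using chain_whisker[OF f(2), of "[]" "src1 P g"] l by simp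
  have c2: "chain P (tgt1 P f @ src1 P g) (whisker (tgt1 P f) [] (flat P g)) (tgt1 P f @ tgt1 P g)"
    using chain_whisker[OF g(2), of "tgt1 P f" "[]"] l by simp
  have "eq2 P (f \<star>\<^sub>0 g) ((f \<star>\<^sub>0 Id1 (src1 P g)) \<star>\<^sub>1 (Id1 (tgt1 P f) \<star>\<^sub>0 g))"
    using f g by (intro interchange_left)
  also have "eq2 P ((f \<star>\<^sub>0 Id1 (src1 P g)) \<star>\<^sub>1 (Id1 (tgt1 P f) \<star>\<^sub>0 g))
    (steps P (src1 P f @ src1 P g) (whisker [] (src1 P g) (flat P f)) \<star>\<^sub>1
     steps P (tgt1 P f @ src1 P g) (whisker (tgt1 P f) [] (flat P g)))"
  proof (rule eq2.cong1)
    show "eq2 P (f \<star>\<^sub>0 Id1 (src1 P g)) (steps P (src1 P f @ src1 P g) (whisker [] (src1 P g) (flat P f)))"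
      using f(2) l by (intro eq2.trans[OF eq2_cong0_left[OF _ f(3)] steps_whisker_right[OF f(2)]]) auto
    show "eq2 P (Id1 (tgt1 P f) \<star>\<^sub>0 g) (steps P (tgt1 P f @ src1 P g) (whisker (tgt1 P f) [] (flat P g)))"
      using f(2) l by (intro eq2.trans[OF eq2_cong0_right[OF _ g(3)] steps_whisker_left[OF g(2)]]) auto
  qed (use f g l in auto)
  also have "eq2 P \<dots> (steps P (src1 P f @ src1 P g) (flat P (f \<star>\<^sub>0 g)))"
    using steps_append[OF c1 c2] by (auto intro: eq2.sym)
  finally show ?case using c1 c2 by (auto simp: chain_append)
next
  case (Comp21 f g)
  then have f: "is_cell2 P f" "chain P (src1 P f) (flat P f) (tgt1 P f)" "eq2 P f (steps P (src1 P f) (flat P f))"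
   and g: "is_cell2 P g" "chain P (src1 P g) (flat P g) (tgt1 P g)" "eq2 P g (steps P (src1 P g) (flat P g))"
   and t: "tgt1 P f = src1 P g" by auto
  have "eq2 P (f \<star>\<^sub>1 g) (steps P (src1 P f) (flat P f) \<star>\<^sub>1 steps P (src1 P g) (flat P g))"
    using f g t by (intro eq2.cong1) auto
  also have "eq2 P \<dots> (steps P (src1 P f) (flat P f @ flat P g))"
    using f g t by (intro eq2.sym[OF steps_append]) auto
  finally show ?case using f g t by (auto simp: chain_append)
qed simp

text \<open>Reduces an equality of 2-cells to typing conditions and an equation between lists, which
  simplification can settle. It is sound but not complete, since the two orders of disjoint steps
  have different lists.\<close>

lemma eq2_flatI:
  assumes "is_cell2 P f" "is_cell2 P g" "positive f" "positive g"
    "src1 P f = src1 P g" "flat P f = flat P g"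
  shows "eq2 P f g"
  using flat_steps[OF assms(1,3)] flat_steps[OF assms(2,4)] assms(5,6)
  by (metis eq2.sym eq2.trans)

text \<open>The redexes of \<open>b\<close> and \<open>b'\<close> are disjoint, separated by
  \<open>m\<close>. Cutting the word after \<open>m\<close> presents both sequences as the
  flattenings of the two interchange forms of a single product.\<close>

lemma steps_swap:
  assumes "chain P w [(p, b, m @ dom2 P b' @ s), (p @ cod2 P b @ m, b', s)] w'"
  shows "eq2 P (steps P w [(p, b, m @ dom2 P b' @ s), (p @ cod2 P b @ m, b', s)])
     (steps P w [(p @ dom2 P b @ m, b', s), (p, b, m @ cod2 P b' @ s)])"
    and "chain P w [(p @ dom2 P b @ m, b', s), (p, b, m @ cod2 P b' @ s)] w'"
proof -
  let ?f = "Id1 p \<star>\<^sub>0 Gen2 b \<star>\<^sub>0 Id1 m" and ?g = "Gen2 b' \<star>\<^sub>0 Id1 s"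
  have c: "is_cell2 P ?f" "is_cell2 P ?g" using assms by auto
  have l: "src1 P ?f \<in> lists (gen1 P)" "tgt1 P ?f \<in> lists (gen1 P)" "src1 P ?g \<in> lists (gen1 P)"
    "tgt1 P ?g \<in> lists (gen1 P)" using is_cell2_lists c by blast+
  have w: "w = src1 P ?f @ src1 P ?g" using assms by simp
  let ?L = "(?f \<star>\<^sub>0 Id1 (src1 P ?g)) \<star>\<^sub>1 (Id1 (tgt1 P ?f) \<star>\<^sub>0 ?g)"
  let ?R = "(Id1 (src1 P ?f) \<star>\<^sub>0 ?g) \<star>\<^sub>1 (?f \<star>\<^sub>0 Id1 (tgt1 P ?g))"
  have "eq2 P ?L ?R"
    using interchange_left[OF c] interchange_right[OF c] by (blast intro: eq2.trans eq2.sym)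
  moreover from this have cells: "is_cell2 P ?L" "is_cell2 P ?R" using eq2_parallel by blast+
  note flat_steps[OF cells(1)] flat_steps[OF cells(2)]
  ultimately show
    "eq2 P (steps P w [(p, b, m @ dom2 P b' @ s), (p @ cod2 P b @ m, b', s)])
     (steps P w [(p @ dom2 P b @ m, b', s), (p, b, m @ cod2 P b' @ s)])"
    "chain P w [(p @ dom2 P b @ m, b', s), (p, b, m @ cod2 P b' @ s)] w'"
    using assms by (auto simp del: steps.simps intro: eq2.trans eq2.sym)
qed

text \<open>Each Peiffer identity below is one such swap between a common beginning
  \<open>l1\<close> and a common end \<open>l2\<close>.\<close>

lemma eq2_flat_swapI:
  assumes "is_cell2 P f" "is_cell2 P g" "positive f" "positive g"
    "src1 P f = src1 P g"
    "flat P f = l1 @ [(p, b, m @ dom2 P b' @ s), (p @ cod2 P b @ m, b', s)] @ l2"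
    "flat P g = l1 @ [(p @ dom2 P b @ m, b', s), (p, b, m @ cod2 P b' @ s)] @ l2"
  shows "eq2 P f g"
proof -
  let ?l = "[(p, b, m @ dom2 P b' @ s), (p @ cod2 P b @ m, b', s)]"
  let ?r = "[(p @ dom2 P b @ m, b', s), (p, b, m @ cod2 P b' @ s)]"
  note f = flat_steps[OF assms(1,3)] and g = flat_steps[OF assms(2,4)]
  obtain w1 w2 where c1: "chain P (src1 P f) l1 w1" and c: "chain P w1 ?l w2" and c2: "chain P w2 l2 (tgt1 P f)"
    using f unfolding assms(6) chain_append by blast
  note swap = steps_swap[OF c]
  have "eq2 P f (steps P (src1 P f) (l1 @ ?l @ l2))" using f assms(6) by simp
  also have "eq2 P \<dots> (steps P (src1 P f) l1 \<star>\<^sub>1 steps P w1 (?l @ l2))"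
    using c c2 c1 unfolding chain_append by (intro steps_append) (auto simp: chain_append simp del: chain.simps append.simps)
  also have "eq2 P \<dots> (steps P (src1 P f) l1 \<star>\<^sub>1 (steps P w1 ?l \<star>\<^sub>1 steps P w2 l2))"
    using chain_steps[OF c1] steps_append[OF c c2] eq2_parallel[OF steps_append[OF c c2]]  chain_steps[OF c]
    by (intro eq2_cong1_right) (auto simp del: steps.simps append.simps)
  also have "eq2 P \<dots> (steps P (src1 P f) l1 \<star>\<^sub>1 (steps P w1 ?r \<star>\<^sub>1 steps P w2 l2))"
    using chain_steps[OF c1] chain_steps[OF c] chain_steps[OF c2] swap
    by (intro eq2_cong1_right eq2_cong1_left) (auto simp del: steps.simps append.simps)
  also have "eq2 P \<dots> (steps P (src1 P f) l1 \<star>\<^sub>1 steps P w1 (?r @ l2))"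
    using chain_steps[OF c1] steps_append[OF swap(2) c2] eq2_parallel[OF steps_append[OF swap(2) c2]] chain_steps[OF swap(2)]
    by (intro eq2_cong1_right) (auto simp del: steps.simps append.simps intro: eq2.sym)
  also have "eq2 P \<dots> (steps P (src1 P f) (l1 @ ?r @ l2))"
    using swap(2) c2 c1 by (intro eq2.sym[OF steps_append]) (auto simp: chain_append simp del: chain.simps append.simps)
  also have "eq2 P \<dots> g" using g assms(5,7) by (simp add: eq2.sym)
  finally show ?thesis .
qed

end

section \<open>Fillers\<close>

lemma src_tgt1_gen3 [simp]:
  "src1 (P\<lparr>gen3 := C\<rparr>) f = src1 P f" "tgt1 (P\<lparr>gen3 := C\<rparr>) f = tgt1 P f"
  by (induction f) auto

lemma is_cell2_gen3 [simp]: "is_cell2 (P\<lparr>gen3 := C\<rparr>) f = is_cell2 P f"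
  by (induction f) auto

lemma eq2_gen3_mono: "eq2 P f g \<Longrightarrow> eq2 (P\<lparr>gen3 := C\<rparr>) f g"
proof (induction rule: eq2.induct)
  case (unit1_left f)
  then show ?case using eq2.unit1_left[of "P\<lparr>gen3 := C\<rparr>" f] by simp
next
  case (unit1_right f)
  then show ?case using eq2.unit1_right[of "P\<lparr>gen3 := C\<rparr>" f] by simp
next
  case (inv_left f)
  then show ?case using eq2.inv_left[of "P\<lparr>gen3 := C\<rparr>" f] by simp
next
  case (inv_right f)
  then show ?case using eq2.inv_right[of "P\<lparr>gen3 := C\<rparr>" f] by simp
next
  case (trans f g h)
  then show ?case using eq2.trans by blast
qed (auto intro: eq2.intros)

lemma eq2_gen3 [simp]: "eq2 (P\<lparr>gen3 := C\<rparr>) f g = eq2 P f g"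
  using eq2_gen3_mono[of "P\<lparr>gen3 := C\<rparr>" f g "gen3 P"] eq2_gen3_mono[of P f g C] by auto

lemma src_tgt2_gen3 [simp]:
  "src2 (P\<lparr>gen3 := C\<rparr>) A = src2 P A" "tgt2 (P\<lparr>gen3 := C\<rparr>) A = tgt2 P A"
  by (induction A) auto

lemma is_cell3_gen3: "is_cell3 P A \<Longrightarrow> gens3 A \<subseteq> C \<Longrightarrow> is_cell3 (P\<lparr>gen3 := C\<rparr>) A"
  by (induction A) auto

lemma is_polygraph3_gen3: "is_polygraph3 P \<Longrightarrow> C \<subseteq> gen3 P \<Longrightarrow> is_polygraph3 (P\<lparr>gen3 := C\<rparr>)"
  by (auto simp: is_polygraph3_def parallel2_def)

lemma is_polygraph3_bounded2: "is_polygraph3 P \<Longrightarrow> bounded2 P"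
  by (simp add: is_polygraph3_def bounded2_def)

lemma is_cell3_parallel: "is_polygraph3 P \<Longrightarrow> is_cell3 P A \<Longrightarrow> parallel2 P (src2 P A) (tgt2 P A)"
proof (induction A)
  case (Comp32 A B)
  then show ?case using eq2_parallel[OF is_polygraph3_bounded2, of P "tgt2 P A" "src2 P B"] by (auto simp: parallel2_def)
qed (auto simp: parallel2_def is_polygraph3_def)

text \<open>The boundary is prescribed only up to \<open>eq2\<close>, so that it can be restated in
  whatever form the next composition requires.\<close>

definition filler :: "('a, 'b, 'c, 'z) polygraph3_scheme \<Rightarrow> ('a, 'b, 'c) cell3
    \<Rightarrow> ('a, 'b) cell2 \<Rightarrow> ('a, 'b) cell2 \<Rightarrow> bool" where
  "filler P A f g \<longleftrightarrow> is_cell3 P A \<and> eq2 P (src2 P A) f \<and> eq2 P (tgt2 P A) g"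

lemma filler_parallel:
  assumes P: "is_polygraph3 P" and A: "filler P A f g"
  shows "is_cell2 P f \<and> is_cell2 P g \<and> src1 P f = src1 P g \<and> tgt1 P f = tgt1 P g"
  using A is_cell3_parallel[OF P, of A] eq2_parallel[OF is_polygraph3_bounded2[OF P]]
  unfolding filler_def parallel2_def by metis

lemma filler_eq2: "filler P A f g \<Longrightarrow> eq2 P f f' \<Longrightarrow> eq2 P g g' \<Longrightarrow> filler P A f' g'"
  unfolding filler_def by (blast intro: eq2.trans)

lemma filler_Id: "is_polygraph3 P \<Longrightarrow> eq2 P f g \<Longrightarrow> filler P (Id2 f) f g"
  unfolding filler_def using eq2_parallel[OF is_polygraph3_bounded2, of P f g]
  by (auto intro: eq2.refl)

lemma filler_Gen: "is_polygraph3 P \<Longrightarrow> c \<in> gen3 P \<Longrightarrow> filler P (Gen3 c) (dom3 P c) (cod3 P c)"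
  unfolding filler_def by (auto simp: is_polygraph3_def parallel2_def intro: eq2.refl)

lemma filler_comp0: "filler P A f f' \<Longrightarrow> filler P B g g' \<Longrightarrow> filler P (A \<bullet>\<^sub>0 B) (f \<star>\<^sub>0 g) (f' \<star>\<^sub>0 g')"
  unfolding filler_def by (auto intro: eq2.cong0)

lemma filler_comp1:
  assumes P: "is_polygraph3 P" and A: "filler P A f f'" and B: "filler P B g g'" and "tgt1 P f = src1 P g"
  shows "filler P (A \<bullet>\<^sub>1 B) (f \<star>\<^sub>1 g) (f' \<star>\<^sub>1 g')"
proof -
  note par = eq2_parallel[OF is_polygraph3_bounded2[OF P]]
  note AB = A[unfolded filler_def] B[unfolded filler_def]
  then have "is_cell2 P (src2 P A \<star>\<^sub>1 src2 P B)" "is_cell2 P (tgt2 P A \<star>\<^sub>1 tgt2 P B)"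
    using par[of _ f] par[of _ f'] par[of _ g] par[of _ g'] filler_parallel[OF P A] filler_parallel[OF P B] assms(4)
    by simp_all
  then show ?thesis using AB by (auto simp: filler_def intro!: eq2.cong1)
qed

lemma filler_comp2: "filler P A f g \<Longrightarrow> filler P B g h \<Longrightarrow> filler P (A \<bullet>\<^sub>2 B) f h"
  unfolding filler_def by (auto intro: eq2.trans eq2.sym)

lemma filler_Inv: "filler P A f g \<Longrightarrow> filler P (Inv3 A) g f"
  unfolding filler_def by simp

text \<open>Coherence asks only for existence. As a relation this is an equivalence compatible with
  both compositions, so fillers can be built by calculational chains without naming them.\<close>

definition filled :: "('a, 'b, 'c, 'z) polygraph3_scheme \<Rightarrow> ('a, 'b) cell2 \<Rightarrow> ('a, 'b) cell2 \<Rightarrow> bool" where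
  "filled P f g \<longleftrightarrow> (\<exists>A. filler P A f g)"

lemma filled_eq2: "is_polygraph3 P \<Longrightarrow> eq2 P f g \<Longrightarrow> filled P f g"
  unfolding filled_def by (blast intro: filler_Id)

lemma filled_refl: "is_polygraph3 P \<Longrightarrow> is_cell2 P f \<Longrightarrow> filled P f f"
  by (intro filled_eq2 eq2.refl)

lemma filled_sym: "filled P f g \<Longrightarrow> filled P g f"
  unfolding filled_def by (blast intro: filler_Inv)

lemma filled_trans [trans]: "filled P f g \<Longrightarrow> filled P g h \<Longrightarrow> filled P f h"
  unfolding filled_def by (blast intro: filler_comp2)

lemma filled_parallel: "is_polygraph3 P \<Longrightarrow> filled P f g \<Longrightarrow>
    is_cell2 P f \<and> is_cell2 P g \<and> src1 P f = src1 P g \<and> tgt1 P f = tgt1 P g"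
  unfolding filled_def by (blast dest: filler_parallel)

lemma filled_cong0: "filled P f f' \<Longrightarrow> filled P g g' \<Longrightarrow> filled P (f \<star>\<^sub>0 g) (f' \<star>\<^sub>0 g')"
  unfolding filled_def by (blast intro: filler_comp0)

lemma filled_cong1:
  "is_polygraph3 P \<Longrightarrow> filled P f f' \<Longrightarrow> filled P g g' \<Longrightarrow> tgt1 P f = src1 P g \<Longrightarrow>
   filled P (f \<star>\<^sub>1 g) (f' \<star>\<^sub>1 g')"
  unfolding filled_def by (blast intro: filler_comp1)

text \<open>Substitution for generators: replacing each generator in \<open>A\<close> by a filler
  over the smaller set \<open>C\<close> turns \<open>A\<close> into a 3-cell over \<open>C\<close>.
  This plays the part of the reduction functor on 3-cells.\<close>

lemma filled_cell3:
  assumes P: "is_polygraph3 (P\<lparr>gen3 := C\<rparr>)"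
  shows "is_cell3 P A \<Longrightarrow> is_polygraph3 P \<Longrightarrow>
    (\<And>c. c \<in> gens3 A \<Longrightarrow> filled (P\<lparr>gen3 := C\<rparr>) (dom3 P c) (cod3 P c)) \<Longrightarrow>
    filled (P\<lparr>gen3 := C\<rparr>) (src2 P A) (tgt2 P A)"
proof (induction A)
  case (Id2 f)
  then show ?case by (auto intro: filled_refl[OF P])
next
  case (Comp30 A B)
  then show ?case by (auto intro: filled_cong0)
next
  case (Comp31 A B)
  then show ?case using P by (auto intro!: filled_cong1)
next
  case (Comp32 A B)
  then have "filled (P\<lparr>gen3 := C\<rparr>) (src2 P A) (tgt2 P A)" "filled (P\<lparr>gen3 := C\<rparr>) (src2 P B) (tgt2 P B)"
    "filled (P\<lparr>gen3 := C\<rparr>) (tgt2 P A) (src2 P B)"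
    by (auto intro: filled_eq2[OF P])
  then show ?case by (auto intro: filled_trans)
next
  case (Inv3 A)
  then show ?case by (auto intro: filled_sym)
qed auto

text \<open>The trivial Nielsen transformation pads with identities. Both components of a sphere
  must be padded by the same cells although their boundaries agree only up to \<open>eq2\<close>;
  hence the free choice of \<open>f\<close> and \<open>g\<close>.\<close>

lemma eq3_pad:
  assumes P: "is_polygraph3 P" and B: "is_cell3 P B" "eq2 P (src2 P B) f" "eq2 P (tgt2 P B) g"
  shows "eq3 P B (Id2 f \<bullet>\<^sub>2 (Id2 (Id1 (src1 P f)) \<bullet>\<^sub>1 B \<bullet>\<^sub>1 Id2 (Id1 (tgt1 P f))) \<bullet>\<^sub>2 Id2 g)"
proof -
  note bd = is_polygraph3_bounded2[OF P]
  note par = is_cell3_parallel[OF P B(1), unfolded parallel2_def] eq2_parallel[OF bd B(2)] eq2_parallel[OF bd B(3)]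
  have l: "src1 P f \<in> lists (gen1 P)" "tgt1 P f \<in> lists (gen1 P)"
    using is_cell2_lists[OF is_polygraph3_bounded2[OF P]] par by blast+
  let ?h = "Id2 (Id1 (src1 P f))" and ?k = "Id2 (Id1 (tgt1 P f))"
  have 1: "eq3 P (B \<bullet>\<^sub>1 ?k) B" using eq3.unit1_right[OF B(1)] par by simp
  have "eq3 P (?h \<bullet>\<^sub>1 B \<bullet>\<^sub>1 ?k) (?h \<bullet>\<^sub>1 B)"
    using B par l by (intro eq3.cong1 eq3.refl 1) (auto simp del: in_lists_conv_set)
  also have "eq3 P (?h \<bullet>\<^sub>1 B) B" using eq3.unit1_left[OF B(1)] par by simp
  finally have 2: "eq3 P (?h \<bullet>\<^sub>1 B \<bullet>\<^sub>1 ?k) B" .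
  have s: "eq2 P (Id1 (src1 P f) \<star>\<^sub>1 h \<star>\<^sub>1 Id1 (tgt1 P f)) h"
    if "is_cell2 P h" "src1 P h = src1 P f" "tgt1 P h = tgt1 P f" for h
  proof -
    have "eq2 P (Id1 (src1 P f) \<star>\<^sub>1 h \<star>\<^sub>1 Id1 (tgt1 P f)) (Id1 (src1 P f) \<star>\<^sub>1 h)"
      using that l eq2.unit1_right[OF that(1)] by (intro eq2_cong1_right) (auto simp del: in_lists_conv_set)
    also have "eq2 P (Id1 (src1 P f) \<star>\<^sub>1 h) h" using eq2.unit1_left[OF that(1)] that by simp
    finally show ?thesis .
  qed
  have s1: "eq2 P f (src2 P (?h \<bullet>\<^sub>1 B \<bullet>\<^sub>1 ?k))" and s2: "eq2 P (tgt2 P (?h \<bullet>\<^sub>1 B \<bullet>\<^sub>1 ?k)) g"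
    using eq2.trans[OF s B(2)] eq2.trans[OF s B(3)] par by (auto intro: eq2.sym)
  have "eq3 P (Id2 f \<bullet>\<^sub>2 (?h \<bullet>\<^sub>1 B \<bullet>\<^sub>1 ?k) \<bullet>\<^sub>2 Id2 g) (Id2 (src2 P B) \<bullet>\<^sub>2 B \<bullet>\<^sub>2 Id2 (tgt2 P B))"
    using B par l s1 s2 by (intro eq3.cong2 eq3.cong_id 2) (auto intro: eq2.sym simp del: in_lists_conv_set)
  also have "eq3 P (Id2 (src2 P B) \<bullet>\<^sub>2 B \<bullet>\<^sub>2 Id2 (tgt2 P B)) (Id2 (src2 P B) \<bullet>\<^sub>2 B)"
    using B par by (intro eq3.cong2 eq3.refl eq3.unit2_right) (auto intro: eq2.refl)
  also have "eq3 P (Id2 (src2 P B) \<bullet>\<^sub>2 B) B" using B by (intro eq3.unit2_left)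
  finally show ?thesis by (rule eq3.sym)
qed

lemma nielsen4_refl:
  assumes "is_polygraph3 P" "sphere3 P \<gamma>"
  shows "nielsen4 P \<gamma> \<gamma>"
proof -
  obtain A B where \<gamma>: "\<gamma> = (A, B)" by fastforce
  with assms have AB: "is_cell3 P A" "is_cell3 P B" "eq2 P (src2 P A) (src2 P B)" "eq2 P (tgt2 P A) (tgt2 P B)"
    by (auto simp: sphere3_def)
  have "eq2 P (src2 P B) (src2 P B)" "eq2 P (tgt2 P B) (tgt2 P B)"
    using is_cell3_parallel[OF assms(1) AB(2)] by (auto simp: parallel2_def intro: eq2.refl)
  from eq3_pad[OF assms(1) AB(1,3,4)] eq3_pad[OF assms(1) AB(2) this] show ?thesis
    unfolding \<gamma> nielsen4_def by auto
qed

section \<open>Insertion and the stylic congruence\<close>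

abbreviation inserts :: "row list \<Rightarrow> nat list \<Rightarrow> row list" where
  "inserts \<equiv> foldl (\<lambda>T x. ins x T)"

text \<open>The bumped letter is a word of length at most one, so that insertion into the remaining
  rows is \<open>inserts\<close> whether or not anything is bumped.\<close>

definition emit :: "nat set \<Rightarrow> nat \<Rightarrow> nat list" where
  "emit A x = (if \<exists>y\<in>A. x < y then [Min {y \<in> A. x < y}] else [])"

lemma ins_Cons: "ins x (u # us) = insort_insert x u # inserts us (emit (set u) x)"
  by (simp add: emit_def)

declare ins.simps(2) [simp del]

lemma emit_empty [simp]: "emit {} x = []"
  by (simp add: emit_def)

lemma emit_cases [consumes 1, case_names none some]:
  assumes "finite A"
  obtains (none) "emit A x = []" "\<forall>a\<in>A. a \<le> x"
  | (some) m where "emit A x = [m]" "m \<in> A" "x < m" "\<forall>a\<in>A. x < a \<longrightarrow> m \<le> a"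
proof (cases "\<exists>y\<in>A. x < y")
  case True
  have "finite {y \<in> A. x < y}" "{y \<in> A. x < y} \<noteq> {}" using assms True by auto
  from Min_in[OF this] Min_le[OF this(1)] True show ?thesis
    by (intro some[of "Min {y \<in> A. x < y}"]) (auto simp: emit_def)
qed (auto simp: emit_def intro!: none)

lemma emit_eqI: "finite A \<Longrightarrow> m \<in> A \<Longrightarrow> x < m \<Longrightarrow> (\<And>a. a \<in> A \<Longrightarrow> x < a \<Longrightarrow> m \<le> a) \<Longrightarrow> emit A x = [m]"
  by (cases rule: emit_cases[of A x]) (auto intro: order.antisym dest: leD)

lemma emit_cong:
  assumes "{y \<in> A. x < y} = {y \<in> B. z < y}"
  shows "emit A x = emit B z"
proof -
  have "(\<exists>y\<in>A. x < y) \<longleftrightarrow> (\<exists>y\<in>B. z < y)" using assms by blast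
  then show ?thesis by (simp add: emit_def assms)
qed

lemma emit_insert_le: "z \<le> x \<Longrightarrow> emit (insert z A) x = emit A x"
  by (rule emit_cong) auto

lemma emit_insert_gt:
  assumes "finite A" "x < z"
  shows "emit (insert z A) x = (if \<exists>a\<in>A. x < a \<and> a \<le> z then emit A x else [z])"
proof (cases "\<exists>a\<in>A. x < a \<and> a \<le> z")
  case True
  with assms show ?thesis
    by (cases rule: emit_cases[OF assms(1), of x]) (auto intro!: emit_eqI)
next
  case False
  with assms show ?thesis by (force intro!: emit_eqI)
qed

lemma insort_insert_left_comm:
  "insort_insert x (insort_insert y u) = insort_insert y (insort_insert (x :: nat) u)"
  by (simp add: insort_insert_key_def set_insort_key insort_left_comm)

lemma insort_insert_idem: "insort_insert x (insort_insert x u) = insort_insert (x :: nat) u"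
  by (simp add: insort_insert_key_def set_insort_key)

lemma set_insort_insert_nat [simp]: "set (insort_insert x u) = insert (x :: nat) (set u)"
  by (simp add: set_insort_insert)

text \<open>The second copy of x bumps the same letter as the first, since bumping looks only at
  letters above x. So the repetition passes to the next row.\<close>

lemma ins_idem: "ins x (ins x T) = ins x T"
proof (induction T arbitrary: x)
  case (Cons u us)
  show ?case
    by (cases rule: emit_cases[OF List.finite_set, of u x])
      (simp_all add: ins_Cons emit_insert_le insort_insert_idem Cons.IH)
qed (simp add: insort_insert_key_def ins_Cons emit_insert_le)

text \<open>The words bumped out of the bottom row are compared. If that row has a letter above x
  and at most z, they are z' x' y' and x' z' y' with x' \<le> y' < z', an instance of the same
  relation, or both x' y' if z bumps nothing. Otherwise x and z bump alike in the original row, and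
  the two words differ only by repeated letters.\<close>

lemma ins_zxy:
  assumes "x \<le> y" "y < z"
  shows "ins y (ins x (ins z T)) = ins y (ins z (ins x T))"
  using assms
proof (induction T arbitrary: x y z)
  case Nil
  then show ?case by (auto simp: insort_insert_key_def ins_Cons emit_insert_le emit_insert_gt)
next
  case (Cons u us)
  define A where "A = set u"
  have A [simp]: "finite A" by (simp add: A_def)
  define E where "E = emit (insert z A) y"
  have E: "emit (insert x (insert z A)) y = E" "emit (insert z (insert x A)) y = E"
    "emit (insert x A) z = emit A z"
    using Cons.prems by (auto simp: E_def emit_insert_le insert_commute)
  have "inserts us (emit A z @ emit (insert z A) x @ E) = inserts us (emit A x @ emit A z @ E)"
  proof (cases "\<exists>a\<in>A. x < a \<and> a \<le> z")
    case True
    obtain x' where x': "emit A x = [x']" "x' \<in> A" "x < x'" "\<forall>a\<in>A. x < a \<longrightarrow> x' \<le> a"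
      using True by (cases rule: emit_cases[OF A, of x]) auto
    have "x' \<le> z" using True x' by force
    have 1: "emit (insert z A) x = [x']" using x' \<open>x' \<le> z\<close> by (intro emit_eqI) auto
    obtain y' where y': "E = [y']" "y' \<in> insert z A" "y < y'"  "\<forall>a\<in>insert z A. y < a \<longrightarrow> y' \<le> a"
      unfolding E_def using Cons.prems(2) A emit_cases[of "insert z A" y]
      by (metis finite_insert insertI1 leD)
    have "x' \<le> y'" "y' \<le> z" using y' x' \<open>x' \<le> z\<close> Cons.prems by auto
    then show ?thesis
      by (cases rule: emit_cases[OF A, of z]) (auto simp: 1 x' y' Cons.IH)
  next
    case False
    have 1: "emit (insert z A) x = [z]" "E = [z]" unfolding E_def
      using False Cons.prems by (force intro!: emit_eqI)+
    have "emit A x = emit A z" using False Cons.prems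
      by (intro emit_cong Collect_cong conj_cong refl) (auto simp: not_le)
    then show ?thesis
      by (cases rule: emit_cases[OF A, of z]) (auto simp: 1 ins_idem)
  qed
  then show ?case
    by (simp add: ins_Cons E A_def[symmetric] insort_insert_left_comm)
qed

text \<open>The letter x bumps the same x' \<le> y on both sides. If z bumps z', then y bumps some
  y' with x' < y' \<le> z', and the bumped words are again related; if z bumps nothing, they
  coincide.\<close>

lemma ins_yzx:
  assumes "x < y" "y \<le> z"
  shows "ins x (ins z (ins y T)) = ins z (ins x (ins y T))"
  using assms
proof (induction T arbitrary: x y z)
  case Nil
  then show ?case
    by (auto simp: insort_insert_key_def ins_Cons emit_insert_le emit_insert_gt)
next
  case (Cons u us)
  define A where "A = set u"
  have A [simp]: "finite A" by (simp add: A_def)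
  obtain x' where x': "emit (insert y A) x = [x']" "x' \<in> insert y A" "x < x'"
     "\<forall>a\<in>insert y A. x < a \<longrightarrow> x' \<le> a"
    using Cons.prems(1) A emit_cases[of "insert y A" x] by (metis finite_insert insertI1 leD)
  have x'': "emit (insert z (insert y A)) x = [x']"
    using x' Cons.prems by (intro emit_eqI) auto
  have x''2: "emit (insert y (insert z A)) x = [x']" using x'' by (subst insert_commute)
  have z: "emit (insert y A) z = emit A z" "emit (insert x (insert y A)) z = emit A z"
    using Cons.prems by (auto simp: emit_insert_le)
  have "x' \<le> y" using x' Cons.prems by auto
  have "inserts us (emit A y @ emit A z @ [x']) = inserts us (emit A y @ [x'] @ emit A z)"
    using A
  proof (cases rule: emit_cases[where x = z])
    case (some z')
    then have "y < z'" using Cons.prems by simp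
    with some show ?thesis using Cons.prems \<open>x' \<le> y\<close>
      by (cases rule: emit_cases[OF A, of y]) (auto intro!: Cons.IH)
  qed simp
  then show ?case
    by (simp add: ins_Cons x' x'' x''2 z A_def[symmetric] insort_insert_left_comm)
qed

section \<open>Invariance of tableaux under the stylic congruence\<close>

definition styl_rel :: "nat \<Rightarrow> (nat list \<times> nat list) set" where
  "styl_rel n = {([x, x], [x]) | x. x \<in> {1..n}} \<union>
     {([z, x, y], [x, z, y]) | x y z. {x, y, z} \<subseteq> {1..n} \<and> x \<le> y \<and> y < z} \<union>
     {([y, z, x], [y, x, z]) | x y z. {x, y, z} \<subseteq> {1..n} \<and> x < y \<and> y \<le> z}"

lemma inserts_cong: "word_cong X (styl_rel n) v w \<Longrightarrow> inserts T v = inserts T w"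
proof (induction arbitrary: T rule: word_cong.induct)
  case (rel l r p s)
  have "inserts U l = inserts U r" for U
    using rel(1) unfolding styl_rel_def by (elim UnE CollectE exE conjE) (simp_all add: ins_idem, (auto intro: ins_zxy ins_yzx))
  then show ?case by simp
qed auto

lemma N_cong: "word_cong X (styl_rel n) v w \<Longrightarrow> N v = N w"
  using inserts_cong by (simp add: N_def)

lemma word_cong_lists: "word_cong X R v w \<Longrightarrow> v \<in> lists X \<and> w \<in> lists X"
  by (induction rule: word_cong.induct) auto

lemma word_cong_context:
  "word_cong X R v w \<Longrightarrow> p \<in> lists X \<Longrightarrow> s \<in> lists X \<Longrightarrow> word_cong X R (p @ v @ s) (p @ w @ s)"
proof (induction rule: word_cong.induct)
  case (rel l r p' s')
  then show ?case using word_cong.rel[of l r R X "p @ p'" "s' @ s"] by simp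
next
  case (trans u v w)
  then show ?case using word_cong.trans by blast
next
  case (sym v w)
  then show ?case using word_cong.sym by blast
qed (simp add: word_cong.refl)

lemmas [trans] = word_cong.trans

text \<open>The letters of \<open>u\<close> that are bumped when \<open>v\<close> is inserted: \<open>z\<close> bumps \<open>y\<close> iff \<open>z < y\<close> and no other
  letter of \<open>u\<close> lies in between.\<close>

definition upper_row :: "row \<Rightarrow> row \<Rightarrow> row" where
  "upper_row u v = filter (\<lambda>y. \<exists>z\<in>set v. z < y \<and> (\<forall>w\<in>set u. w < y \<longrightarrow> w \<le> z)) u"

lemma set_upper: "set (upper_row u v) = {y \<in> set u. \<exists>z\<in>set v. z < y \<and> (\<forall>w\<in>set u. w < y \<longrightarrow> w \<le> z)}"
  by (auto simp: upper_row_def)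

section \<open>Inserting a whole row below another\<close>

lemma sorted_upper: "sorted_wrt (<) u \<Longrightarrow> sorted_wrt (<) (upper_row u v)"
  by (simp add: upper_row_def sorted_wrt_filter)

lemma insort_insert_eq: "sorted_wrt (<) u \<Longrightarrow> insort_insert x u = sorted_list_of_set (insert (x :: nat) (set u))"
  by (metis List.finite_set set_insort_insert_nat sorted_insort_insert strict_sorted_iff distinct_insort_insert
      sorted_list_of_set.idem_if_sorted_distinct)

lemma strict_sorted_sl [simp]: "sorted_wrt (<) u \<Longrightarrow> sorted_list_of_set (set u) = (u :: nat list)"
  by (simp add: strict_sorted_iff sorted_list_of_set.idem_if_sorted_distinct)

lemma sl_strict [simp]: "sorted_wrt (<) (sorted_list_of_set (A :: nat set))"
  by simp

lemma strict_sorted_eqI: "sorted_wrt (<) xs \<Longrightarrow> sorted_wrt (<) ys \<Longrightarrow> set xs = set ys \<Longrightarrow> xs = (ys :: nat list)"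
  using strict_sorted_equal by metis

text \<open>The letters of \<open>v\<close> bump a weakly increasing word out of \<open>u\<close>.
  It may contain repetitions, which \<open>ins_idem\<close> removes; what remains is the row
  \<open>upper_row u v\<close>.\<close>

lemma inserts_row:
  assumes "sorted_wrt (<) u" "sorted_wrt (<) v"
  shows "inserts (u # us) v = sorted_list_of_set (set u \<union> set v) # inserts us (upper_row u v)"
  using assms
proof (induction v arbitrary: u us)
  case Nil
  then show ?case by (simp add: upper_row_def)
next
  case (Cons z v)
  let ?u = "insort_insert z u"
  have u: "sorted_wrt (<) ?u" using Cons.prems(1) insort_insert_eq sl_strict by metis
  have z: "\<forall>y\<in>set v. z < y" "sorted_wrt (<) v" using Cons.prems by auto
  \<comment> \<open>The new letter z is smaller than all letters of \<open>v\<close>: it is neither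
    bumped by them nor does it block a bump.\<close>
  have t: "upper_row ?u v = upper_row u v"
  proof (rule strict_sorted_eqI, goal_cases)
    case 3
    show ?case
    proof (intro Set.set_eqI iffI)
      fix y assume "y \<in> set (upper_row ?u v)"
      then obtain z' where z': "y = z \<or> y \<in> set u" "z' \<in> set v" "z' < y"
        "\<forall>w\<in>insert z (set u). w < y \<longrightarrow> w \<le> z'"
        unfolding set_upper by auto
      then have "y \<noteq> z" using z by auto
      with z' show "y \<in> set (upper_row u v)" unfolding set_upper by auto
    next
      fix y assume "y \<in> set (upper_row u v)"
      then obtain z' where z': "y \<in> set u" "z' \<in> set v" "z' < y" "\<forall>w\<in>set u. w < y \<longrightarrow> w \<le> z'"
        unfolding set_upper by auto
      with z have "z \<le> z'" by auto
      with z' show "y \<in> set (upper_row ?u v)" unfolding set_upper by auto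
    qed
  qed (use u Cons.prems in \<open>auto simp: sorted_upper\<close>)
  have "inserts (inserts us (emit (set u) z)) (upper_row u v) = inserts us (upper_row u (z # v))"
    using List.finite_set[of u]
  proof (cases rule: emit_cases[where x = z])
    case none
    then have "upper_row u (z # v) = upper_row u v"
      unfolding upper_row_def by (intro filter_cong refl) (auto dest: leD)
    then show ?thesis using none by simp
  next
    case (some m)
    have set: "set (upper_row u (z # v)) = insert m (set (upper_row u v))"
    proof (intro Set.set_eqI iffI)
      fix y assume "y \<in> set (upper_row u (z # v))"
      then consider "y \<in> set u" "z < y" "\<forall>w\<in>set u. w < y \<longrightarrow> w \<le> z" | "y \<in> set (upper_row u v)"
        unfolding set_upper by auto
      then show "y \<in> insert m (set (upper_row u v))"
      proof cases
        case 1
        then have "m \<le> y" "\<not> m < y" using some by force+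
        then show ?thesis by simp
      qed simp
    next
      fix y assume "y \<in> insert m (set (upper_row u v))"
      moreover have "\<forall>w\<in>set u. w < m \<longrightarrow> w \<le> z" using some by (meson leD leI)
      ultimately show "y \<in> set (upper_row u (z # v))" using some unfolding set_upper by auto
    qed
    have sorted: "sorted_wrt (<) (upper_row u v)" using Cons.prems by (simp add: sorted_upper)
    have le: "\<forall>y\<in>set (upper_row u v). m \<le> y" using some z(1) by (fastforce simp: set_upper)
    show ?thesis
    \<comment> \<open>If a later letter bumps m as well, then m heads the sorted row
      \<open>upper_row u v\<close>, and its two insertions in succession collapse.\<close>
    proof (cases "m \<in> set (upper_row u v)")
      case True
      then have "upper_row u (z # v) = upper_row u v"
        using set Cons.prems by (intro strict_sorted_eqI) (auto simp: sorted_upper)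
      moreover obtain r where "upper_row u v = m # r"
        using True le sorted by (cases "upper_row u v") (auto simp: leD)
      ultimately show ?thesis using some by (simp add: ins_idem)
    next
      case False
      then have "upper_row u (z # v) = m # upper_row u v"
        using set Cons.prems le sorted by (intro strict_sorted_eqI) (auto simp: sorted_upper le_less)
      then show ?thesis using some by simp
    qed
  qed
  then show ?case
    using u z by (simp add: ins_Cons Cons.IH t del: foldl_append)
qed

lemma inserts_Nil_row: "sorted_wrt (<) u \<Longrightarrow> u \<noteq> [] \<Longrightarrow> inserts [] u = [u]"
proof (cases u)
  case (Cons x v)
  assume "sorted_wrt (<) u"
  then have "upper_row [x] v = []" "sorted_wrt (<) v" "sorted_list_of_set (insert x (set v)) = u"
    using Cons strict_sorted_sl[of u] by (auto simp: upper_row_def)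
  then show ?thesis using Cons by (simp add: inserts_row)
qed simp

definition lower_row :: "row \<Rightarrow> row \<Rightarrow> row" where
  "lower_row u v = sorted_list_of_set (set u \<union> set v)"

lemma set_lower [simp]: "set (lower_row u v) = set u \<union> set v"
  by (simp add: lower_row_def)

lemma N_rows2:
  assumes "sorted_wrt (<) u" "u \<noteq> []" "sorted_wrt (<) v"
  shows "N (u @ v) = (if upper_row u v = [] then [lower_row u v] else [upper_row u v, lower_row u v])"
  using assms by (simp add: N_def inserts_Nil_row inserts_row sorted_upper lower_row_def)

text \<open>Every letter of \<open>u\<close> is bumped: a non-minimal one by its predecessor in
  \<open>u\<close>, which belongs to \<open>v\<close>, and the minimal one by the minimum of
  \<open>v\<close>.\<close>

lemma upper_below:
  assumes "u \<triangleleft> v" "sorted_wrt (<) u" "u \<noteq> []" "v \<noteq> []"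
  shows "upper_row u v = u"
proof -
  have "\<exists>z\<in>set v. z < y \<and> (\<forall>w\<in>set u. w < y \<longrightarrow> w \<le> z)" if y: "y \<in> set u" for y
  proof (cases "\<exists>w\<in>set u. w < y")
    case True
    define w where "w = Max {w \<in> set u. w < y}"
    have "{w \<in> set u. w < y} \<noteq> {}" using True by auto
    then have "w \<in> {w \<in> set u. w < y}" unfolding w_def by (intro Max_in) auto
    moreover have "\<forall>w'\<in>set u. w' < y \<longrightarrow> w' \<le> w" unfolding w_def by auto
    ultimately show ?thesis using assms(1) by (auto simp: below_def)
  next
    case False
    have "Min (set v) \<in> set v" using assms by (intro Min_in) auto
    moreover have "Min (set v) < y" using assms(1) y by (auto simp: below_def intro: less_le_trans)
    ultimately show ?thesis using False by auto
  qed
  then show ?thesis by (auto simp: upper_row_def filter_id_conv)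
qed

text \<open>By \<open>upper_below\<close> each inserted row pushes out the entire row that it meets,
  so the stack moves up by one place unchanged.\<close>

lemma inserts_below:
  assumes "successively (\<lambda>a b. b \<triangleleft> a) (v # us)" "\<forall>u\<in>set (v # us). sorted_wrt (<) u \<and> u \<noteq> []"
  shows "inserts us v = v # us"
  using assms
proof (induction us arbitrary: v)
  case (Cons u us)
  have "upper_row u v = u" "set u \<union> set v = set v" using Cons.prems by (auto intro!: upper_below simp: below_def)
  then show ?case using Cons by (simp add: inserts_row)
qed (simp add: inserts_Nil_row)

lemma N_concat_tableau:
  assumes "successively (\<triangleleft>) T" "\<forall>u\<in>set T. sorted_wrt (<) u \<and> u \<noteq> []"
  shows "N (concat T) = T"
proof -
  have "inserts [] (concat T) = rev T"
    using assms
  proof (induction T rule: rev_induct)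
    case (snoc v T)
    have "successively (\<triangleleft>) T" using snoc.prems by (simp add: successively_append_iff)
    moreover have "successively (\<lambda>a b. b \<triangleleft> a) (v # rev T)"
      using snoc.prems(1) successively_rev[of "\<lambda>a b. b \<triangleleft> a" "T @ [v]"] by simp
    ultimately show ?case using snoc inserts_below[of v "rev T"] by simp
  qed simp
  then show ?thesis by (simp add: N_def)
qed


declare One_nat_def [simp del]

section \<open>Every word is congruent to the reading of its tableau\<close>

context
  fixes n :: nat
begin

abbreviation styl_cong :: "nat list \<Rightarrow> nat list \<Rightarrow> bool"  (infix \<open>\<approx>\<close> 50) where
  "v \<approx> w \<equiv> word_cong {1..n} (styl_rel n) v w"

lemma styl_rel_cong: "(l, r) \<in> styl_rel n \<Longrightarrow> l \<approx> r"
  using word_cong.rel[of l r "styl_rel n" "{1..n}" "[]" "[]"]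
  by (auto simp: styl_rel_def word_cong.refl)

lemma styl_cong_context:
  assumes "v \<approx> w" "set p \<subseteq> {1..n}" "set s \<subseteq> {1..n}"
  shows "p @ v @ s \<approx> p @ w @ s"
  using assms by (intro word_cong_context) auto

lemma styl_cong_refl: "set w \<subseteq> {1..n} \<Longrightarrow> w \<approx> w"
  by (rule word_cong.refl) auto

lemma cong_xx: "x \<in> {1..n} \<Longrightarrow> [x, x] \<approx> [x]"
  by (rule styl_rel_cong) (auto simp: styl_rel_def)

lemma cong_zxy: "{x, y, z} \<subseteq> {1..n} \<Longrightarrow> x \<le> y \<Longrightarrow> y < z \<Longrightarrow> [z, x, y] \<approx> [x, z, y]"
  by (rule styl_rel_cong) (auto simp: styl_rel_def)

lemma cong_yzx: "{x, y, z} \<subseteq> {1..n} \<Longrightarrow> x < y \<Longrightarrow> y \<le> z \<Longrightarrow> [y, z, x] \<approx> [y, x, z]"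
  by (rule styl_rel_cong) (auto simp: styl_rel_def)

text \<open>The letter x passes the letters of \<open>q\<close> from right to left. Each exchange is
  an instance of the relation for yzx whose first letter is the letter preceding the one being
  passed.\<close>

lemma cong_move_left:
  assumes "sorted (y # q)" "x < y" "set (x # y # q) \<subseteq> {1..n}"
  shows "y # q @ [x] \<approx> y # x # q"
  using assms
proof (induction q arbitrary: y)
  case Nil
  then show ?case by (auto intro!: styl_cong_refl)
next
  case (Cons b q)
  have "b # q @ [x] \<approx> b # x # q" using Cons.prems by (intro Cons.IH) auto
  from styl_cong_context[OF this, of "[y]" "[]"] Cons.prems
  have "y # (b # q) @ [x] \<approx> [y, b, x] @ q" by simp
  also have "[y, b, x] @ q \<approx> [y, x, b] @ q"
    using styl_cong_context[OF cong_yzx[of x y b], of "[]" q] Cons.prems by simp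
  finally show ?case by simp
qed

text \<open>The letters m of \<open>p\<close> pass y from right to left. The exchange of m and y
  needs behind them a letter between the two in size: x for the first exchange, and afterwards the
  letter passed last.\<close>

lemma cong_move_right:
  assumes "sorted (p @ [x])" "x < y" "set (x # y # p) \<subseteq> {1..n}"
  shows "p @ [y, x] \<approx> y # p @ [x]"
  using assms
proof (induction p arbitrary: x rule: rev_induct)
  case Nil
  then show ?case by (auto intro!: styl_cong_refl)
next
  case (snoc m p)
  then have m: "m \<le> x" by (auto simp: sorted_append)
  have "p @ [m, y, x] \<approx> p @ [y, m, x]"
    using styl_cong_context[OF cong_zxy[of m x y, THEN word_cong.sym], of p "[]"] snoc.prems m by simp
  also have "p @ [y, m, x] \<approx> y # p @ [m, x]"
    using styl_cong_context[OF snoc.IH[of m], of "[]" "[x]"] snoc.prems m by (simp add: sorted_append)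
  finally show ?case by simp
qed

lemma cong_absorb:
  assumes "sorted_wrt (<) p" "\<forall>a\<in>set p. a \<le> x" "x \<in> set p" "set p \<subseteq> {1..n}"
  shows "p @ [x] \<approx> p"
proof -
  obtain p' where "p = p' @ [x]"
    using assms(1-3) by (cases p rule: rev_cases) (force simp: sorted_wrt_append)+
  then show ?thesis
    using styl_cong_context[OF cong_xx[of x], of p' "[]"] assms(4) by simp
qed

text \<open>The row splits into letters at most x and letters above x. The first letter y of the
  second part is the one bumped, and it has to appear at the front while remaining in the
  row.\<close>

lemma cong_ins_row:
  assumes u: "sorted_wrt (<) u" and X: "set u \<subseteq> {1..n}" "x \<in> {1..n}"
  shows "u @ [x] \<approx> emit (set u) x @ insort_insert x u"
proof -
  define p q where "p = takeWhile (\<lambda>a. a \<le> x) u" and "q = dropWhile (\<lambda>a. a \<le> x) u"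
  have pq: "u = p @ q" by (simp add: p_def q_def)
  have p: "\<forall>a\<in>set p. a \<le> x" by (auto simp: p_def dest: set_takeWhileD)
  moreover have "sorted_wrt (<) p" using u by (simp add: pq sorted_wrt_append)
  moreover from this have "sorted p" by (simp add: strict_sorted_iff)
  ultimately have p: "\<forall>a\<in>set p. a \<le> x" "sorted_wrt (<) p" "sorted p" by auto
  have q: "\<forall>a\<in>set q. x < a"
  proof (cases q)
    case (Cons y q')
    then have "x < y" using hd_dropWhile[of "\<lambda>a. a \<le> x" u] by (auto simp: q_def)
    then show ?thesis using u pq Cons by (auto simp: sorted_wrt_append)
  qed simp
  have ins: "insort_insert x u = (if x \<in> set p then u else p @ [x] @ q)"
  proof (cases "x \<in> set p")
    case True
    then show ?thesis by (simp add: insort_insert_key_def pq)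
  next
    case False
    have "\<forall>a\<in>set p. a < x" using p(1) False by (auto simp: order.strict_iff_order)
    moreover have "\<forall>a\<in>set p. \<forall>b\<in>set q. a < b" "sorted_wrt (<) q"
      using u by (auto simp: pq sorted_wrt_append)
    ultimately have "sorted_wrt (<) (p @ [x] @ q)" using p(2) q
      by (simp add: sorted_wrt_append)
    moreover have "sorted_wrt (<) (insort_insert x u)"
      using insort_insert_eq[OF u] sl_strict by metis
    ultimately have "insort_insert x u = p @ [x] @ q"
      by (intro strict_sorted_eqI) (simp_all add: pq Un_insert_left insert_commute)
    then show ?thesis using False by simp
  qed
  show ?thesis
  proof (cases q)
    case Nil
    then have "emit (set u) x = []" using p by (auto simp: emit_def pq leD)
    then show ?thesis using cong_absorb[of p x] p X ins Nil pq
      by (auto intro!: styl_cong_refl)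
  next
    case (Cons y q')
    have y: "x < y" "y \<in> {1..n}" and set: "set p \<subseteq> {1..n}" "set q' \<subseteq> {1..n}"
      and q': "sorted (y # q')" "\<forall>a\<in>set q'. y < a"
      using q X u by (auto simp: pq Cons sorted_wrt_append strict_sorted_iff)
    have e: "emit (set u) x = [y]"
      using y p q' by (intro emit_eqI) (auto simp: pq Cons)
    \<comment> \<open>The bumped letter is doubled by xx = x: one copy travels to the front, the
      other stays. Meanwhile x is brought from the end to its place before y.\<close>
    have "p @ [y] @ (q' @ [x]) \<approx> p @ [y, y] @ (q' @ [x])"
      using y set X by (intro styl_cong_context word_cong.sym[OF cong_xx]) auto
    also have "p @ [y, y] @ (q' @ [x]) \<approx> p @ [y, y, x] @ q'"
      using styl_cong_context[OF cong_move_left[OF q'(1) y(1)], of "p @ [y]" "[]"] y set X by simp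
    also have "p @ [y, y, x] @ q' \<approx> p @ [y, x, y] @ q'"
      using y set X by (intro styl_cong_context cong_yzx) auto
    also have "p @ [y, x, y] @ q' \<approx> y # p @ [x, y] @ q'"
      using styl_cong_context[OF cong_move_right[of p x y], of "[]" "y # q'"] p y set X
      by (simp add: sorted_append)
    also have "y # p @ [x, y] @ q' \<approx> [y] @ insort_insert x u"
    proof (cases "x \<in> set p")
      case True
      then show ?thesis
        using styl_cong_context[OF cong_absorb[of p x], of "[y]" "y # q'"] p y set X
        unfolding ins by (simp add: pq Cons)
    next
      case False
      then show ?thesis
        using styl_cong_refl[of "y # p @ [x, y] @ q'"] y set X by (simp add: ins Cons)
    qed
    finally show ?thesis unfolding e by (simp add: pq Cons)
  qed
qed

lemma ins_rows:
  "\<forall>u\<in>set T. sorted_wrt (<) u \<and> set u \<subseteq> {1..n} \<Longrightarrow> x \<in> {1..n} \<Longrightarrow>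
   \<forall>u\<in>set (ins x T). sorted_wrt (<) u \<and> set u \<subseteq> {1..n}"
proof (induction T arbitrary: x)
  case (Cons u us)
  have "sorted_wrt (<) (insort_insert x u)"
    using Cons.prems(1) insort_insert_eq[of u x] sl_strict by (metis list.set_intros(1))
  moreover have "\<forall>w\<in>set (inserts us (emit (set u) x)). sorted_wrt (<) w \<and> set w \<subseteq> {1..n}"
    using List.finite_set[of u]
  proof (cases rule: emit_cases[where x = x])
    case none
    then show ?thesis using Cons.prems by simp
  next
    case (some m)
    then have "m \<in> {1..n}" using Cons.prems by auto
    moreover have "\<forall>u\<in>set us. sorted_wrt (<) u \<and> set u \<subseteq> {1..n}" using Cons.prems(1) by simp
    ultimately show ?thesis unfolding some(1) foldl.simps by (intro Cons.IH)
  qed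
  ultimately show ?case using Cons.prems by (auto simp: ins_Cons)
qed simp

lemma cong_ins:
  assumes "\<forall>u\<in>set T. sorted_wrt (<) u \<and> set u \<subseteq> {1..n}" "x \<in> {1..n}"
  shows "concat (rev T) @ [x] \<approx> concat (rev (ins x T))"
  using assms
proof (induction T arbitrary: x)
  case Nil
  then show ?case by (auto intro!: styl_cong_refl)
next
  case (Cons u us)
  have us: "set (concat (rev us)) \<subseteq> {1..n}" using Cons.prems by auto
  have i: "set (insort_insert x u) \<subseteq> {1..n}" using Cons.prems by auto
  have "concat (rev us) @ (u @ [x]) @ [] \<approx> concat (rev us) @ (emit (set u) x @ insort_insert x u) @ []"
    using Cons.prems us by (intro styl_cong_context cong_ins_row) auto
  also have "concat (rev us) @ (emit (set u) x @ insort_insert x u) @ [] \<approx>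
      concat (rev (ins x (u # us)))"
    using List.finite_set[of u]
  proof (cases rule: emit_cases[where x = x])
    case none
    then show ?thesis
      using us i styl_cong_refl[of "concat (rev us) @ insort_insert x u"] by (simp add: ins_Cons)
  next
    case (some m)
    then have "concat (rev us) @ [m] \<approx> concat (rev (ins m us))"
      using Cons.prems by (intro Cons.IH) auto
    from styl_cong_context[OF this _ i, of "[]"] some show ?thesis
      by (simp add: ins_Cons)
  qed
  finally show ?case by simp
qed

lemma cong_concat_N: "set w \<subseteq> {1..n} \<Longrightarrow> w \<approx> concat (N w)"
proof -
  assume "set w \<subseteq> {1..n}"
  then have "w \<approx> concat (rev (inserts [] w)) \<and>
    (\<forall>u\<in>set (inserts [] w). sorted_wrt (<) u \<and> set u \<subseteq> {1..n})"
  proof (induction w rule: rev_induct)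
    case Nil
    then show ?case by (auto intro!: styl_cong_refl)
  next
    case (snoc x w)
    then have IH: "w \<approx> concat (rev (inserts [] w))"
      "\<forall>u\<in>set (inserts [] w). sorted_wrt (<) u \<and> set u \<subseteq> {1..n}" and x: "x \<in> {1..n}" by auto
    have "w @ [x] \<approx> concat (rev (inserts [] w)) @ [x]"
      using styl_cong_context[OF IH(1), of "[]" "[x]"] x by simp
    also have "concat (rev (inserts [] w)) @ [x] \<approx> concat (rev (ins x (inserts [] w)))"
      using IH(2) x by (rule cong_ins)
    finally show ?case using ins_rows[OF IH(2) x] by simp
  qed
  then show ?thesis by (simp add: N_def)
qed

text \<open>The tableau of the concatenation is an invariant of reduction. Since normal words are
  recovered from their tableaux by \<open>N_concat_normal\<close>, normal forms are unique.\<close>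

lemma N_rows_cong:
  assumes "w \<in> lists (rows n)" "u \<in> rows n" "v \<in> rows n" "s \<in> lists (rows n)"
  shows "N (concat (w @ N (u @ v) @ s)) = N (concat (w @ [u, v] @ s))"
proof -
  have c: "u @ v \<approx> concat (N (u @ v))" using assms by (intro cong_concat_N) (auto simp: rows_def)
  have "concat w @ (u @ v) @ concat s \<approx> concat w @ concat (N (u @ v)) @ concat s"
    using assms by (intro styl_cong_context c) (auto simp: rows_def)
  then show ?thesis by (simp add: N_cong)
qed

lemma lower_rows: "u \<in> rows n \<Longrightarrow> v \<in> rows n \<Longrightarrow> lower_row u v \<in> rows n"
  by (auto simp: rows_def lower_row_def)

lemma upper_rows: "u \<in> rows n \<Longrightarrow> upper_row u v \<noteq> [] \<Longrightarrow> upper_row u v \<in> rows n"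
  by (auto simp: rows_def sorted_upper set_upper)

lemma N_rows: "u \<in> rows n \<Longrightarrow> v \<in> rows n \<Longrightarrow> N (u @ v) \<in> lists (rows n)"
  using lower_rows upper_rows by (auto simp: N_rows2 rows_def)

lemma N_concat_normal: "w \<in> lists (rows n) \<Longrightarrow> successively (\<triangleleft>) w \<Longrightarrow> N (concat w) = w"
  by (rule N_concat_tableau) (auto simp: rows_def)

end

section \<open>Termination of the row rewriting system\<close>

text \<open>No single weight decreases: a reduction may both copy a letter to the row on its right and remove
  letters.  But the smallest letter \<open>z\<close> whose occurrences change is copied only into rows with smaller
  letters, and moves to the right otherwise.  So the costs of the letters decrease lexicographically.\<close>

primrec cost :: "nat \<Rightarrow> row list \<Rightarrow> nat" where
  "cost z [] = 0"
| "cost z (r # w) = (if \<exists>y\<in>set r. y < z then (if z \<in> set r then 0 else 1)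
     else if z \<in> set r then length w + 1 else 0) + cost z w"

lemma cost_prefix:
  "length w = length w' \<Longrightarrow> cost z w = cost z w' \<Longrightarrow> cost z (p @ w) = cost z (p @ w')"
  "length w = length w' \<Longrightarrow> cost z w < cost z w' \<Longrightarrow> cost z (p @ w) < cost z (p @ w')"
  by (induction p) auto

lemma upper_below_lower: "upper_row u v \<noteq> [] \<Longrightarrow> v \<noteq> [] \<Longrightarrow> upper_row u v \<triangleleft> lower_row u v"
proof -
  assume ne: "upper_row u v \<noteq> []" "v \<noteq> []"
  then have "Min (set (upper_row u v)) \<in> set (upper_row u v)" by (intro Min_in) auto
  then obtain z where "z \<in> set v" "z < Min (set (upper_row u v))" unfolding set_upper by auto
  moreover from this have "Min (set (lower_row u v)) \<le> z" by (intro Min_le) auto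
  moreover have "set (upper_row u v) \<subseteq> set (lower_row u v)" by (auto simp: set_upper)
  ultimately show ?thesis unfolding below_def by linarith
qed

lemma cost_decreases:
  assumes u: "u \<in> rows n" and v: "v \<in> rows n" and "\<not> u \<triangleleft> v" and upper_row: "upper_row u v \<noteq> []"
  obtains z where "z \<le> n" "\<And>y. y < z \<Longrightarrow> cost y (p @ [upper_row u v, lower_row u v] @ s) = cost y (p @ [u, v] @ s)"
    "cost z (p @ [upper_row u v, lower_row u v] @ s) < cost z (p @ [u, v] @ s)"
proof -
  let ?a = "upper_row u v" and ?b = "lower_row u v"
  let ?D = "\<lambda>z. (z \<in> set u) \<noteq> (z \<in> set ?a) \<or> (z \<in> set v) \<noteq> (z \<in> set ?b)"
  have "\<exists>z. ?D z"
  proof (rule ccontr)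
    assume "\<not> ?thesis"
    then have "set u = set ?a" "set v = set ?b" by blast+
    then have "?a = u" "?b = v" using u v by (auto intro!: strict_sorted_eqI simp: sorted_upper rows_def lower_row_def)
    then show False using upper_below_lower[OF upper_row] v assms(3) by (auto simp: rows_def)
  qed
  \<comment> \<open>The least letter whose distribution over the two rows changes; all costs of
    smaller letters are therefore unaffected.\<close>
  then obtain z where z: "?D z" and less: "\<And>y. y < z \<Longrightarrow> \<not> ?D y"
    using exists_least_iff[of ?D] by blast
  have zu: "z \<in> set u" using z by (auto simp: set_upper)
  have lower_u: "(\<exists>x\<in>set ?a. x < y) \<longleftrightarrow> (\<exists>x\<in>set u. x < y)"
   and lower_v: "(\<exists>x\<in>set ?b. x < y) \<longleftrightarrow> (\<exists>x\<in>set v. x < y)" if "y \<le> z" for y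
    using less that less_le_trans by blast+
  \<comment> \<open>All letters of \<open>u\<close> enter the lower row; those below z changed
    nothing there, so they were in \<open>v\<close> already.\<close>
  have sub: "x \<in> set v" if "x \<in> set u" "x < z" for x using less[OF that(2)] that by auto
  show thesis
  proof
    show "z \<le> n" using zu u by (auto simp: rows_def)
    show "cost y (p @ [?a, ?b] @ s) = cost y (p @ [u, v] @ s)" if "y < z" for y
      using less[OF that] lower_u[of y] lower_v[of y] that by (intro cost_prefix) auto
    have "cost z ([?a, ?b] @ s) < cost z ([u, v] @ s)"
    \<comment> \<open>If \<open>v\<close> has a letter below z, then z is bumped and also newly
      copied into the lower row, which saves the cost 1 of its absence there. Otherwise z disappears
      from the upper row and is counted one place further to the right.\<close>
    proof (cases "\<exists>x\<in>set v. x < z")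
      case True
      have "\<exists>x\<in>set v. x < z \<and> (\<forall>w\<in>set u. w < z \<longrightarrow> w \<le> x)"
      proof (cases "\<exists>w\<in>set u. w < z")
        case True
        define m where "m = Max {w \<in> set u. w < z}"
        have "{w \<in> set u. w < z} \<noteq> {}" using True by auto
        then have "m \<in> {w \<in> set u. w < z}" unfolding m_def by (intro Max_in) auto
        moreover have "\<forall>w\<in>set u. w < z \<longrightarrow> w \<le> m" unfolding m_def by auto
        ultimately show ?thesis using sub by blast
      qed (use True in auto)
      then have "z \<in> set ?a" using zu by (auto simp: set_upper)
      moreover from this z zu have "z \<notin> set v" by auto
      ultimately show ?thesis using True zu lower_u[of z] lower_v[of z] by simp
    next
      case False
      then have "z \<notin> set ?a" by (auto simp: set_upper)
      moreover have "\<not> (\<exists>x\<in>set u. x < z)" using sub False by blast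
      ultimately show ?thesis using False zu lower_u[of z] lower_v[of z] by simp
    qed
    then show "cost z (p @ [?a, ?b] @ s) < cost z (p @ [u, v] @ s)"
      by (intro cost_prefix) auto
  qed
qed

definition red :: "nat \<Rightarrow> (row list \<times> row list) set" where
  "red n = {(p @ N (u @ v) @ s, p @ [u, v] @ s) | p u v s. \<not> u \<triangleleft> v \<and> p @ [u, v] @ s \<in> lists (rows n)}"

lemma redI: "\<not> u \<triangleleft> v \<Longrightarrow> p @ [u, v] @ s \<in> lists (rows n) \<Longrightarrow> (p @ N (u @ v) @ s, p @ [u, v] @ s) \<in> red n"
  unfolding red_def by blast

lemma wf_red: "wf (red n)"
proof -
  \<comment> \<open>\<open>lex\<close> compares lists of equal length, hence one entry for each
    number from 0 to n. The length of the word comes first because a product may merge two rows into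
    one.\<close>
  let ?R = "inv_image (less_than <*lex*> lex less_than) (\<lambda>w. (length w, map (\<lambda>z. cost z w) [0..<Suc n]))"
  have "wf ?R" by (intro wf_inv_image wf_lex_prod wf_lex wf_less_than)
  moreover have "red n \<subseteq> ?R"
  proof
    fix x assume "x \<in> red n"
    then obtain p u v s where x: "x = (p @ N (u @ v) @ s, p @ [u, v] @ s)" "\<not> u \<triangleleft> v"
      and uv: "u \<in> rows n" "v \<in> rows n" unfolding red_def by auto
    then have N: "N (u @ v) = (if upper_row u v = [] then [lower_row u v] else [upper_row u v, lower_row u v])"
      by (intro N_rows2) (auto simp: rows_def)
    show "x \<in> ?R"
    proof (cases "upper_row u v = []")
      case False
      obtain z where z: "z \<le> n" "\<And>y. y < z \<Longrightarrow> cost y (p @ [upper_row u v, lower_row u v] @ s) = cost y (p @ [u, v] @ s)"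
        "cost z (p @ [upper_row u v, lower_row u v] @ s) < cost z (p @ [u, v] @ s)"
        using cost_decreases[OF uv x(2) False] by metis
      have "[0..<Suc n] = [0..<z] @ z # [Suc z..<Suc n]"
        using z(1) upt_add_eq_append[of 0 z "Suc n - z"] upt_conv_Cons[of z "Suc n"] by simp
      then show ?thesis using z(2,3) x N False
        by (auto simp: lex_conv intro!: exI[of _ "map (\<lambda>z. cost z (p @ [u, v] @ s)) [0..<z]"])
    qed (simp add: x N)
  qed
  ultimately show ?thesis by (rule wf_subset)
qed

section \<open>Leftmost normalization paths\<close>

lemma row_coh_sel [simp]:
  "gen1 (row_coh n) = rows n"
  "gen2 (row_coh n) = {(u, v). u \<in> rows n \<and> v \<in> rows n \<and> \<not> u \<triangleleft> v}"
  "dom2 (row_coh n) (u, v) = [u, v]"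
  "cod2 (row_coh n) (u, v) = N (u @ v)"
  "gen3 (row_coh n) = critical n"
  "dom3 (row_coh n) (u, v, t) = (\<alpha> u v \<star>\<^sub>0 Id1 [t]) \<star>\<^sub>1 \<Lambda> (N (u @ v) @ [t])"
  "cod3 (row_coh n) (u, v, t) = (Id1 [u] \<star>\<^sub>0 \<alpha> v t) \<star>\<^sub>1 \<Lambda> ([u] @ N (v @ t))"
  by (simp_all add: row_coh_def row_pres_def polygraph2.extend_def)

lemma leftmost_unique:
  assumes "p @ u # v # s = p' @ u' # v' # s'" "successively (\<triangleleft>) (p @ [u])" "\<not> u \<triangleleft> v"
    "successively (\<triangleleft>) (p' @ [u'])" "\<not> u' \<triangleleft> v'"
  shows "p = p' \<and> u = u' \<and> v = v' \<and> s = s'"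
proof -
  have False if prems: "p @ u # v # s = p' @ u' # v' # s'" "successively (\<triangleleft>) (p' @ [u'])" "\<not> u \<triangleleft> v"
    "length p < length p'" for p u v s p' u' v' s'
  proof -
    obtain r where "p @ r = p'" "u # v # s = r @ u' # v' # s'"
      using prems(1,4) unfolding append_eq_append_conv2 by force
    moreover from this have "r \<noteq> []" using prems(4) by auto
    ultimately obtain q where q: "p' = p @ u # q" "v # s = q @ u' # v' # s'"
      by (cases r) auto
    then have "hd (q @ [u']) = v" by (cases q) auto
    with that(2) q(1) have "u \<triangleleft> v" by (simp add: successively_append_iff successively_Cons)
    with that(3) show False by simp
  qed
  from this[of p u v s p' u' v' s'] this[of p' u' v' s' p u v s] have "length p = length p'"
    using assms by (metis linorder_neqE_nat)
  then show ?thesis using assms(1) by simp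
qed

lemma not_successively_append: "successively (\<triangleleft>) (p @ u # v # s) \<Longrightarrow> u \<triangleleft> v"
  by (simp add: successively_append_iff)

text \<open>\<open>\<Lambda>\<close> is a definite description, so it requires determinism of the
  leftmost strategy in addition to termination.\<close>

lemma leftmost_path_unique: "leftmost_path w f \<Longrightarrow> leftmost_path w g \<Longrightarrow> f = g"
proof (induction arbitrary: g rule: leftmost_path.induct)
  case (1 w)
  from 1(2) show ?case
  proof cases
    case (2 p u v s f)
    then show ?thesis using 1(1) not_successively_append[of p u v s] by simp
  qed simp
next
  case (2 p u v s f)
  from 2(5) show ?case
  proof cases
    case 1
    then show ?thesis using 2(2) not_successively_append[of p u v s] by simp
  next
    case (2 p' u' v' s' f')
    then have "p = p' \<and> u = u' \<and> v = v' \<and> s = s'"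
      using \<open>successively (\<triangleleft>) (p @ [u])\<close> \<open>\<not> u \<triangleleft> v\<close> by (intro leftmost_unique) simp_all
    then show ?thesis using "2.IH" 2 by simp
  qed
qed

lemma leftmost_reducible:
  "\<not> successively (\<triangleleft>) w \<Longrightarrow> \<exists>p u v s. w = p @ [u, v] @ s \<and> successively (\<triangleleft>) (p @ [u]) \<and> \<not> u \<triangleleft> v"
proof (induction w)
  case (Cons a w)
  show ?case
  proof (cases "successively (\<triangleleft>) w")
    case True
    then obtain b w' where "w = b # w'" "\<not> a \<triangleleft> b" using Cons.prems by (cases w) auto
    then have "a # w = [] @ [a, b] @ w' \<and> successively (\<triangleleft>) ([] @ [a]) \<and> \<not> a \<triangleleft> b" by simp
    then show ?thesis by blast
  next
    case False
    then obtain p u v s where w: "w = p @ [u, v] @ s" "successively (\<triangleleft>) (p @ [u])" "\<not> u \<triangleleft> v"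
      using Cons.IH by blast
    show ?thesis
    proof (cases "a \<triangleleft> hd (p @ [u])")
      case True
      then have "successively (\<triangleleft>) ((a # p) @ [u])" using w(2) by (auto simp: successively_Cons)
      then have "a # w = (a # p) @ [u, v] @ s \<and> successively (\<triangleleft>) ((a # p) @ [u]) \<and> \<not> u \<triangleleft> v"
        using w by simp
      then show ?thesis by blast
    next
      case False
      moreover obtain w' where "w = hd (p @ [u]) # w'" using w(1) by (cases p) auto
      ultimately have "a # w = [] @ [a, hd (p @ [u])] @ w' \<and> successively (\<triangleleft>) ([] @ [a]) \<and> \<not> a \<triangleleft> hd (p @ [u])"
        by simp
      then show ?thesis by blast
    qed
  qed
qed simp

context
  fixes n :: nat
begin

lemma reduct_rows:
  "p @ [u, v] @ s \<in> lists (rows n) \<Longrightarrow> p @ N (u @ v) @ s \<in> lists (rows n)"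
  using N_rows[of u n v] by simp

lemma red_rows: "(w', w) \<in> (red n)\<^sup>* \<Longrightarrow> w \<in> lists (rows n) \<Longrightarrow> w' \<in> lists (rows n)"
proof (induction rule: converse_rtrancl_induct)
  case (step w' w'')
  from step(1) obtain p u v s where w: "w' = p @ N (u @ v) @ s" "w'' = p @ [u, v] @ s"
    unfolding red_def by blast
  show ?case using reduct_rows[of p u v s] step(3,4) unfolding w by blast
qed

lemma leftmost_path_exists: "w \<in> lists (rows n) \<Longrightarrow> \<exists>f. leftmost_path w f"
proof (induction w rule: wf_induct_rule[OF wf_red[of n]])
  case (1 w)
  show ?case
  proof (cases "successively (\<triangleleft>) w")
    case False
    then obtain p u v s where w: "w = p @ [u, v] @ s" "successively (\<triangleleft>) (p @ [u])" "\<not> u \<triangleleft> v"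
      using leftmost_reducible by blast
    then obtain f where "leftmost_path (p @ N (u @ v) @ s) f"
      using 1(1)[of "p @ N (u @ v) @ s"] 1(2) redI[of u v p s n] reduct_rows[of p u v s] by blast
    from leftmost_path.intros(2)[OF w(2,3) this] show ?thesis unfolding w(1) by blast
  qed (auto intro: leftmost_path.intros)
qed

lemma \<Lambda>_eqI: "leftmost_path w f \<Longrightarrow> \<Lambda> w = f"
  unfolding \<Lambda>_def by (rule the_equality) (auto intro: leftmost_path_unique)

lemma leftmost_path_\<Lambda>: "w \<in> lists (rows n) \<Longrightarrow> leftmost_path w (\<Lambda> w)"
  using leftmost_path_exists \<Lambda>_eqI by metis

lemma \<Lambda>_normal: "successively (\<triangleleft>) w \<Longrightarrow> \<Lambda> w = Id1 w"
  by (intro \<Lambda>_eqI leftmost_path.intros)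

abbreviation redex :: "row list \<Rightarrow> row \<Rightarrow> row \<Rightarrow> row list \<Rightarrow> rcell2" where
  "redex p u v s \<equiv> Id1 p \<star>\<^sub>0 \<alpha> u v \<star>\<^sub>0 Id1 s"

lemma \<Lambda>_step:
  assumes "p @ [u, v] @ s \<in> lists (rows n)" "successively (\<triangleleft>) (p @ [u])" "\<not> u \<triangleleft> v"
  shows "\<Lambda> (p @ [u, v] @ s) = redex p u v s \<star>\<^sub>1 \<Lambda> (p @ N (u @ v) @ s)"
  using assms reduct_rows by (intro \<Lambda>_eqI leftmost_path.intros leftmost_path_\<Lambda>)

section \<open>Normal forms as targets of leftmost paths\<close>

abbreviation nf :: "row list \<Rightarrow> row list" where
  "nf w \<equiv> N (concat w)"

lemma nf_reduct: "p @ [u, v] @ s \<in> lists (rows n) \<Longrightarrow> nf (p @ N (u @ v) @ s) = nf (p @ [u, v] @ s)"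
  using N_rows_cong[of p n u v s] by simp

lemma leftmost_path_cell:
  "leftmost_path w f \<Longrightarrow> w \<in> lists (rows n) \<Longrightarrow> is_cell2 (row_coh n) f \<and> positive f \<and>
    src1 (row_coh n) f = w \<and> tgt1 (row_coh n) f = nf w \<and> successively (\<triangleleft>) (nf w) \<and> nf w \<in> lists (rows n)"
proof (induction rule: leftmost_path.induct)
  case (1 w)
  then show ?case using N_concat_normal[of w n] by auto
next
  case (2 p u v s f)
  then show ?case using reduct_rows[of p u v s] nf_reduct[of p u v s] by auto
qed

lemma
  assumes "w \<in> lists (rows n)"
  shows is_cell2_\<Lambda>: "is_cell2 (row_coh n) (\<Lambda> w)" and positive_\<Lambda>: "positive (\<Lambda> w)"
    and src1_\<Lambda>: "src1 (row_coh n) (\<Lambda> w) = w" and tgt1_\<Lambda>: "tgt1 (row_coh n) (\<Lambda> w) = nf w"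
    and successively_nf: "successively (\<triangleleft>) (nf w)" and nf_rows: "nf w \<in> lists (rows n)"
  using leftmost_path_cell[OF leftmost_path_\<Lambda>[OF assms] assms] by auto

lemma nf_append:
  assumes "w \<in> lists (rows n)" "s \<in> lists (rows n)" "p \<in> lists (rows n)"
  shows "nf (p @ nf w @ s) = nf (p @ w @ s)"
proof -
  have "nf (p @ w @ s) = nf (p @ v @ s)" if "leftmost_path w f" "v = tgt1 (row_coh n) f" for f v
    using that assms
  proof (induction rule: leftmost_path.induct)
    case (2 p' u v s' f)
    then show ?case using reduct_rows[of p' u v s'] nf_reduct[of "p @ p'" u v "s' @ s"] by simp
  qed simp
  from this[OF leftmost_path_\<Lambda>[OF assms(1)]] show ?thesis using tgt1_\<Lambda>[OF assms(1)] by simp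
qed

lemma bounded2_row_coh: "bounded2 (row_coh n)"
  using N_rows by (auto simp: bounded2_def)

text \<open>The two branches of a critical triple end in the same word because both reducts have the
  tableau of the original word.\<close>

lemma is_polygraph3_row_coh: "is_polygraph3 (row_coh n)"
proof -
  have "parallel2 (row_coh n) (dom3 (row_coh n) (u, v, t)) (cod3 (row_coh n) (u, v, t))"
    if "(u, v, t) \<in> critical n" for u v t
  proof -
    have r: "u \<in> rows n" "v \<in> rows n" "t \<in> rows n" "\<not> u \<triangleleft> v" "\<not> v \<triangleleft> t" using that by (auto simp: critical_def)
    have w: "N (u @ v) @ [t] \<in> lists (rows n)" "[u] @ N (v @ t) \<in> lists (rows n)"
      using r N_rows[of u n v] N_rows[of v n t] by auto
    have "nf (N (u @ v) @ [t]) = N (u @ v @ t)" "nf ([u] @ N (v @ t)) = N (u @ v @ t)"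
      using r N_rows_cong[of "[]" n u v "[t]"] N_rows_cong[of "[u]" n v t "[]"] by auto
    then show ?thesis using r is_cell2_\<Lambda>[OF w(1)] is_cell2_\<Lambda>[OF w(2)] src1_\<Lambda>[OF w(1)] src1_\<Lambda>[OF w(2)]
       tgt1_\<Lambda>[OF w(1)] tgt1_\<Lambda>[OF w(2)] by (auto simp: parallel2_def)
  qed
  then show ?thesis using bounded2_row_coh unfolding is_polygraph3_def bounded2_def by auto
qed

text \<open>As long as \<open>w\<close> is reducible, the leftmost redex of \<open>w @ s\<close>
  lies in \<open>w\<close>. So a context on the right is compatible with leftmost paths on the nose;
  for a context on the left only a filler is available, see \<open>filled_whisker\<close>.\<close>

lemma flat_\<Lambda>_append:
  assumes "w \<in> lists (rows n)" "s \<in> lists (rows n)"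
  shows "flat (row_coh n) (\<Lambda> (w @ s)) =
    whisker [] s (flat (row_coh n) (\<Lambda> w)) @ flat (row_coh n) (\<Lambda> (nf w @ s))"
proof -
  have "flat (row_coh n) (\<Lambda> (w @ s)) = whisker [] s (flat (row_coh n) f) @ flat (row_coh n) (\<Lambda> (nf w @ s))"
    if "leftmost_path w f" for f
    using that assms
  proof (induction rule: leftmost_path.induct)
    case (1 w)
    then show ?case using N_concat_normal[of w n] by simp
  next
    case (2 p u v s' f)
    then show ?case
      using reduct_rows[of p u v s'] nf_reduct[of p u v s'] \<Lambda>_step[of p u v "s' @ s"] by simp
  qed
  then show ?thesis using leftmost_path_\<Lambda>[OF assms(1)] by blast
qed

end

section \<open>Coherence\<close>

text \<open>A triple outside \<open>C\<close> may be filled by a composite of other generators. This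
  is what allows the argument to be applied directly to the reduced set of generators.\<close>

locale row_filling =
  fixes n :: nat and C :: "(row \<times> row \<times> row) set"
  assumes sub: "C \<subseteq> critical n"
    and critical_filled: "\<And>\<tau>. \<tau> \<in> critical n \<Longrightarrow>
      filled ((row_coh n)\<lparr>gen3 := C\<rparr>) (dom3 (row_coh n) \<tau>) (cod3 (row_coh n) \<tau>)"
begin

abbreviation (input) "P \<equiv> (row_coh n)\<lparr>gen3 := C\<rparr>"

lemma P: "is_polygraph3 P"
  using is_polygraph3_gen3[OF is_polygraph3_row_coh] sub by simp

lemmas bounded = bounded2_row_coh[of n]

abbreviation (input) "W \<equiv> lists (rows n)"

lemmas \<Lambda>_simps = is_cell2_\<Lambda>[of _ n] positive_\<Lambda>[of _ n] src1_\<Lambda>[of _ n] tgt1_\<Lambda>[of _ n] nf_rows[of _ n]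

lemma filled_flatI:
  "is_cell2 (row_coh n) f \<Longrightarrow> is_cell2 (row_coh n) g \<Longrightarrow> positive f \<Longrightarrow> positive g \<Longrightarrow>
   src1 (row_coh n) f = src1 (row_coh n) g \<Longrightarrow> flat (row_coh n) f = flat (row_coh n) g \<Longrightarrow> filled P f g"
  using filled_eq2[OF P, of f g] eq2_flatI[OF bounded] by simp

lemma filled_cong1_right:
  "filled P g g' \<Longrightarrow> is_cell2 (row_coh n) f \<Longrightarrow> tgt1 (row_coh n) f = src1 (row_coh n) g \<Longrightarrow> filled P (f \<star>\<^sub>1 g) (f \<star>\<^sub>1 g')"
  by (intro filled_cong1 P filled_refl) simp_all

text \<open>The local form of coherence, suited to Noetherian induction: the choice of the first
  redex does not matter up to fillers.\<close>

definition coherent_at :: "row list \<Rightarrow> bool" where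
  "coherent_at w \<longleftrightarrow> (\<forall>p u v s. w = p @ [u, v] @ s \<longrightarrow> \<not> u \<triangleleft> v \<longrightarrow>
     filled P (redex p u v s \<star>\<^sub>1 \<Lambda> (p @ N (u @ v) @ s)) (\<Lambda> w))"

lemma coherent_atD:
  "coherent_at w \<Longrightarrow> w = p @ [u, v] @ s \<Longrightarrow> \<not> u \<triangleleft> v \<Longrightarrow>
   filled P (redex p u v s \<star>\<^sub>1 \<Lambda> (p @ N (u @ v) @ s)) (\<Lambda> w)"
  by (simp add: coherent_at_def)

text \<open>Coherence of the reducts is an assumption here because the lemma serves inside the
  induction for \<open>coherent_at\<close>; afterwards \<open>filled_whisker\<close> discharges
  it.\<close>

lemma filled_whisker_path:
  assumes "leftmost_path x f" "p @ x @ s \<in> W"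
    "\<And>w. (w, p @ x @ s) \<in> (red n)\<^sup>* \<Longrightarrow> coherent_at w"
  shows "filled P ((Id1 p \<star>\<^sub>0 f \<star>\<^sub>0 Id1 s) \<star>\<^sub>1 \<Lambda> (p @ nf x @ s)) (\<Lambda> (p @ x @ s))"
  using assms
proof (induction rule: leftmost_path.induct)
  case (1 x)
  then have x: "nf x = x" using N_concat_normal[of x n] by simp
  show ?case using 1 \<Lambda>_simps[of "p @ x @ s"] unfolding x by (intro filled_flatI) auto
next
  case (2 p' u v s' f)
  let ?x = "p' @ [u, v] @ s'" and ?y = "p' @ N (u @ v) @ s'"
  have x: "?x \<in> W" and y: "?y \<in> W" "p @ ?y @ s \<in> W"
    using 2(5) reduct_rows[of p' u v s' n] by auto
  have nf: "nf ?y = nf ?x" using nf_reduct[OF x] .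
  note f = leftmost_path_cell[OF 2(3) y(1)]
  have red: "(p @ ?y @ s, p @ ?x @ s) \<in> red n"
    using redI[of u v "p @ p'" "s' @ s" n] 2(2,5) by simp
  have nfW: "p @ nf ?x @ s \<in> W" using nf_rows[OF x] 2(5) by simp
  let ?r = "redex (p @ p') u v (s' @ s)"
  have "filled P ((Id1 p \<star>\<^sub>0 (redex p' u v s' \<star>\<^sub>1 f) \<star>\<^sub>0 Id1 s) \<star>\<^sub>1 \<Lambda> (p @ nf ?x @ s))
     (?r \<star>\<^sub>1 ((Id1 p \<star>\<^sub>0 f \<star>\<^sub>0 Id1 s) \<star>\<^sub>1 \<Lambda> (p @ nf ?y @ s)))"
    using 2 f \<Lambda>_simps[OF nfW] nf by (intro filled_flatI) auto
  also have "filled P \<dots> (?r \<star>\<^sub>1 \<Lambda> (p @ ?y @ s))"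
  proof (rule filled_cong1_right)
    show "filled P ((Id1 p \<star>\<^sub>0 f \<star>\<^sub>0 Id1 s) \<star>\<^sub>1 \<Lambda> (p @ nf ?y @ s)) (\<Lambda> (p @ ?y @ s))"
      using y(2) 2(6) red by (intro 2(4)) (blast intro: rtrancl_into_rtrancl)+
  qed (use 2 f in auto)
  also have "filled P (?r \<star>\<^sub>1 \<Lambda> (p @ ?y @ s)) (\<Lambda> (p @ ?x @ s))"
    using coherent_atD[OF 2(6)[OF rtrancl.rtrancl_refl], of "p @ p'" u v "s' @ s"] 2(2) by simp
  finally show ?case .
qed

text \<open>The usual trichotomy of local branchings: equal, overlapping in one row, disjoint. No
  redex lies to the left of (u0, v0), because the rows up to u0 are already a tableau.\<close>

lemma position_cases:
  assumes "p @ [u, v] @ s = p0 @ [u0, v0] @ s0" "successively (\<triangleleft>) (p0 @ [u0])" "\<not> u \<triangleleft> v"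
  obtains "p = p0" "u = u0" "v = v0" "s = s0"
  | "p = p0 @ [u0]" "u = v0" "s0 = v # s"
  | m where "p = p0 @ [u0, v0] @ m" "s0 = m @ [u, v] @ s"
proof (cases "length p < length p0")
  case True
  obtain r where "p @ r = p0" "u # v # s = r @ u0 # v0 # s0"
    using True assms(1) by (auto simp: append_eq_append_conv2)
  moreover from this have "r \<noteq> []" using True by auto
  ultimately obtain q where q: "p0 = p @ u # q" "v # s = q @ u0 # v0 # s0"
    by (cases r) auto
  then have "hd (q @ [u0]) = v" by (cases q) auto
  with assms(2) q(1) have "u \<triangleleft> v" by (simp add: successively_append_iff successively_Cons)
  with assms(3) show thesis by simp
next
  case False
  obtain r where r: "p = p0 @ r" "r @ u # v # s = u0 # v0 # s0"
    using False assms(1) by (auto simp: append_eq_append_conv2)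
  show thesis
  proof (cases r)
    case Nil
    then show thesis using r that(1) by simp
  next
    case (Cons a q)
    then show thesis using r that(2) that(3)[of "tl q"] by (cases q) auto
  qed
qed

lemma coherent_at: "w \<in> W \<Longrightarrow> coherent_at w"
proof (induction w rule: wf_induct_rule[OF wf_trancl[OF wf_red[of n]]])
  case (1 w)
  have IH: "coherent_at w'" if "(w', y) \<in> (red n)\<^sup>*" "(y, w) \<in> red n" for w' y
  proof -
    have t: "(w', w) \<in> (red n)\<^sup>+" using that by (rule rtrancl_into_trancl1)
    then have "w' \<in> W" using red_rows[of w' w n] 1(2) by (simp add: trancl_into_rtrancl)
    then show ?thesis using 1(1)[OF t] by blast
  qed
  show ?case unfolding coherent_at_def
  proof (intro allI impI)
    fix p u v s
    assume w: "w = p @ [u, v] @ s" and uv: "\<not> u \<triangleleft> v"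
    then have "\<not> successively (\<triangleleft>) w" by (auto simp: successively_append_iff)
    then obtain p0 u0 v0 s0 where w0: "w = p0 @ [u0, v0] @ s0" "successively (\<triangleleft>) (p0 @ [u0])" "\<not> u0 \<triangleleft> v0"
      using leftmost_reducible by blast
    have \<Lambda>w: "\<Lambda> w = redex p0 u0 v0 s0 \<star>\<^sub>1 \<Lambda> (p0 @ N (u0 @ v0) @ s0)"
      using \<Lambda>_step[of p0 u0 v0 s0 n] w0 1(2) by simp
    have reds: "p0 @ N (u0 @ v0) @ s0 \<in> W" "p @ N (u @ v) @ s \<in> W"
      using reduct_rows[OF 1(2)[unfolded w0(1)]] reduct_rows[OF 1(2)[unfolded w]] .
    have redw: "(p0 @ N (u0 @ v0) @ s0, w) \<in> red n" "(p @ N (u @ v) @ s, w) \<in> red n"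
      using redI[OF w0(3) 1(2)[unfolded w0(1)], folded w0(1)] redI[OF uv 1(2)[unfolded w], folded w] .
    show "filled P (redex p u v s \<star>\<^sub>1 \<Lambda> (p @ N (u @ v) @ s)) (\<Lambda> w)"
    proof (rule position_cases[of p u v s p0 u0 v0 s0])
      show "p @ [u, v] @ s = p0 @ [u0, v0] @ s0" using w w0 by simp
    next
      assume "p = p0" "u = u0" "v = v0" "s = s0"
      then show ?thesis using \<Lambda>w 1(2) w w0(3) \<Lambda>_simps[OF reds(2)] by (auto intro!: filled_refl[OF P])
    next
      assume o: "p = p0 @ [u0]" "u = v0" "s0 = v # s"
      have r: "u0 \<in> rows n" "u \<in> rows n" "v \<in> rows n" "p0 \<in> W" "s \<in> W" using 1(2) w o by auto
      have \<tau>: "(u0, u, v) \<in> critical n" using r w0(3) uv o by (simp add: critical_def)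
      let ?x1 = "N (u0 @ u) @ [v]" and ?x2 = "[u0] @ N (u @ v)" and ?z = "N (u0 @ u @ v)"
      have x: "?x1 \<in> W" "?x2 \<in> W" "p0 @ ?x1 @ s \<in> W" "p0 @ ?x2 @ s \<in> W"
        using r N_rows[of u0 n u] N_rows[of u n v] by auto
      have z: "nf ?x1 = ?z" "nf ?x2 = ?z"
        using N_rows_cong[of "[]" n u0 u "[v]"] N_rows_cong[of "[u0]" n u v "[]"] r by simp_all
      have zW: "p0 @ ?z @ s \<in> W" using nf_rows[OF x(1)] z r by simp
      note c = \<Lambda>_simps[OF x(1)] \<Lambda>_simps[OF x(2)] \<Lambda>_simps[OF x(3)] \<Lambda>_simps[OF x(4)] \<Lambda>_simps[OF zW]
      have e: "(p0 @ ?x1 @ s, w) \<in> red n" "(p0 @ ?x2 @ s, w) \<in> red n" using redw o by simp_all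
      \<comment> \<open>The leftmost path of each reduct is traded for one that first normalizes the
        three overlapping rows. The filler of the critical triple then applies in the context of
        \<open>p0\<close> and \<open>s\<close>.\<close>
      have step1: "filled P (\<Lambda> (p0 @ ?x1 @ s)) ((Id1 p0 \<star>\<^sub>0 \<Lambda> ?x1 \<star>\<^sub>0 Id1 s) \<star>\<^sub>1 \<Lambda> (p0 @ ?z @ s))"
        by (rule filled_sym[OF filled_whisker_path[OF leftmost_path_\<Lambda>[OF x(1)] x(3), unfolded z]])
          (rule IH[OF _ e(1)])
      have step2: "filled P ((Id1 p0 \<star>\<^sub>0 \<Lambda> ?x2 \<star>\<^sub>0 Id1 s) \<star>\<^sub>1 \<Lambda> (p0 @ ?z @ s)) (\<Lambda> (p0 @ ?x2 @ s))"
        by (rule filled_whisker_path[OF leftmost_path_\<Lambda>[OF x(2)] x(4), unfolded z]) (rule IH[OF _ e(2)])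
      have "filled P (\<Lambda> w) (redex p0 u0 u (v # s) \<star>\<^sub>1 ((Id1 p0 \<star>\<^sub>0 \<Lambda> ?x1 \<star>\<^sub>0 Id1 s) \<star>\<^sub>1 \<Lambda> (p0 @ ?z @ s)))"
        using \<Lambda>w o step1 r w0(3) c by (auto intro!: filled_cong1_right)
      also have "filled P \<dots> ((Id1 p0 \<star>\<^sub>0 ((\<alpha> u0 u \<star>\<^sub>0 Id1 [v]) \<star>\<^sub>1 \<Lambda> ?x1) \<star>\<^sub>0 Id1 s) \<star>\<^sub>1 \<Lambda> (p0 @ ?z @ s))"
        using c z r w0(3) o by (intro filled_flatI) auto
      also have "filled P \<dots> ((Id1 p0 \<star>\<^sub>0 ((Id1 [u0] \<star>\<^sub>0 \<alpha> u v) \<star>\<^sub>1 \<Lambda> ?x2) \<star>\<^sub>0 Id1 s) \<star>\<^sub>1 \<Lambda> (p0 @ ?z @ s))"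
        by (rule filled_cong1[OF P filled_cong0[OF filled_refl[OF P] filled_cong0[OF _ filled_refl[OF P]]]
              filled_refl[OF P]]) (use critical_filled[OF \<tau>] c z r in auto)
      also have "filled P \<dots> (redex p u v s \<star>\<^sub>1 ((Id1 p0 \<star>\<^sub>0 \<Lambda> ?x2 \<star>\<^sub>0 Id1 s) \<star>\<^sub>1 \<Lambda> (p0 @ ?z @ s)))"
        using c z r uv o by (intro filled_flatI) auto
      also have "filled P \<dots> (redex p u v s \<star>\<^sub>1 \<Lambda> (p @ N (u @ v) @ s))"
        using step2 c r uv o by (auto intro!: filled_cong1_right)
      finally show ?thesis by (rule filled_sym)
    next
      fix m assume o: "p = p0 @ [u0, v0] @ m" "s0 = m @ [u, v] @ s"
      have r: "u0 \<in> rows n" "v0 \<in> rows n" "u \<in> rows n" "v \<in> rows n" "p0 \<in> W" "m \<in> W" "s \<in> W"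
        using 1(2) w o by auto
      note N = N_rows[OF r(1,2)] N_rows[OF r(3,4)]
      \<comment> \<open>The common reduct of the two disjoint reductions. By induction both leftmost
        paths may be routed through it, which leaves a Peiffer square.\<close>
      let ?w = "p0 @ N (u0 @ v0) @ m @ N (u @ v) @ s"
      have W: "?w \<in> W" using r N by simp
      note c = \<Lambda>_simps[OF W] \<Lambda>_simps[OF reds(1)] \<Lambda>_simps[OF reds(2)]
      let ?r1 = "redex p0 u0 v0 (m @ [u, v] @ s)" and ?r2 = "redex (p0 @ N (u0 @ v0) @ m) u v s"
      let ?s1 = "redex p0 u0 v0 (m @ N (u @ v) @ s)"
      have step1: "filled P (\<Lambda> (p0 @ N (u0 @ v0) @ s0)) (?r2 \<star>\<^sub>1 \<Lambda> ?w)"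
        using filled_sym[OF coherent_atD[OF IH[OF rtrancl_refl redw(1)], of "p0 @ N (u0 @ v0) @ m" u v s]] uv o
        by simp
      have step2: "filled P (?s1 \<star>\<^sub>1 \<Lambda> ?w) (\<Lambda> (p @ N (u @ v) @ s))"
        using coherent_atD[OF IH[OF rtrancl_refl redw(2)], of p0 u0 v0 "m @ N (u @ v) @ s"] w0(3) o
        by simp
      have "filled P (\<Lambda> w) (?r1 \<star>\<^sub>1 (?r2 \<star>\<^sub>1 \<Lambda> ?w))"
        using \<Lambda>w o step1 r w0(3) c by (auto intro!: filled_cong1_right)
      also have "filled P \<dots> (redex p u v s \<star>\<^sub>1 (?s1 \<star>\<^sub>1 \<Lambda> ?w))"
      proof -
        have "eq2 (row_coh n) (?r1 \<star>\<^sub>1 (?r2 \<star>\<^sub>1 \<Lambda> ?w)) (redex p u v s \<star>\<^sub>1 (?s1 \<star>\<^sub>1 \<Lambda> ?w))"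
          by (rule eq2_flat_swapI[OF bounded, where ?l1.0 = "[]" and p = p0 and b = "(u0, v0)" and m = m
            and b' = "(u, v)" and s = s and ?l2.0 = "flat (row_coh n) (\<Lambda> ?w)"])
            (use c r N w0(3) uv o in auto)
        then show ?thesis by (intro filled_eq2 P) simp
      qed
      also have "filled P \<dots> (redex p u v s \<star>\<^sub>1 \<Lambda> (p @ N (u @ v) @ s))"
        using step2 c r uv o N by (auto intro!: filled_cong1_right)
      finally show ?thesis by (rule filled_sym)
    qed (use w0(2) uv in auto)
  qed
qed

lemma filled_whisker:
  assumes "p @ x @ s \<in> W"
  shows "filled P ((Id1 p \<star>\<^sub>0 \<Lambda> x \<star>\<^sub>0 Id1 s) \<star>\<^sub>1 \<Lambda> (p @ nf x @ s)) (\<Lambda> (p @ x @ s))"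
proof (rule filled_whisker_path)
  show "leftmost_path x (\<Lambda> x)" using assms by (intro leftmost_path_\<Lambda>[of _ n]) auto
  show "coherent_at w" if "(w, p @ x @ s) \<in> (red n)\<^sup>*" for w
  proof -
    have "w \<in> W" using red_rows[OF that assms] .
    then show ?thesis by (rule coherent_at)
  qed
qed fact

lemma filled_\<Lambda>_append:
  assumes "p \<in> W" "q \<in> W"
  shows "filled P ((\<Lambda> p \<star>\<^sub>0 \<Lambda> q) \<star>\<^sub>1 \<Lambda> (nf p @ nf q)) (\<Lambda> (p @ q))"
proof -
  have W: "nf p \<in> W" "nf q \<in> W" "nf p @ q \<in> W" "nf p @ nf q \<in> W"
    using nf_rows[OF assms(1)] nf_rows[OF assms(2)] assms by auto
  note c = \<Lambda>_simps[OF assms(1)] \<Lambda>_simps[OF assms(2)] \<Lambda>_simps[OF W(3)] \<Lambda>_simps[OF W(4)]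
  let ?p = "Id1 [] \<star>\<^sub>0 \<Lambda> p \<star>\<^sub>0 Id1 q"
  have "filled P ((\<Lambda> p \<star>\<^sub>0 \<Lambda> q) \<star>\<^sub>1 \<Lambda> (nf p @ nf q))
      (?p \<star>\<^sub>1 ((Id1 (nf p) \<star>\<^sub>0 \<Lambda> q \<star>\<^sub>0 Id1 []) \<star>\<^sub>1 \<Lambda> (nf p @ nf q)))"
    using c W assms by (intro filled_flatI) auto
  also have "filled P \<dots> (?p \<star>\<^sub>1 \<Lambda> (nf p @ q))"
    using filled_whisker[of "nf p" q "[]"] c W assms by (intro filled_cong1_right) auto
  also have "filled P \<dots> (\<Lambda> (p @ q))"
    using filled_whisker[of "[]" p q] c W assms by simp
  finally show ?thesis .
qed

text \<open>Normalization paths form a cone over all 2-cells, inverses included. This extends local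
  coherence from single reductions to arbitrary zigzags.\<close>

lemma filled_normalize:
  "is_cell2 (row_coh n) f \<Longrightarrow> filled P (f \<star>\<^sub>1 \<Lambda> (tgt1 (row_coh n) f)) (\<Lambda> (src1 (row_coh n) f))"
proof (induction f)
  case (Id1 w)
  then show ?case using \<Lambda>_simps[of w] by (intro filled_flatI) auto
next
  case (Gen2 b)
  obtain u v where b: "b = (u, v)" by fastforce
  with Gen2 have r: "u \<in> rows n" "v \<in> rows n" "\<not> u \<triangleleft> v" by auto
  have N: "N (u @ v) \<in> W" using N_rows[OF r(1,2)] .
  have "\<Lambda> [u, v] = redex [] u v [] \<star>\<^sub>1 \<Lambda> (N (u @ v))"
    using \<Lambda>_step[of "[]" u v "[]" n] r by simp
  then show ?case using r b \<Lambda>_simps[OF N] N by (intro filled_flatI) auto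
next
  case (Comp20 f g)
  then have f: "is_cell2 (row_coh n) f" and g: "is_cell2 (row_coh n) g" by auto
  let ?p = "src1 (row_coh n) f" and ?p' = "tgt1 (row_coh n) f" and ?q = "src1 (row_coh n) g" and ?q' = "tgt1 (row_coh n) g"
  have W: "?p \<in> W" "?p' \<in> W" "?q \<in> W" "?q' \<in> W"
    using is_cell2_lists[OF bounded f] is_cell2_lists[OF bounded g] by simp_all
  note c = \<Lambda>_simps[OF W(1)] \<Lambda>_simps[OF W(2)] \<Lambda>_simps[OF W(3)] \<Lambda>_simps[OF W(4)]
  \<comment> \<open>The normal forms agree because filled cells are parallel, so this can be read
    off from the induction hypotheses.\<close>
  have nf: "nf ?p = nf ?p'" "nf ?q = nf ?q'"
    using filled_parallel[OF P Comp20.IH(1)[OF f]] filled_parallel[OF P Comp20.IH(2)[OF g]] c by simp_all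
  have W': "nf ?p' @ nf ?q' \<in> W" using c by simp
  note c' = \<Lambda>_simps[OF W'] \<Lambda>_simps[of "?p' @ ?q'"]
  let ?z = "\<Lambda> (nf ?p' @ nf ?q')"
  have "filled P ((f \<star>\<^sub>0 g) \<star>\<^sub>1 \<Lambda> (?p' @ ?q')) ((f \<star>\<^sub>0 g) \<star>\<^sub>1 ((\<Lambda> ?p' \<star>\<^sub>0 \<Lambda> ?q') \<star>\<^sub>1 ?z))"
    using filled_sym[OF filled_\<Lambda>_append[OF W(2,4)]] f g W c' by (intro filled_cong1_right) auto
  also have "filled P \<dots> (((f \<star>\<^sub>0 g) \<star>\<^sub>1 (\<Lambda> ?p' \<star>\<^sub>0 \<Lambda> ?q')) \<star>\<^sub>1 ?z)"
    using f g c c' by (intro filled_eq2[OF P] eq2.sym[OF eq2.assoc1]) auto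
  also have "filled P \<dots> (((f \<star>\<^sub>1 \<Lambda> ?p') \<star>\<^sub>0 (g \<star>\<^sub>1 \<Lambda> ?q')) \<star>\<^sub>1 ?z)"
    using f g c c' by (intro filled_cong1[OF P] filled_eq2[OF P] filled_refl[OF P] eq2.sym[OF eq2.exchange]) auto
  also have "filled P \<dots> ((\<Lambda> ?p \<star>\<^sub>0 \<Lambda> ?q) \<star>\<^sub>1 ?z)"
    using Comp20.IH f g c c' by (intro filled_cong1[OF P] filled_cong0 filled_refl[OF P]) auto
  also have "filled P \<dots> (\<Lambda> (?p @ ?q))"
    using filled_\<Lambda>_append[OF W(1,3)] nf by simp
  finally show ?case by simp
next
  case (Comp21 f g)
  then have fg: "is_cell2 (row_coh n) f" "is_cell2 (row_coh n) g" "tgt1 (row_coh n) f = src1 (row_coh n) g" by auto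
  have W: "tgt1 (row_coh n) g \<in> W" using is_cell2_lists[OF bounded fg(2)] by simp
  have "filled P ((f \<star>\<^sub>1 g) \<star>\<^sub>1 \<Lambda> (tgt1 (row_coh n) g)) (f \<star>\<^sub>1 (g \<star>\<^sub>1 \<Lambda> (tgt1 (row_coh n) g)))"
    using fg \<Lambda>_simps[OF W] by (intro filled_eq2[OF P] eq2.assoc1) auto
  also have "filled P \<dots> (f \<star>\<^sub>1 \<Lambda> (src1 (row_coh n) g))"
    using fg Comp21.IH by (intro filled_cong1_right) auto
  also have "filled P \<dots> (\<Lambda> (src1 (row_coh n) f))" using fg Comp21.IH by simp
  finally show ?case by simp
next
  case (Inv2 f)
  then have f: "is_cell2 (row_coh n) f" by simp
  let ?s = "src1 (row_coh n) f" and ?t = "tgt1 (row_coh n) f"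
  have W: "?s \<in> W" "?t \<in> W" using is_cell2_lists[OF bounded f] by simp_all
  note c = \<Lambda>_simps[OF W(1)] \<Lambda>_simps[OF W(2)]
  have "filled P (Inv2 f \<star>\<^sub>1 \<Lambda> ?s) (Inv2 f \<star>\<^sub>1 (f \<star>\<^sub>1 \<Lambda> ?t))"
    using filled_sym[OF Inv2.IH[OF f]] f c by (intro filled_cong1_right) auto
  also have "filled P \<dots> ((Inv2 f \<star>\<^sub>1 f) \<star>\<^sub>1 \<Lambda> ?t)"
    using f c by (intro filled_eq2[OF P] eq2.sym[OF eq2.assoc1]) auto
  also have "filled P \<dots> (Id1 ?t \<star>\<^sub>1 \<Lambda> ?t)"
    using f c eq2.inv_left[OF f] by (intro filled_cong1[OF P] filled_eq2[OF P] filled_refl[OF P]) auto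
  also have "filled P \<dots> (\<Lambda> ?t)"
    using W c by (intro filled_flatI) auto
  finally show ?case by simp
qed

text \<open>Both cells followed by the normalization path of their target are filled against the
  path of their source. That path is invertible in the free (2,1)-category and can be
  cancelled.\<close>

lemma filled_parallel2:
  assumes "parallel2 (row_coh n) f g"
  shows "filled P f g"
proof -
  have cells: "is_cell2 (row_coh n) f" "is_cell2 (row_coh n) g" and s: "src1 (row_coh n) f = src1 (row_coh n) g"
    and t: "tgt1 (row_coh n) f = tgt1 (row_coh n) g" using assms by (auto simp: parallel2_def)
  let ?t = "tgt1 (row_coh n) g"
  let ?L = "\<Lambda> ?t"
  have W: "?t \<in> W" "src1 (row_coh n) g \<in> W" using is_cell2_lists[OF bounded cells(2)] by simp_all
  note c = \<Lambda>_simps[OF W(1)]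
  have cancel: "filled P h ((h \<star>\<^sub>1 ?L) \<star>\<^sub>1 Inv2 ?L)" if h: "is_cell2 (row_coh n) h" "tgt1 (row_coh n) h = ?t" for h
  proof -
    have "filled P h (h \<star>\<^sub>1 Id1 ?t)"
      using h eq2.sym[OF eq2.unit1_right[OF h(1)]] by (intro filled_eq2[OF P]) simp
    also have "filled P \<dots> (h \<star>\<^sub>1 (?L \<star>\<^sub>1 Inv2 ?L))"
      using h c eq2.sym[OF eq2.inv_right[OF c(1)]] by (intro filled_cong1_right filled_eq2[OF P]) auto
    also have "filled P \<dots> ((h \<star>\<^sub>1 ?L) \<star>\<^sub>1 Inv2 ?L)"
      using h c by (intro filled_eq2[OF P] eq2.sym[OF eq2.assoc1]) auto
    finally show ?thesis .
  qed
  have "filled P (f \<star>\<^sub>1 ?L) (g \<star>\<^sub>1 ?L)"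
    using filled_trans[OF filled_normalize[OF cells(1)], unfolded s t, OF filled_sym[OF filled_normalize[OF cells(2)]]] .
  then have "filled P ((f \<star>\<^sub>1 ?L) \<star>\<^sub>1 Inv2 ?L) ((g \<star>\<^sub>1 ?L) \<star>\<^sub>1 Inv2 ?L)"
    by (rule filled_cong1[OF P]) (use cells t c in \<open>auto intro!: filled_refl[OF P]\<close>)
  from filled_trans[OF cancel[OF cells(1) t] filled_trans[OF this filled_sym[OF cancel[OF cells(2) HOL.refl]]]]
  show ?thesis .
qed

end

section \<open>The boundaries of the spheres\<close>

lemma upper_subset: "set (upper_row u v) \<subseteq> set u"
  by (auto simp: set_upper)

lemma min_in_upper:
  assumes "z \<in> set v" "\<And>y. y \<in> set u \<Longrightarrow> z < y" "u \<noteq> []"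
  shows "Min (set u) \<in> set (upper_row u v)"
  using assms by (auto simp: set_upper leD intro!: bexI[of _ z])

text \<open>Enlarging \<open>v\<close> to the right of \<open>u\<close> cannot make it fit above
  \<open>t\<close>. Hence the step on (b, t) in \<open>\<Theta>L\<close> always exists.\<close>

lemma lower_not_below: "v \<noteq> [] \<Longrightarrow> \<not> v \<triangleleft> t \<Longrightarrow> \<not> lower_row u v \<triangleleft> t"
  by (auto simp: below_def intro: less_le_trans Min_antimono)

lemma below_lower: "a \<triangleleft> b \<Longrightarrow> b \<noteq> [] \<Longrightarrow> a \<triangleleft> lower_row b t"
  using le_less_trans[OF Min_antimono[of "set b" "set b \<union> set t"]] by (auto simp: below_def)

lemma lower_below: "a \<triangleleft> d \<Longrightarrow> b \<triangleleft> d \<Longrightarrow> a \<noteq> [] \<Longrightarrow> b \<noteq> [] \<Longrightarrow> lower_row a b \<triangleleft> d"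
  by (auto simp: below_def Min_Un)

lemma below_trans_subset: "a \<triangleleft> c \<Longrightarrow> set c \<subseteq> set v \<Longrightarrow> c \<noteq> [] \<Longrightarrow> a \<triangleleft> v"
  using le_less_trans[OF Min_antimono[of "set c" "set v"]] by (auto simp: below_def)

text \<open>In \<open>\<Theta>R\<close> this shows that once the lower row has been multiplied by
  \<open>d\<close>, the row i already lies below the new upper row, so no further step is
  needed.\<close>

lemma upper_below_upper_lower:
  assumes cd: "c \<triangleleft> d" and ne: "c \<noteq> []" "d \<noteq> []" and i: "upper_row u c \<noteq> []"
  shows "upper_row u c \<triangleleft> upper_row (lower_row u c) d"
proof -
  have sub: "set c \<subseteq> set d" using cd by (simp add: below_def)
  have "set (upper_row u c) \<subseteq> set (upper_row (lower_row u c) d)"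
  proof
    fix y assume "y \<in> set (upper_row u c)"
    then obtain z where z: "y \<in> set u" "z \<in> set c" "z < y" "\<forall>w\<in>set u. w < y \<longrightarrow> w \<le> z"
      unfolding set_upper by auto
    let ?S = "{w \<in> set (lower_row u c). w < y}"
    have S: "finite ?S" "z \<in> ?S" using z by auto
    \<comment> \<open>The predecessor of y in the lower row. It belongs to \<open>c\<close>, as a
      letter of \<open>u\<close> below y does not exceed the letter z that bumped y; hence it lies
      in \<open>d\<close> and bumps y again.\<close>
    define m where "m = Max ?S"
    have "?S \<noteq> {}" using S(2) by blast
    then have m: "m \<in> ?S" "\<forall>w\<in>?S. w \<le> m" unfolding m_def using Max_in[OF S(1)] Max_ge[OF S(1)] by blast+
    have "m \<in> set c"
    proof (cases "m \<in> set c")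
      case False
      then have "m \<le> z" using m z by auto
      then show ?thesis using m(2) S(2) z(2) by (metis order.antisym)
    qed
    then show "y \<in> set (upper_row (lower_row u c) d)" using z(1) m sub by (auto simp: set_upper)
  qed
  moreover have "Min (set (upper_row (lower_row u c) d)) < Min (set (upper_row u c))"
  proof -
    have "Min (set (upper_row u c)) \<in> set (upper_row u c)" using i by (intro Min_in) auto
    then obtain c0 where c0: "c0 \<in> set c" "c0 < Min (set (upper_row u c))" unfolding set_upper by auto
    let ?d = "Min (set d)"
    have d: "?d \<in> set d" using ne by (intro Min_in) auto
    have "Min (set c) \<le> c0" using c0 by (intro Min_le) auto
    with cd have "?d < c0" by (auto simp: below_def)
    let ?S = "{w \<in> set (lower_row u c). ?d < w}"
    have S: "finite ?S" "c0 \<in> ?S" using c0 \<open>?d < c0\<close> by auto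
    \<comment> \<open>The first letter of the lower row above the minimum of \<open>d\<close> is
      bumped by that minimum. It does not exceed \<open>c0\<close>, which bumped the least letter of
      \<open>upper_row u c\<close>.\<close>
    define m where "m = Min ?S"
    have "?S \<noteq> {}" using S(2) by blast
    then have m: "m \<in> ?S" "\<forall>w\<in>?S. m \<le> w" unfolding m_def using Min_in[OF S(1)] Min_le[OF S(1)] by blast+
    then have "m \<le> c0" using S(2) by blast
    have "w \<le> ?d" if w: "w \<in> set (lower_row u c)" "w < m" for w
    proof (rule ccontr)
      assume "\<not> w \<le> ?d"
      then have "m \<le> w" using w(1) m(2) by simp
      with w(2) show False by simp
    qed
    then have "m \<in> set (upper_row (lower_row u c) d)" using m(1) d unfolding set_upper by blast
    then have "Min (set (upper_row (lower_row u c) d)) \<le> m" by (intro Min_le) auto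
    then show ?thesis using \<open>m \<le> c0\<close> c0(2) by simp
  qed
  ultimately show ?thesis by (simp add: below_def)
qed

context
  fixes n :: nat
begin

lemma N_rows_cases:
  assumes "u \<in> rows n" "v \<in> rows n"
  shows "(upper_row u v = [] \<and> N (u @ v) = [lower_row u v]) \<or> (upper_row u v \<noteq> [] \<and> N (u @ v) = [upper_row u v, lower_row u v])"
  using N_rows2[of u v] assms by (auto simp: rows_def)

lemma rows_ne: "u \<in> rows n \<Longrightarrow> u \<noteq> []"
  by (simp add: rows_def)

lemma rows_Cons: "x # u \<in> rows n \<Longrightarrow> u \<noteq> [] \<Longrightarrow> [x] \<in> rows n \<and> u \<in> rows n \<and> (\<forall>y\<in>set u. x < y)"
  by (auto simp: rows_def)

lemma Cons_rows: "[x] \<in> rows n \<Longrightarrow> a \<in> rows n \<Longrightarrow> \<forall>y\<in>set a. x < y \<Longrightarrow> x # a \<in> rows n"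
  by (auto simp: rows_def)

lemma not_below_greater: "\<forall>y\<in>set a. x < y \<Longrightarrow> \<not> [x] \<triangleleft> a"
  by (auto simp: below_def)

lemma N_row: "u \<in> rows n \<Longrightarrow> N u = [u]"
  by (simp add: rows_def N_def inserts_Nil_row)

lemma N_concat_cong:
  assumes "u \<in> rows n" "v \<in> rows n" "p \<in> lists (rows n)" "s \<in> lists (rows n)"
  shows "N (concat p @ concat (N (u @ v)) @ concat s) = N (concat p @ u @ v @ concat s)"
  using N_rows_cong[OF assms(3,1,2,4)] by simp

section \<open>Flattened normalization paths of short words\<close>

abbreviation (input) "Q \<equiv> row_coh n"

lemmas Q = is_polygraph3_row_coh[of n]

lemmas \<Lambda>_simps = is_cell2_\<Lambda>[of _ n] positive_\<Lambda>[of _ n] src1_\<Lambda>[of _ n] tgt1_\<Lambda>[of _ n]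

lemma flat_\<Lambda>_normal: "successively (\<triangleleft>) w \<Longrightarrow> flat Q (\<Lambda> w) = []"
  by (simp add: \<Lambda>_normal)

lemma flat_\<Lambda>_redex:
  "u \<in> rows n \<Longrightarrow> v \<in> rows n \<Longrightarrow> s \<in> lists (rows n) \<Longrightarrow> \<not> u \<triangleleft> v \<Longrightarrow>
   flat Q (\<Lambda> (u # v # s)) = ([], (u, v), s) # flat Q (\<Lambda> (N (u @ v) @ s))"
  using \<Lambda>_step[of "[]" u v s n] by simp

lemma flat_\<Lambda>_below:
  "u \<in> rows n \<Longrightarrow> v \<in> rows n \<Longrightarrow> t \<in> rows n \<Longrightarrow> s \<in> lists (rows n) \<Longrightarrow> u \<triangleleft> v \<Longrightarrow> \<not> v \<triangleleft> t \<Longrightarrow>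
   flat Q (\<Lambda> (u # v # t # s)) = ([u], (v, t), s) # flat Q (\<Lambda> (u # N (v @ t) @ s))"
  using \<Lambda>_step[of "[u]" v t s n] by simp

lemma flat_\<Lambda>_N: "u \<in> rows n \<Longrightarrow> v \<in> rows n \<Longrightarrow> flat Q (\<Lambda> (N (u @ v))) = []"
  using successively_nf[of "[u, v]" n] by (simp add: flat_\<Lambda>_normal)

lemma flat_\<Lambda>_pair:
  "u \<in> rows n \<Longrightarrow> v \<in> rows n \<Longrightarrow> flat Q (\<Lambda> [u, v]) = (if u \<triangleleft> v then [] else [([], (u, v), [])])"
  using flat_\<Lambda>_redex[of u v "[]"] flat_\<Lambda>_N by (simp add: flat_\<Lambda>_normal)

lemma filler_\<X>:
  "(u, v, t) \<in> critical n \<Longrightarrow> filler Q (\<X> u v t) ((\<alpha> u v \<star>\<^sub>0 Id1 [t]) \<star>\<^sub>1 \<Lambda> (N (u @ v) @ [t]))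
     ((Id1 [u] \<star>\<^sub>0 \<alpha> v t) \<star>\<^sub>1 \<Lambda> ([u] @ N (v @ t)))"
  using filler_Gen[OF Q, of "(u, v, t)"] by simp

lemma filler_Id2: "is_cell2 Q f \<Longrightarrow> filler Q (Id2 f) f f"
  by (intro filler_Id Q eq2.refl)

lemmas eq2I = eq2_flatI[OF bounded2_row_coh[of n]]

lemma filler_Xhat:
  assumes "(u, v, t) \<in> critical n" "w \<in> lists (rows n)"
  shows "filler Q (Xhat w u v t)
     ((((\<alpha> u v \<star>\<^sub>0 Id1 [t]) \<star>\<^sub>1 \<Lambda> (N (u @ v) @ [t])) \<star>\<^sub>0 Id1 w) \<star>\<^sub>1 \<Lambda> (N (u @ v @ t) @ w))
     ((((Id1 [u] \<star>\<^sub>0 \<alpha> v t) \<star>\<^sub>1 \<Lambda> ([u] @ N (v @ t))) \<star>\<^sub>0 Id1 w) \<star>\<^sub>1 \<Lambda> (N (u @ v @ t) @ w))"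
proof -
  have r: "u \<in> rows n" "v \<in> rows n" "t \<in> rows n" using assms by (auto simp: critical_def)
  have W: "N (u @ v @ t) \<in> lists (rows n)" using nf_rows[of "[u, v, t]" n] r by simp
  have W': "N (u @ v) @ [t] \<in> lists (rows n)" using N_rows r by simp
  have "tgt1 Q (\<Lambda> (N (u @ v) @ [t])) = N (u @ v @ t)"
    using tgt1_\<Lambda>[OF W'] N_concat_cong[of u v "[]" "[t]"] r by simp
  then show ?thesis unfolding Xhat_def
    using W assms(2) \<Lambda>_simps[of "N (u @ v @ t) @ w"]
    by (intro filler_comp1 filler_comp0 Q filler_\<X> assms(1) filler_Id2) auto
qed

text \<open>Each piece has a known boundary from its generator; the case distinctions follow the
  number of rows that occur, and flattening shows that consecutive pieces fit.\<close>

lemma filler_\<Theta>L: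
  assumes r: "[x] \<in> rows n" "u \<in> rows n" "v \<in> rows n" "t \<in> rows n" and x: "\<forall>y\<in>set u. x < y"
    and uv: "\<not> u \<triangleleft> v" and vt: "\<not> v \<triangleleft> t"
  shows "filler Q (\<Theta>L x u v t) ((\<Lambda> ([x] # N (u @ v)) \<star>\<^sub>0 Id1 [t]) \<star>\<^sub>1 \<Lambda> (N (x # u @ v) @ [t]))
    ((Id1 [[x]] \<star>\<^sub>0 \<Lambda> (N (u @ v) @ [t])) \<star>\<^sub>1 \<Lambda> ([x] # N (u @ v @ t)))"
proof -
  define a b where "a = upper_row u v" and "b = lower_row u v"
  note ne = r[THEN rows_ne]
  have b: "b \<in> rows n" using r by (simp add: b_def lower_rows)
  have bt: "\<not> b \<triangleleft> t" using vt ne by (simp add: b_def lower_not_below)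
  note Nbt = N_rows[OF b r(4)] and Nuv = N_rows[OF r(2,3)]
  have M: "N (x # concat (N (u @ v))) = N (x # u @ v)"
    using N_concat_cong[of u v "[[x]]" "[]"] r by simp
  have Mt: "N (concat (N (u @ v)) @ t) = N (u @ v @ t)"
    using N_concat_cong[of u v "[]" "[t]"] r by simp
  have WM: "N (x # u @ v) \<in> lists (rows n)" using nf_rows[of "[[x], u, v]" n] r by simp
  have WZ: "N (u @ v @ t) \<in> lists (rows n)" using nf_rows[of "[u, v, t]" n] r by simp
  have Mxt: "N (concat (N (x # u @ v)) @ t) = N (x # u @ v @ t)"
    using nf_append[of "[[x], u, v]" n "[t]" "[]"] r by simp
  have Zx: "N (x # concat (N (u @ v @ t))) = N (x # u @ v @ t)"
    using nf_append[of "[u, v, t]" n "[]" "[[x]]"] r by simp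
  show ?thesis
  proof (cases "a = []")
    case True
    then have Nb: "N (u @ v) = [b]" using N_rows_cases[OF r(2,3)] by (simp add: a_def b_def)
    \<comment> \<open>If [x] were below b, then x would be a letter of \<open>v\<close>, being
      smaller than all of \<open>u\<close>. It would bump the minimum of \<open>u\<close>, contrary
      to the empty upper row.\<close>
    have xb: "\<not> [x] \<triangleleft> b"
    proof
      assume "[x] \<triangleleft> b"
      then have "x \<in> set v" using x by (auto simp: below_def b_def)
      then show False using min_in_upper[of x v u] x ne True by (auto simp: a_def)
    qed
    have \<tau>: "([x], b, t) \<in> critical n" using r b xb bt by (simp add: critical_def)
    have M: "N (x # b) = N (x # u @ v)" and Z: "N (b @ t) = N (u @ v @ t)" using M Mt Nb by simp_all
    have flat: "flat Q (\<Lambda> (N (x # b))) = []" using flat_\<Lambda>_N[of "[x]" b] r b by simp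
    note Zx' = Zx[folded Z] and Mxt' = Mxt[folded M]
    have "\<Theta>L x u v t = \<X> [x] b t" by (simp add: \<Theta>L_def Nb)
    moreover have "eq2 Q ((\<alpha> [x] b \<star>\<^sub>0 Id1 [t]) \<star>\<^sub>1 \<Lambda> (N ([x] @ b) @ [t]))
      ((\<Lambda> ([x] # N (u @ v)) \<star>\<^sub>0 Id1 [t]) \<star>\<^sub>1 \<Lambda> (N (x # u @ v) @ [t]))"
      using r b xb WM flat by (intro eq2I) (auto simp: Nb M[symmetric] \<Lambda>_simps flat_\<Lambda>_pair)
    moreover have "eq2 Q ((Id1 [[x]] \<star>\<^sub>0 \<alpha> b t) \<star>\<^sub>1 \<Lambda> ([[x]] @ N (b @ t)))
      ((Id1 [[x]] \<star>\<^sub>0 \<Lambda> (N (u @ v) @ [t])) \<star>\<^sub>1 \<Lambda> ([x] # N (u @ v @ t)))"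
      using r b bt WZ by (intro eq2I) (auto simp: Nb Z[symmetric] \<Lambda>_simps flat_\<Lambda>_pair)
    ultimately show ?thesis using filler_eq2[OF filler_\<X>[OF \<tau>]] by simp
  next
    case False
    then have Nab: "N (u @ v) = [a, b]" using N_rows_cases[OF r(2,3)] by (simp add: a_def b_def)
    have a: "a \<in> rows n" using False r by (simp add: a_def upper_rows)
    have ab: "a \<triangleleft> b" using False ne by (simp add: a_def b_def upper_below_lower)
    have xa: "\<forall>y\<in>set a. x < y" using x upper_subset[of u v] by (auto simp: a_def)
    let ?c = "x # a"
    have c: "?c \<in> rows n" using Cons_rows[OF r(1) a xa] .
    have Nc: "N ?c = [?c]" using N_row[OF c] .
    have nxa: "\<not> [x] \<triangleleft> a" using not_below_greater[OF xa] .
    have M: "N (x # u @ v) = N (?c @ b)" and Z: "N (u @ v @ t) = N (a @ b @ t)" using M Mt Nab by simp_all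
    have WM: "N (?c @ b) \<in> lists (rows n)" using N_rows[OF c b] .
    have Ncb: "N (?c @ b) = [?c, b]" if "?c \<triangleleft> b"
      using N_concat_normal[of "[?c, b]" n] that c b by simp
    have Z': "N (a @ concat (N (b @ t))) = N (a @ b @ t)"
      using N_concat_cong[of b t "[a]" "[]"] r a b by simp
    have ft: "flat Q (\<Lambda> [?c, b, t]) = ([?c], (b, t), []) # flat Q (\<Lambda> (?c # N (b @ t)))" if "?c \<triangleleft> b"
      using flat_\<Lambda>_below[of ?c b t "[]"] that c b r bt by simp
    have Wc: "?c # N (b @ t) \<in> lists (rows n)" using c Nbt by simp
    define K where "K = (if ?c \<triangleleft> b then Id2 (\<Lambda> [?c, b, t]) else \<X> ?c b t)"
    \<comment> \<open>\<open>T1\<close> reduces (x, a) first and \<open>T2\<close> reduces (b, t)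
      first: the two sides of the Peiffer identity.\<close>
    define T1 where "T1 = (\<alpha> [x] a \<star>\<^sub>0 Id1 [b] \<star>\<^sub>0 Id1 [t]) \<star>\<^sub>1 (Id1 [?c] \<star>\<^sub>0 \<alpha> b t) \<star>\<^sub>1 \<Lambda> (?c # N (b @ t))"
    define T2 where "T2 = (Id1 [[x]] \<star>\<^sub>0 Id1 [a] \<star>\<^sub>0 \<alpha> b t) \<star>\<^sub>1 (\<alpha> [x] a \<star>\<^sub>0 Id1 (N (b @ t))) \<star>\<^sub>1 \<Lambda> (?c # N (b @ t))"
    define first where "first = Id2 (\<alpha> [x] a \<star>\<^sub>0 Id1 [b] \<star>\<^sub>0 Id1 [t]) \<bullet>\<^sub>1 K"
    define peiffer :: rcell3 where "peiffer = Id2 ((\<alpha> [x] a \<star>\<^sub>0 \<alpha> b t) \<star>\<^sub>1 \<Lambda> ([?c] @ N (b @ t)))"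
    \<comment> \<open>\<open>\<Lambda> [?c, b]\<close> is an identity or the single step on (xa, b),
      so one formula gives the boundary of both forms of \<open>K\<close>.\<close>
    have K: "filler Q K ((\<Lambda> [?c, b] \<star>\<^sub>0 Id1 [t]) \<star>\<^sub>1 \<Lambda> (N (?c @ b) @ [t]))
      ((Id1 [?c] \<star>\<^sub>0 \<alpha> b t) \<star>\<^sub>1 \<Lambda> (?c # N (b @ t)))"
    proof (cases "?c \<triangleleft> b")
      case True
      have 1: "eq2 Q (\<Lambda> [?c, b, t]) ((\<Lambda> [?c, b] \<star>\<^sub>0 Id1 [t]) \<star>\<^sub>1 \<Lambda> (N (?c @ b) @ [t]))"
        using True c b r Ncb WM by (intro eq2I) (auto simp: \<Lambda>_simps flat_\<Lambda>_pair)
      have 2: "eq2 Q (\<Lambda> [?c, b, t]) ((Id1 [?c] \<star>\<^sub>0 \<alpha> b t) \<star>\<^sub>1 \<Lambda> (?c # N (b @ t)))"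
        using True c b r Wc bt ft by (intro eq2I) (auto simp: \<Lambda>_simps)
      have "is_cell2 Q (\<Lambda> [?c, b, t])" using c b r by (simp add: \<Lambda>_simps)
      then show ?thesis using filler_eq2[OF filler_Id2 1 2] True by (simp add: K_def)
    next
      case F: False
      have \<tau>: "(?c, b, t) \<in> critical n" using F c b r bt by (simp add: critical_def)
      have 1: "eq2 Q ((\<alpha> ?c b \<star>\<^sub>0 Id1 [t]) \<star>\<^sub>1 \<Lambda> (N (?c @ b) @ [t]))
        ((\<Lambda> [?c, b] \<star>\<^sub>0 Id1 [t]) \<star>\<^sub>1 \<Lambda> (N (?c @ b) @ [t]))"
        using F c b r WM by (intro eq2I) (auto simp: \<Lambda>_simps flat_\<Lambda>_pair)
      have 2: "eq2 Q ((Id1 [?c] \<star>\<^sub>0 \<alpha> b t) \<star>\<^sub>1 \<Lambda> ([?c] @ N (b @ t))) ((Id1 [?c] \<star>\<^sub>0 \<alpha> b t) \<star>\<^sub>1 \<Lambda> (?c # N (b @ t)))"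
        using c b r Wc bt by (intro eq2I) (auto simp: \<Lambda>_simps)
      show ?thesis using filler_eq2[OF filler_\<X>[OF \<tau>] 1 2] F by (simp add: K_def)
    qed
    have "filler Q first ((\<alpha> [x] a \<star>\<^sub>0 Id1 [b] \<star>\<^sub>0 Id1 [t]) \<star>\<^sub>1 (\<Lambda> [?c, b] \<star>\<^sub>0 Id1 [t]) \<star>\<^sub>1 \<Lambda> (N (?c @ b) @ [t])) T1"
      unfolding first_def T1_def using r a b c nxa Nc
      by (intro filler_comp1 Q filler_Id2 K) (auto simp: \<Lambda>_simps)
    moreover have "eq2 Q ((\<alpha> [x] a \<star>\<^sub>0 Id1 [b] \<star>\<^sub>0 Id1 [t]) \<star>\<^sub>1 (\<Lambda> [?c, b] \<star>\<^sub>0 Id1 [t]) \<star>\<^sub>1 \<Lambda> (N (?c @ b) @ [t]))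
      ((\<Lambda> ([x] # N (u @ v)) \<star>\<^sub>0 Id1 [t]) \<star>\<^sub>1 \<Lambda> (N (x # u @ v) @ [t]))"
      using r a b c nxa Nc WM by (intro eq2I) (auto simp: M Nab \<Lambda>_simps flat_\<Lambda>_redex)
    moreover have T1: "is_cell2 Q T1"
      unfolding T1_def using r a b c nxa Nc Wc bt by (auto simp: \<Lambda>_simps)
    ultimately have first: "filler Q first ((\<Lambda> ([x] # N (u @ v)) \<star>\<^sub>0 Id1 [t]) \<star>\<^sub>1 \<Lambda> (N (x # u @ v) @ [t])) T1"
      by (rule filler_eq2[OF _ _ eq2.refl])
    have T2: "is_cell2 Q T2"
      unfolding T2_def using r a b c nxa Nc Wc bt Nbt by (auto simp: \<Lambda>_simps)
    have swap: "eq2 Q T1 T2"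
      by (rule eq2_flat_swapI[OF bounded2_row_coh T1 T2, where ?l1.0 = "[]" and p = "[]" and b = "([x], a)"
            and m = "[]" and b' = "(b, t)" and s = "[]" and ?l2.0 = "flat Q (\<Lambda> (?c # N (b @ t)))"])
        (use r a b c nxa Nc Wc bt Nbt in \<open>auto simp: T1_def T2_def \<Lambda>_simps\<close>)
    have pf: "eq2 Q ((\<alpha> [x] a \<star>\<^sub>0 \<alpha> b t) \<star>\<^sub>1 \<Lambda> ([?c] @ N (b @ t))) T1"
      using r a b c nxa Nc Wc bt T1 by (intro eq2I) (auto simp: T1_def \<Lambda>_simps)
    have peiffer: "filler Q peiffer T1 T2"
      unfolding peiffer_def by (rule filler_eq2[OF filler_Id[OF Q pf] pf swap])
    have fp: "filler Q (first \<bullet>\<^sub>2 peiffer) ((\<Lambda> ([x] # N (u @ v)) \<star>\<^sub>0 Id1 [t]) \<star>\<^sub>1 \<Lambda> (N (x # u @ v) @ [t])) T2"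
      using filler_comp2[OF first peiffer] .
    have fabt: "flat Q (\<Lambda> [a, b, t]) = ([a], (b, t), []) # flat Q (\<Lambda> (a # N (b @ t)))"
      using flat_\<Lambda>_below[of a b t "[]"] ab bt a b r by simp
    \<comment> \<open>The case where the path on \<open>[a, b, t]\<close> ends after its first
      step.\<close>
    have short: "eq2 Q T2 ((Id1 [[x]] \<star>\<^sub>0 \<Lambda> (N (u @ v) @ [t])) \<star>\<^sub>1 \<Lambda> ([x] # N (u @ v @ t)))"
      if "successively (\<triangleleft>) (a # N (b @ t))"
    proof -
      have Z2: "N (a @ b @ t) = a # N (b @ t)"
        using N_concat_normal[of "a # N (b @ t)" n] that a Nbt Z' by simp
      show ?thesis using T2 r a b c nxa Nc Wc bt Nbt that
        by (intro eq2I) (auto simp: T2_def Z Nab Z2 \<Lambda>_simps fabt flat_\<Lambda>_redex flat_\<Lambda>_normal)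
    qed
    have \<Theta>: "\<Theta>L x u v t = (case N (b @ t) of
              [e, f] \<Rightarrow>
                if a \<triangleleft> e then first \<bullet>\<^sub>2 peiffer
                else first \<bullet>\<^sub>2 peiffer \<bullet>\<^sub>2
                     (Id2 (Id1 [[x]] \<star>\<^sub>0 Id1 [a] \<star>\<^sub>0 \<alpha> b t) \<bullet>\<^sub>1 Xhat [f] [x] a e)
            | _ \<Rightarrow> first \<bullet>\<^sub>2 peiffer)"
      by (simp only: \<Theta>L_def Nab Let_def first_def peiffer_def K_def list.case)
    define e f where "e = upper_row b t" and "f = lower_row b t"
    have f: "f \<in> rows n" using b r by (simp add: f_def lower_rows)
    show ?thesis
    proof (cases "e = [] \<or> a \<triangleleft> e")
      case True
      have "a \<triangleleft> f" using below_lower[OF ab rows_ne[OF b]] by (simp add: f_def)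
      moreover have "e \<noteq> [] \<Longrightarrow> e \<triangleleft> f" using ne by (simp add: e_def f_def upper_below_lower)
      ultimately have "successively (\<triangleleft>) (a # N (b @ t))" "\<Theta>L x u v t = first \<bullet>\<^sub>2 peiffer"
        using True N_rows_cases[OF b r(4)] \<Theta> by (auto simp: e_def f_def)
      then show ?thesis using filler_eq2[OF fp eq2.refl short] filler_parallel[OF Q fp] by simp
    next
      case F: False
      then have Nef: "N (b @ t) = [e, f]" using N_rows_cases[OF b r(4)] by (simp add: e_def f_def)
      have e: "e \<in> rows n" using F b by (simp add: e_def upper_rows)
      have ef: "e \<triangleleft> f" using F ne by (simp add: e_def f_def upper_below_lower)
      have af: "a \<triangleleft> f" using below_lower[OF ab rows_ne[OF b]] by (simp add: f_def)
      have \<tau>: "([x], a, e) \<in> critical n" using r a e nxa F by (simp add: critical_def)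
      let ?last = "Id2 (Id1 [[x]] \<star>\<^sub>0 Id1 [a] \<star>\<^sub>0 \<alpha> b t) \<bullet>\<^sub>1 Xhat [f] [x] a e"
      have Nae: "N (a @ e) \<in> lists (rows n)" using N_rows[OF a e] .
      \<comment> \<open>Both a and e lie below f, hence so does their union; the path on
        \<open>[a, b, t]\<close> therefore ends with its second step.\<close>
      have succ: "successively (\<triangleleft>) (N (a @ e) @ [f])"
        using N_rows_cases[OF a e] upper_below_lower[of a e] lower_below[OF af ef] a e rows_ne by auto
      have Z2: "N (a @ b @ t) = N (a @ e) @ [f]"
      proof -
        have "N (a @ b @ t) = N (a @ e @ f)" using Z' Nef by simp
        also have "\<dots> = N (concat (N (a @ e) @ [f]))"
          using N_concat_cong[of a e "[]" "[f]"] a e f by simp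
        also have "\<dots> = N (a @ e) @ [f]" using N_concat_normal[OF _ succ, of n] Nae f by simp
        finally show ?thesis .
      qed
      have nfx: "N (concat ([[x]] @ N (a @ e))) = N (x # a @ e)"
        using N_concat_cong[of a e "[[x]]" "[]"] r a e by simp
      have fx: "flat Q (\<Lambda> ([x] # N (a @ e) @ [f])) =
          whisker [] [f] (flat Q (\<Lambda> ([x] # N (a @ e)))) @ flat Q (\<Lambda> (N (x # a @ e) @ [f]))"
        using flat_\<Lambda>_append[of "[x] # N (a @ e)" n "[f]"] nfx r Nae f by simp
      have fc: "flat Q (\<Lambda> [?c, e, f]) =
          whisker [] [f] (flat Q (\<Lambda> [?c, e])) @ flat Q (\<Lambda> (N (x # a @ e) @ [f]))"
        using flat_\<Lambda>_append[of "[?c, e]" n "[f]"] c e f by simp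
      have Wxae: "N (x # a @ e) \<in> lists (rows n)" using N_rows[OF c e] by simp
      have s: "eq2 Q ((Id1 [[x]] \<star>\<^sub>0 Id1 [a] \<star>\<^sub>0 \<alpha> b t) \<star>\<^sub>1
           ((((\<alpha> [x] a \<star>\<^sub>0 Id1 [e]) \<star>\<^sub>1 \<Lambda> (N ([x] @ a) @ [e])) \<star>\<^sub>0 Id1 [f]) \<star>\<^sub>1 \<Lambda> (N ([x] @ a @ e) @ [f]))) T2"
        using T2 r a b c e f nxa Nc bt Nef Wxae by (intro eq2I) (auto simp: T2_def \<Lambda>_simps fc)
      have t: "eq2 Q ((Id1 [[x]] \<star>\<^sub>0 Id1 [a] \<star>\<^sub>0 \<alpha> b t) \<star>\<^sub>1
           ((((Id1 [[x]] \<star>\<^sub>0 \<alpha> a e) \<star>\<^sub>1 \<Lambda> ([[x]] @ N (a @ e))) \<star>\<^sub>0 Id1 [f]) \<star>\<^sub>1 \<Lambda> (N ([x] @ a @ e) @ [f])))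
           ((Id1 [[x]] \<star>\<^sub>0 \<Lambda> (N (u @ v) @ [t])) \<star>\<^sub>1 \<Lambda> ([x] # N (u @ v @ t)))"
        using r a b c e f nxa Nc bt Nef F Wxae Nae nfx succ
        by (intro eq2I) (auto simp: Z Z2 Nab \<Lambda>_simps fabt flat_\<Lambda>_redex flat_\<Lambda>_normal fx)
      have "filler Q ?last ((Id1 [[x]] \<star>\<^sub>0 Id1 [a] \<star>\<^sub>0 \<alpha> b t) \<star>\<^sub>1
           ((((\<alpha> [x] a \<star>\<^sub>0 Id1 [e]) \<star>\<^sub>1 \<Lambda> (N ([x] @ a) @ [e])) \<star>\<^sub>0 Id1 [f]) \<star>\<^sub>1 \<Lambda> (N ([x] @ a @ e) @ [f])))
         ((Id1 [[x]] \<star>\<^sub>0 Id1 [a] \<star>\<^sub>0 \<alpha> b t) \<star>\<^sub>1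
           ((((Id1 [[x]] \<star>\<^sub>0 \<alpha> a e) \<star>\<^sub>1 \<Lambda> ([[x]] @ N (a @ e))) \<star>\<^sub>0 Id1 [f]) \<star>\<^sub>1 \<Lambda> (N ([x] @ a @ e) @ [f])))"
        using r a b bt f Nef by (intro filler_comp1 Q filler_Id2 filler_Xhat \<tau>) auto
      from filler_comp2[OF first filler_comp2[OF peiffer filler_eq2[OF this s t]]]
      show ?thesis using F by (simp add: \<Theta> Nef)
    qed
  qed
qed

end

context
  fixes n :: nat
begin

lemma filler_\<Theta>R:
  assumes r: "[x] \<in> rows n" "u \<in> rows n" "v \<in> rows n" "t \<in> rows n" and x: "\<forall>y\<in>set u. x < y"
    and uv: "\<not> u \<triangleleft> v" and vt: "\<not> v \<triangleleft> t"
  shows "filler (row_coh n) (\<Theta>R x u v t)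
    ((\<alpha> [x] u \<star>\<^sub>0 Id1 (N (v @ t))) \<star>\<^sub>1 \<Lambda> ((x # u) # N (v @ t)))
    ((Id1 [[x]] \<star>\<^sub>0 \<Lambda> (u # N (v @ t))) \<star>\<^sub>1 \<Lambda> ([x] # N (u @ v @ t)))"
proof -
  let ?Q = "row_coh n"
  note Q = is_polygraph3_row_coh[of n]
  note \<Lambda>_simps = is_cell2_\<Lambda>[of _ n] positive_\<Lambda>[of _ n] src1_\<Lambda>[of _ n] tgt1_\<Lambda>[of _ n]
  define c d where "c = upper_row v t" and "d = lower_row v t"
  note ne = r[THEN rows_ne]
  let ?w = "x # u"
  have w: "?w \<in> rows n" using Cons_rows[OF r(1,2) x] .
  have Nw: "N ?w = [?w]" using N_row[OF w] .
  have d: "d \<in> rows n" using r by (simp add: d_def lower_rows)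
  have xu: "\<not> [x] \<triangleleft> u" using not_below_greater[OF x] .
  have Z: "N (u @ concat (N (v @ t))) = N (u @ v @ t)"
    using N_concat_cong[of v n t "[u]" "[]"] r by simp
  have WZ: "N (u @ v @ t) \<in> lists (rows n)" using nf_rows[of "[u, v, t]" n] r by simp
  show ?thesis
  proof (cases "c = []")
    case True
    then have Nd: "N (v @ t) = [d]" using N_rows_cases[OF r(3,4)] by (simp add: c_def d_def)
    have Z: "N (u @ v @ t) = N (u @ d)" using Z Nd by simp
    show ?thesis
    proof (cases "u \<triangleleft> d")
      case True
      have Zn: "N (u @ d) = [u, d]" using N_concat_normal[of "[u, d]" n] True r d by simp
      have \<Theta>: "\<Theta>R x u v t = Id2 ((\<alpha> [x] u \<star>\<^sub>0 Id1 [d]) \<star>\<^sub>1 \<Lambda> [?w, d])"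
        by (simp add: \<Theta>R_def Nd True)
      have "eq2 ?Q ((\<alpha> [x] u \<star>\<^sub>0 Id1 [d]) \<star>\<^sub>1 \<Lambda> [?w, d])
         ((Id1 [[x]] \<star>\<^sub>0 \<Lambda> (u # N (v @ t))) \<star>\<^sub>1 \<Lambda> ([x] # N (u @ v @ t)))"
        using r d w Nw xu True
        by (intro eq2I) (auto simp: Z Zn Nd \<Lambda>_simps flat_\<Lambda>_normal flat_\<Lambda>_redex)
      from filler_Id[OF Q this] show ?thesis unfolding \<Theta> Nd by simp
    next
      case False
      have \<tau>: "([x], u, d) \<in> critical n" using r d xu False by (simp add: critical_def)
      have \<Theta>: "\<Theta>R x u v t = \<X> [x] u d" by (simp add: \<Theta>R_def Nd False)
      have WZ: "N (u @ d) \<in> lists (rows n)" using WZ Z by simp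
      have s: "eq2 ?Q ((\<alpha> [x] u \<star>\<^sub>0 Id1 [d]) \<star>\<^sub>1 \<Lambda> (N ([x] @ u) @ [d]))
         ((\<alpha> [x] u \<star>\<^sub>0 Id1 (N (v @ t))) \<star>\<^sub>1 \<Lambda> ((x # u) # N (v @ t)))"
        using r d w Nw xu by (intro eq2I) (auto simp: Nd \<Lambda>_simps)
      have t: "eq2 ?Q ((Id1 [[x]] \<star>\<^sub>0 \<alpha> u d) \<star>\<^sub>1 \<Lambda> ([[x]] @ N (u @ d)))
         ((Id1 [[x]] \<star>\<^sub>0 \<Lambda> (u # N (v @ t))) \<star>\<^sub>1 \<Lambda> ([x] # N (u @ v @ t)))"
        using r d False WZ by (intro eq2I) (auto simp: Nd Z \<Lambda>_simps flat_\<Lambda>_pair)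
      show ?thesis unfolding \<Theta> using filler_eq2[OF filler_\<X>[OF \<tau>] s t] .
    qed
  next
    case False
    then have Ncd: "N (v @ t) = [c, d]" using N_rows_cases[OF r(3,4)] by (simp add: c_def d_def)
    have c: "c \<in> rows n" using False r by (simp add: c_def upper_rows)
    have cd: "c \<triangleleft> d" using False ne by (simp add: c_def d_def upper_below_lower)
    \<comment> \<open>The row c consists of letters of \<open>v\<close>, so u below c would imply u
      below \<open>v\<close>.\<close>
    have uc: "\<not> u \<triangleleft> c"
      using below_trans_subset[of u c v] uv upper_subset[of v t] False by (auto simp: c_def)
    have \<tau>0: "([x], u, c) \<in> critical n" using r c xu uc by (simp add: critical_def)
    note Nuc = N_rows[OF r(2) c]
    have Wxuc: "N (x # u @ c) \<in> lists (rows n)" using N_rows[OF w c] by simp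
    have nfx: "N (x # concat (N (u @ c))) = N (x # u @ c)"
      using N_concat_cong[of u n c "[[x]]" "[]"] r c by simp
    have fx: "flat ?Q (\<Lambda> ([x] # N (u @ c) @ [d])) =
        whisker [] [d] (flat ?Q (\<Lambda> ([x] # N (u @ c)))) @ flat ?Q (\<Lambda> (N (x # u @ c) @ [d]))"
      using flat_\<Lambda>_append[of "[x] # N (u @ c)" n "[d]"] nfx r Nuc d by simp
    have fw: "flat ?Q (\<Lambda> [?w, c, d]) =
        whisker [] [d] (flat ?Q (\<Lambda> [?w, c])) @ flat ?Q (\<Lambda> (N (x # u @ c) @ [d]))"
      using flat_\<Lambda>_append[of "[?w, c]" n "[d]"] w c d by simp
    have Z: "N (u @ v @ t) = N (concat (N (u @ c)) @ d)"
      using Z Ncd N_concat_cong[of u n c "[]" "[d]"] r c d by simp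
    have Zc: "N (u @ c @ d) = N (concat (N (u @ c)) @ d)"
      using N_concat_cong[of u n c "[]" "[d]"] r c d by simp
    let ?S = "(\<alpha> [x] u \<star>\<^sub>0 Id1 (N (v @ t))) \<star>\<^sub>1 \<Lambda> ((x # u) # N (v @ t))"
    let ?T = "(Id1 [[x]] \<star>\<^sub>0 \<Lambda> (u # N (v @ t))) \<star>\<^sub>1 \<Lambda> ([x] # N (u @ v @ t))"
    define K0 where "K0 = Xhat [d] [x] u c"
    define step where "step = Id1 [[x]] \<star>\<^sub>0 \<alpha> u c \<star>\<^sub>0 Id1 [d]"
    \<comment> \<open>All branches begin with \<open>K0\<close>, which leads to \<open>T0\<close>.
      There the leftmost reductions start at x again, whereas \<open>?T\<close> first finishes
      normalizing to the right of x.\<close>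
    define T0 where "T0 = step \<star>\<^sub>1 \<Lambda> ([x] # N (u @ c) @ [d])"
    have step: "is_cell2 ?Q step" "positive step" "src1 ?Q step = [[x], u, c, d]"
      "tgt1 ?Q step = [x] # N (u @ c) @ [d]" "flat ?Q step = [([[x]], (u, c), [d])]"
      using r c d uc by (auto simp: step_def)
    have K0: "filler ?Q K0 ?S T0"
    proof -
      have "eq2 ?Q ((((\<alpha> [x] u \<star>\<^sub>0 Id1 [c]) \<star>\<^sub>1 \<Lambda> (N ([x] @ u) @ [c])) \<star>\<^sub>0 Id1 [d]) \<star>\<^sub>1 \<Lambda> (N ([x] @ u @ c) @ [d])) ?S"
        using r c d w Nw xu Wxuc by (intro eq2I) (auto simp: Ncd \<Lambda>_simps fw)
      moreover have "eq2 ?Q ((((Id1 [[x]] \<star>\<^sub>0 \<alpha> u c) \<star>\<^sub>1 \<Lambda> ([[x]] @ N (u @ c))) \<star>\<^sub>0 Id1 [d]) \<star>\<^sub>1 \<Lambda> (N ([x] @ u @ c) @ [d])) T0"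
        using r c d uc Nuc nfx Wxuc by (intro eq2I) (auto simp: T0_def step \<Lambda>_simps fx)
      ultimately show ?thesis unfolding K0_def using filler_Xhat[OF \<tau>0, of "[d]"] d
        by (auto intro: filler_eq2)
    qed
    have fucd: "flat ?Q (\<Lambda> [u, c, d]) = ([], (u, c), [d]) # flat ?Q (\<Lambda> (N (u @ c) @ [d]))"
      using flat_\<Lambda>_redex[of u n c "[d]"] r c d uc by simp
    have short: "eq2 ?Q T0 ?T" if "successively (\<triangleleft>) (N (u @ c) @ [d])"
    proof -
      have "N (concat (N (u @ c)) @ d) = N (u @ c) @ [d]"
        using N_concat_normal[OF _ that, of n] Nuc d by simp
      then show ?thesis using r c d uc Nuc that
        by (intro eq2I) (auto simp: T0_def step Z Zc Ncd \<Lambda>_simps fucd flat_\<Lambda>_normal)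
    qed
    define g i where "g = lower_row u c" and "i = upper_row u c"
    have g: "g \<in> rows n" using r c by (simp add: g_def lower_rows)
    note Ngd = N_rows[OF g d]
    show ?thesis
    proof (cases "i = []")
      case True
      then have Ng: "N (u @ c) = [g]" using N_rows_cases[OF r(2) c] by (simp add: g_def i_def)
      \<comment> \<open>As for the left side: otherwise x would be a letter of c and would bump the
        minimum of \<open>u\<close>.\<close>
      have xg: "\<not> [x] \<triangleleft> g"
      proof
        assume "[x] \<triangleleft> g"
        then have "x \<in> set c" using x by (auto simp: below_def g_def)
        then show False using min_in_upper[of x c u] x ne True by (auto simp: i_def)
      qed
      have \<Theta>: "\<Theta>R x u v t = (if g \<triangleleft> d then K0 else K0 \<bullet>\<^sub>2 (Id2 step \<bullet>\<^sub>1 \<X> [x] g d))"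
        by (simp only: \<Theta>R_def Ncd Ng Let_def K0_def step_def list.case)
      show ?thesis
      proof (cases "g \<triangleleft> d")
        case True
        then show ?thesis using short filler_eq2[OF K0 eq2.refl] filler_parallel[OF Q K0]
          by (simp add: \<Theta> Ng)
      next
        case F: False
        have \<tau>: "([x], g, d) \<in> critical n" using r g d xg F by (simp add: critical_def)
        have W: "N (x # g) \<in> lists (rows n)" using N_rows[OF r(1) g] by simp
        have s: "eq2 ?Q (step \<star>\<^sub>1 (\<alpha> [x] g \<star>\<^sub>0 Id1 [d]) \<star>\<^sub>1 \<Lambda> (N ([x] @ g) @ [d])) T0"
          using r g d xg W step Ng by (intro eq2I) (auto simp: T0_def \<Lambda>_simps flat_\<Lambda>_redex)
        have t: "eq2 ?Q (step \<star>\<^sub>1 (Id1 [[x]] \<star>\<^sub>0 \<alpha> g d) \<star>\<^sub>1 \<Lambda> ([[x]] @ N (g @ d))) ?T"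
          using r g c d F Ngd step Ng
          by (intro eq2I) (auto simp: Z Zc Ncd \<Lambda>_simps fucd flat_\<Lambda>_pair)
        have "filler ?Q (Id2 step \<bullet>\<^sub>1 \<X> [x] g d) (step \<star>\<^sub>1 (\<alpha> [x] g \<star>\<^sub>0 Id1 [d]) \<star>\<^sub>1 \<Lambda> (N ([x] @ g) @ [d]))
           (step \<star>\<^sub>1 (Id1 [[x]] \<star>\<^sub>0 \<alpha> g d) \<star>\<^sub>1 \<Lambda> ([[x]] @ N (g @ d)))"
          using step Ng by (intro filler_comp1 Q filler_Id2 filler_\<X> \<tau>) auto
        from filler_comp2[OF K0 filler_eq2[OF this s t]] F show ?thesis by (simp add: \<Theta>)
      qed
    next
      case Fi: False
      then have Nig: "N (u @ c) = [i, g]" using N_rows_cases[OF r(2) c] by (simp add: g_def i_def)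
      have i: "i \<in> rows n" using Fi r by (simp add: i_def upper_rows)
      have ig: "i \<triangleleft> g" using Fi c rows_ne by (simp add: i_def g_def upper_below_lower)
      have xi: "\<forall>y\<in>set i. x < y" using x upper_subset[of u c] by (auto simp: i_def)
      let ?k = "x # i"
      have k: "?k \<in> rows n" using Cons_rows[OF r(1) i xi] .
      have Nk: "N ?k = [?k]" using N_row[OF k] .
      have nxi: "\<not> [x] \<triangleleft> i" using not_below_greater[OF xi] .
      define K1 where "K1 = (if ?k \<triangleleft> g then Id2 (\<Lambda> [?k, g, d]) else \<X> ?k g d)"
      define middle where "middle = Id2 (step \<star>\<^sub>1 (\<alpha> [x] i \<star>\<^sub>0 Id1 [g] \<star>\<^sub>0 Id1 [d])) \<bullet>\<^sub>1 K1"
      define peiffer :: rcell3 where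
        "peiffer = Id2 (step \<star>\<^sub>1 (\<alpha> [x] i \<star>\<^sub>0 \<alpha> g d) \<star>\<^sub>1 \<Lambda> ([?k] @ N (g @ d)))"
      have \<Theta>: "\<Theta>R x u v t = (if g \<triangleleft> d then K0 else K0 \<bullet>\<^sub>2 middle \<bullet>\<^sub>2 peiffer)"
        by (simp only: \<Theta>R_def Ncd Nig Let_def K0_def step_def K1_def middle_def peiffer_def list.case)
      show ?thesis
      proof (cases "g \<triangleleft> d")
        case True
        then show ?thesis using ig short filler_eq2[OF K0 eq2.refl] filler_parallel[OF Q K0]
          by (simp add: \<Theta> Nig)
      next
        case gd: False
        have Wk: "?k # N (g @ d) \<in> lists (rows n)" using k Ngd by simp
        have fk: "flat ?Q (\<Lambda> [?k, g, d]) = ([?k], (g, d), []) # flat ?Q (\<Lambda> (?k # N (g @ d)))" if "?k \<triangleleft> g"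
          using flat_\<Lambda>_below[of ?k n g d "[]"] that k g d gd by simp
        have K1: "filler ?Q K1 (\<Lambda> [?k, g, d]) ((Id1 [?k] \<star>\<^sub>0 \<alpha> g d) \<star>\<^sub>1 \<Lambda> (?k # N (g @ d)))"
        proof (cases "?k \<triangleleft> g")
          case True
          have "eq2 ?Q (\<Lambda> [?k, g, d]) ((Id1 [?k] \<star>\<^sub>0 \<alpha> g d) \<star>\<^sub>1 \<Lambda> (?k # N (g @ d)))"
            using True k g d gd Wk fk by (intro eq2I) (auto simp: \<Lambda>_simps)
          from filler_Id[OF Q this] show ?thesis using True by (simp add: K1_def)
        next
          case F: False
          have \<tau>: "(?k, g, d) \<in> critical n" using F k g d gd by (simp add: critical_def)
          have W: "N (?k @ g) \<in> lists (rows n)" using N_rows[OF k g] .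
          have 1: "eq2 ?Q ((\<alpha> ?k g \<star>\<^sub>0 Id1 [d]) \<star>\<^sub>1 \<Lambda> (N (?k @ g) @ [d])) (\<Lambda> [?k, g, d])"
            using F k g d W by (intro eq2I) (auto simp: \<Lambda>_simps flat_\<Lambda>_redex)
          have 2: "eq2 ?Q ((Id1 [?k] \<star>\<^sub>0 \<alpha> g d) \<star>\<^sub>1 \<Lambda> ([?k] @ N (g @ d))) ((Id1 [?k] \<star>\<^sub>0 \<alpha> g d) \<star>\<^sub>1 \<Lambda> (?k # N (g @ d)))"
            using k g d gd Wk by (intro eq2I) (auto simp: \<Lambda>_simps)
          show ?thesis using filler_eq2[OF filler_\<X>[OF \<tau>] 1 2] F by (simp add: K1_def)
        qed
        define T1 where "T1 = (step \<star>\<^sub>1 (\<alpha> [x] i \<star>\<^sub>0 Id1 [g] \<star>\<^sub>0 Id1 [d])) \<star>\<^sub>1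
          (Id1 [?k] \<star>\<^sub>0 \<alpha> g d) \<star>\<^sub>1 \<Lambda> (?k # N (g @ d))"
        define T2 where "T2 = step \<star>\<^sub>1 (Id1 [[x]] \<star>\<^sub>0 Id1 [i] \<star>\<^sub>0 \<alpha> g d) \<star>\<^sub>1
          (\<alpha> [x] i \<star>\<^sub>0 Id1 (N (g @ d))) \<star>\<^sub>1 \<Lambda> (?k # N (g @ d))"
        have T1: "is_cell2 ?Q T1" "is_cell2 ?Q T2" "positive T1" "positive T2"
          unfolding T1_def T2_def using r i g d k nxi Nk Wk gd step Nig Ngd by (auto simp: \<Lambda>_simps)
        have "filler ?Q middle ((step \<star>\<^sub>1 (\<alpha> [x] i \<star>\<^sub>0 Id1 [g] \<star>\<^sub>0 Id1 [d])) \<star>\<^sub>1 \<Lambda> [?k, g, d]) T1"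
          unfolding middle_def T1_def using r i g d k nxi Nk step Nig
          by (intro filler_comp1 Q filler_Id2 K1) (auto simp: \<Lambda>_simps)
        moreover have "eq2 ?Q ((step \<star>\<^sub>1 (\<alpha> [x] i \<star>\<^sub>0 Id1 [g] \<star>\<^sub>0 Id1 [d])) \<star>\<^sub>1 \<Lambda> [?k, g, d]) T0"
          using r i g d k nxi Nk step Nig
          by (intro eq2I) (auto simp: T0_def \<Lambda>_simps flat_\<Lambda>_redex)
        ultimately have middle: "filler ?Q middle T0 T1"
          by (rule filler_eq2[OF _ _ eq2.refl[OF T1(1)]])
        have pf: "eq2 ?Q (step \<star>\<^sub>1 (\<alpha> [x] i \<star>\<^sub>0 \<alpha> g d) \<star>\<^sub>1 \<Lambda> ([?k] @ N (g @ d))) T1"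
          using r i g d k nxi Nk Wk gd step Nig T1 by (intro eq2I) (auto simp: T1_def \<Lambda>_simps)
        have swap: "eq2 ?Q T1 T2"
          by (rule eq2_flat_swapI[OF bounded2_row_coh T1, where ?l1.0 = "[([[x]], (u, c), [d])]"
            and p = "[]" and b = "([x], i)" and m = "[]" and b' = "(g, d)" and s = "[]"
            and ?l2.0 = "flat ?Q (\<Lambda> (?k # N (g @ d)))"])
            (use r i g d k nxi Nk Wk gd step Nig Ngd in \<open>auto simp: T1_def T2_def \<Lambda>_simps\<close>)
        have peiffer: "filler ?Q peiffer T1 T2"
          unfolding peiffer_def by (rule filler_eq2[OF filler_Id[OF Q pf] pf swap])
        \<comment> \<open>This bounds the path on \<open>[u, c, d]\<close> by two steps, so the
          Peiffer identity is the last piece of \<open>\<Theta>R\<close>.\<close>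
        have ine: "i \<triangleleft> upper_row g d"
          using upper_below_upper_lower[OF cd rows_ne[OF c] rows_ne[OF d]] Fi by (simp add: i_def g_def)
        then have "upper_row g d \<noteq> []" using rows_ne[OF i] by (auto simp: below_def)
        then have succ: "successively (\<triangleleft>) (i # N (g @ d))"
          using N_rows_cases[OF g d] ine upper_below_lower[of g d] rows_ne[OF d] by auto
        have Z2: "N (i @ g @ d) = i # N (g @ d)"
          using N_concat_normal[of "i # N (g @ d)" n] succ i Ngd N_concat_cong[of g n d "[i]" "[]"] g d by simp
        have figd: "flat ?Q (\<Lambda> [i, g, d]) = [([i], (g, d), [])]"
          using flat_\<Lambda>_below[of i n g d "[]"] succ ig gd i g d by (simp add: flat_\<Lambda>_normal)
        have "eq2 ?Q T2 ?T"
          using T1 r i g c d k nxi Nk Wk gd step Nig Ngd succ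
          by (intro eq2I) (auto simp: T2_def Z Zc Z2 Ncd \<Lambda>_simps fucd figd flat_\<Lambda>_redex)
        from filler_comp2[OF K0 filler_comp2[OF middle filler_eq2[OF peiffer eq2.refl[OF T1(1)] this]]]
        show ?thesis using gd by (simp add: \<Theta>)
      qed
    qed
  qed
qed

text \<open>The five factors meet at \<open>B \<star>\<^sub>1 ?SL\<close>,
  \<open>B \<star>\<^sub>1 ?TL\<close>, \<open>C \<star>\<^sub>1 ?TR\<close> and
  \<open>C \<star>\<^sub>1 ?SR\<close>. The cell \<open>A\<close> stays in front of both ends, to be
  cancelled by its inverse in \<open>filler_\<Omega>\<close>.\<close>

lemma filler_\<Psi>:
  assumes "(u, v, t) \<in> splittable n"
  defines "A \<equiv> \<alpha> [hd u] (tl u) \<star>\<^sub>0 Id1 [v] \<star>\<^sub>0 Id1 [t]"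
  shows "filler (row_coh n) (\<Psi> (u, v, t)) (A \<star>\<^sub>1 dom3 (row_coh n) (u, v, t)) (A \<star>\<^sub>1 cod3 (row_coh n) (u, v, t))"
    and "is_cell2 (row_coh n) A"
proof -
  let ?Q = "row_coh n"
  note Q = is_polygraph3_row_coh[of n]
  note \<Lambda>_simps = is_cell2_\<Lambda>[of _ n] positive_\<Lambda>[of _ n] src1_\<Lambda>[of _ n] tgt1_\<Lambda>[of _ n]
  define x u' where "x = hd u" and "u' = tl u"
  have u: "u = x # u'" and "u' \<noteq> []"
    using assms by (cases u; auto simp: x_def u'_def splittable_def)+
  have w: "x # u' \<in> rows n" and r': "v \<in> rows n" "t \<in> rows n" and uv: "\<not> x # u' \<triangleleft> v" and vt: "\<not> v \<triangleleft> t"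
    and u'v: "\<not> u' \<triangleleft> v"
    using assms by (auto simp: splittable_def critical_def u)
  have r: "[x] \<in> rows n" "u' \<in> rows n" "v \<in> rows n" "t \<in> rows n" and x: "\<forall>y\<in>set u'. x < y"
    using rows_Cons[OF w \<open>u' \<noteq> []\<close>] r' by auto
  have xu: "\<not> [x] \<triangleleft> u'" using not_below_greater[OF x] .
  have Nw: "N (x # u') = [x # u']" using N_row[OF w] .
  define M V Z where "M = N (x # u' @ v)" and "V = N (v @ t)" and "Z = N (u' @ v @ t)"
  define B where "B = Id1 [[x]] \<star>\<^sub>0 \<alpha> u' v \<star>\<^sub>0 Id1 [t]"
  define C where "C = Id1 [[x]] \<star>\<^sub>0 Id1 [u'] \<star>\<^sub>0 \<alpha> v t"
  have WM: "M \<in> lists (rows n)" and WV: "V \<in> lists (rows n)" and WZ: "Z \<in> lists (rows n)"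
    and WU: "N (u' @ v) \<in> lists (rows n)"
    using nf_rows[of "[[x], u', v]" n] nf_rows[of "[u', v, t]" n] N_rows r by (simp_all add: M_def V_def Z_def)
  have nf: "N (concat (N (u' @ v)) @ t) = Z" "N (u' @ concat V) = Z" "N (x # concat (N (u' @ v))) = M"
    "N (x # u' @ concat V) = N (x # u' @ v @ t)"  "N (x # concat Z) = N (x # u' @ v @ t)"
    "N (concat M @ t) = N (x # u' @ v @ t)"
    using N_concat_cong[of u' n v "[]" "[t]"] N_concat_cong[of v n t "[u']" "[]"]
      N_concat_cong[of u' n v "[[x]]" "[]"] N_concat_cong[of v n t "[x # u']" "[]"]
      nf_append[of "[u', v, t]" n "[]" "[[x]]"] nf_append[of "[[x], u', v]" n "[t]" "[]"] r w
    by (simp_all add: M_def V_def Z_def)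
  have A: "A = \<alpha> [x] u' \<star>\<^sub>0 Id1 [v] \<star>\<^sub>0 Id1 [t]" by (simp add: A_def x_def u'_def)
  show "is_cell2 ?Q A" using r xu by (simp add: A)
  let ?SL = "(\<Lambda> ([x] # N (u' @ v)) \<star>\<^sub>0 Id1 [t]) \<star>\<^sub>1 \<Lambda> (M @ [t])"
  let ?TL = "(Id1 [[x]] \<star>\<^sub>0 \<Lambda> (N (u' @ v) @ [t])) \<star>\<^sub>1 \<Lambda> ([x] # Z)"
  let ?SR = "(\<alpha> [x] u' \<star>\<^sub>0 Id1 V) \<star>\<^sub>1 \<Lambda> ((x # u') # V)"
  let ?TR = "(Id1 [[x]] \<star>\<^sub>0 \<Lambda> (u' # V)) \<star>\<^sub>1 \<Lambda> ([x] # Z)"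
  have L: "filler ?Q (\<Theta>L x u' v t) ?SL ?TL"
    using filler_\<Theta>L[OF r x u'v vt] by (simp add: M_def Z_def)
  have R: "filler ?Q (\<Theta>R x u' v t) ?SR ?TR"
    using filler_\<Theta>R[OF r x u'v vt] by (simp add: V_def Z_def)
  have BC: "is_cell2 ?Q B" "is_cell2 ?Q C" using r u'v vt by (simp_all add: B_def C_def)
  have crit: "([x], u', v) \<in> critical n" "(u', v, t) \<in> critical n"
    using r xu u'v vt by (simp_all add: critical_def)
  define F1 where "F1 = (\<X> [x] u' v \<bullet>\<^sub>0 Id2 (Id1 [t])) \<bullet>\<^sub>1 Id2 (\<Lambda> (M @ [t]))"
  define F3 where "F3 = (Id2 (Id1 [[x]]) \<bullet>\<^sub>0 \<X> u' v t) \<bullet>\<^sub>1 Id2 (\<Lambda> ([x] # Z))"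
  define F5 :: rcell3 where "F5 = Id2 (C \<star>\<^sub>1 (\<alpha> [x] u' \<star>\<^sub>0 Id1 V)) \<bullet>\<^sub>1 Id2 (\<Lambda> ((x # u') # V))"
  have F1: "filler ?Q F1 (A \<star>\<^sub>1 dom3 ?Q (u, v, t)) (B \<star>\<^sub>1 ?SL)"
  proof (rule filler_eq2)
    show "filler ?Q F1 ((((\<alpha> [x] u' \<star>\<^sub>0 Id1 [v]) \<star>\<^sub>1 \<Lambda> (N ([x] @ u') @ [v])) \<star>\<^sub>0 Id1 [t]) \<star>\<^sub>1 \<Lambda> (M @ [t]))
       ((((Id1 [[x]] \<star>\<^sub>0 \<alpha> u' v) \<star>\<^sub>1 \<Lambda> ([[x]] @ N (u' @ v))) \<star>\<^sub>0 Id1 [t]) \<star>\<^sub>1 \<Lambda> (M @ [t]))"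
      unfolding F1_def using r w WM Nw
      by (intro filler_comp1 filler_comp0 Q filler_Id2 filler_\<X> crit) (auto simp: \<Lambda>_simps M_def)
    show "eq2 ?Q ((((\<alpha> [x] u' \<star>\<^sub>0 Id1 [v]) \<star>\<^sub>1 \<Lambda> (N ([x] @ u') @ [v])) \<star>\<^sub>0 Id1 [t]) \<star>\<^sub>1 \<Lambda> (M @ [t]))
       (A \<star>\<^sub>1 dom3 ?Q (u, v, t))"
      using r w WM Nw xu uv by (intro eq2I) (auto simp: A u \<Lambda>_simps M_def flat_\<Lambda>_pair)
    show "eq2 ?Q ((((Id1 [[x]] \<star>\<^sub>0 \<alpha> u' v) \<star>\<^sub>1 \<Lambda> ([[x]] @ N (u' @ v))) \<star>\<^sub>0 Id1 [t]) \<star>\<^sub>1 \<Lambda> (M @ [t])) (B \<star>\<^sub>1 ?SL)"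
      using r WM WU u'v nf(3) by (intro eq2I) (auto simp: B_def \<Lambda>_simps)
  qed
  have F2: "filler ?Q (Id2 B \<bullet>\<^sub>1 \<Theta>L x u' v t) (B \<star>\<^sub>1 ?SL) (B \<star>\<^sub>1 ?TL)"
    using r WU by (intro filler_comp1 Q filler_Id2 BC L) (auto simp: B_def \<Lambda>_simps)
  have F3: "filler ?Q F3 (B \<star>\<^sub>1 ?TL) (C \<star>\<^sub>1 ?TR)"
  proof (rule filler_eq2)
    show "filler ?Q F3 ((Id1 [[x]] \<star>\<^sub>0 ((\<alpha> u' v \<star>\<^sub>0 Id1 [t]) \<star>\<^sub>1 \<Lambda> (N (u' @ v) @ [t]))) \<star>\<^sub>1 \<Lambda> ([x] # Z))
      ((Id1 [[x]] \<star>\<^sub>0 ((Id1 [u'] \<star>\<^sub>0 \<alpha> v t) \<star>\<^sub>1 \<Lambda> ([u'] @ N (v @ t)))) \<star>\<^sub>1 \<Lambda> ([x] # Z))"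
      unfolding F3_def using r WU WZ nf
      by (intro filler_comp1 filler_comp0 Q filler_Id2 filler_\<X> crit) (auto simp: \<Lambda>_simps)
    show "eq2 ?Q ((Id1 [[x]] \<star>\<^sub>0 ((\<alpha> u' v \<star>\<^sub>0 Id1 [t]) \<star>\<^sub>1 \<Lambda> (N (u' @ v) @ [t]))) \<star>\<^sub>1 \<Lambda> ([x] # Z)) (B \<star>\<^sub>1 ?TL)"
      using r WU WZ nf u'v by (intro eq2I) (auto simp: \<Lambda>_simps B_def)
    show "eq2 ?Q ((Id1 [[x]] \<star>\<^sub>0 ((Id1 [u'] \<star>\<^sub>0 \<alpha> v t) \<star>\<^sub>1 \<Lambda> ([u'] @ N (v @ t)))) \<star>\<^sub>1 \<Lambda> ([x] # Z)) (C \<star>\<^sub>1 ?TR)"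
      using r WV WZ nf vt by (intro eq2I) (auto simp: \<Lambda>_simps C_def V_def)
  qed
  have F4: "filler ?Q (Id2 C \<bullet>\<^sub>1 Inv3 (\<Theta>R x u' v t)) (C \<star>\<^sub>1 ?TR) (C \<star>\<^sub>1 ?SR)"
    using r WV by (intro filler_comp1 Q filler_Id2 BC filler_Inv R) (auto simp: C_def V_def \<Lambda>_simps)
  have F5: "filler ?Q F5 (C \<star>\<^sub>1 ?SR) (A \<star>\<^sub>1 cod3 ?Q (u, v, t))"
  proof (rule filler_eq2)
    have cells: "is_cell2 ?Q ((C \<star>\<^sub>1 (\<alpha> [x] u' \<star>\<^sub>0 Id1 V)) \<star>\<^sub>1 \<Lambda> ((x # u') # V))"
      "is_cell2 ?Q (A \<star>\<^sub>1 cod3 ?Q (u, v, t))"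
      using r w Nw WV vt xu uv by (auto simp: A u C_def \<Lambda>_simps V_def)
    show "filler ?Q F5 ((C \<star>\<^sub>1 (\<alpha> [x] u' \<star>\<^sub>0 Id1 V)) \<star>\<^sub>1 \<Lambda> ((x # u') # V))
      ((C \<star>\<^sub>1 (\<alpha> [x] u' \<star>\<^sub>0 Id1 V)) \<star>\<^sub>1 \<Lambda> ((x # u') # V))"
      unfolding F5_def using cells(1) by (intro filler_comp1 Q filler_Id2) auto
    show "eq2 ?Q ((C \<star>\<^sub>1 (\<alpha> [x] u' \<star>\<^sub>0 Id1 V)) \<star>\<^sub>1 \<Lambda> ((x # u') # V)) (C \<star>\<^sub>1 ?SR)"
      using cells(1) w WV by (intro eq2I) (auto simp: C_def \<Lambda>_simps)
    \<comment> \<open>The steps on (x, u') and on (v, t) act on disjoint pairs of rows; this is the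
      Peiffer identity that closes the chain.\<close>
    have "eq2 ?Q (A \<star>\<^sub>1 cod3 ?Q (u, v, t)) ((C \<star>\<^sub>1 (\<alpha> [x] u' \<star>\<^sub>0 Id1 V)) \<star>\<^sub>1 \<Lambda> ((x # u') # V))"
      by (rule eq2_flat_swapI[OF bounded2_row_coh cells(2,1), where ?l1.0 = "[]" and p = "[]" and b = "([x], u')"
            and m = "[]" and b' = "(v, t)" and s = "[]" and ?l2.0 = "flat ?Q (\<Lambda> ((x # u') # V))"])
        (use r w Nw WV in \<open>auto simp: A u C_def V_def \<Lambda>_simps\<close>)
    then show "eq2 ?Q ((C \<star>\<^sub>1 (\<alpha> [x] u' \<star>\<^sub>0 Id1 V)) \<star>\<^sub>1 \<Lambda> ((x # u') # V)) (A \<star>\<^sub>1 cod3 ?Q (u, v, t))"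
      by (rule eq2.sym)
  qed
  have "\<Psi> (u, v, t) = F1 \<bullet>\<^sub>2 (Id2 B \<bullet>\<^sub>1 \<Theta>L x u' v t) \<bullet>\<^sub>2 F3 \<bullet>\<^sub>2 (Id2 C \<bullet>\<^sub>1 Inv3 (\<Theta>R x u' v t)) \<bullet>\<^sub>2 F5"
    by (simp add: Let_def u F1_def F3_def F5_def B_def C_def M_def V_def Z_def)
  then show "filler ?Q (\<Psi> (u, v, t)) (A \<star>\<^sub>1 dom3 ?Q (u, v, t)) (A \<star>\<^sub>1 cod3 ?Q (u, v, t))"
    using filler_comp2[OF F1 filler_comp2[OF F2 filler_comp2[OF F3 filler_comp2[OF F4 F5]]]] by simp
qed

text \<open>A formal inverse is not positive, so here flattening gives way to the axioms.\<close>

lemma eq2_cancel_inverse: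
  assumes "is_cell2 (row_coh n) f" "is_cell2 (row_coh n) g" "tgt1 (row_coh n) f = src1 (row_coh n) g"
  shows "eq2 (row_coh n) (Inv2 f \<star>\<^sub>1 f \<star>\<^sub>1 g) g"
proof -
  have "eq2 (row_coh n) (Inv2 f \<star>\<^sub>1 f \<star>\<^sub>1 g) ((Inv2 f \<star>\<^sub>1 f) \<star>\<^sub>1 g)"
    using assms by (intro eq2.sym[OF eq2.assoc1]) auto
  also have "eq2 (row_coh n) \<dots> (Id1 (tgt1 (row_coh n) f) \<star>\<^sub>1 g)"
    using assms eq2.inv_left[OF assms(1)] by (intro eq2_cong1_left) auto
  also have "eq2 (row_coh n) \<dots> g"
    using assms eq2.unit1_left[OF assms(2)] by simp
  finally show ?thesis .
qed

lemma filler_\<Omega>: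
  assumes "\<tau> \<in> splittable n"
  shows "filler (row_coh n) (fst (\<Omega> \<tau>)) (dom3 (row_coh n) \<tau>) (cod3 (row_coh n) \<tau>)"
proof -
  obtain u v t where \<tau>: "\<tau> = (u, v, t)" by (cases \<tau>) auto
  let ?Q = "row_coh n"
  note Q = is_polygraph3_row_coh[of n]
  let ?A = "\<alpha> [hd u] (tl u) \<star>\<^sub>0 Id1 [v] \<star>\<^sub>0 Id1 [t]"
  note \<Psi> = filler_\<Psi>[OF assms[unfolded \<tau>]]
  note par = filler_parallel[OF Q \<Psi>(1)]
  have s: "is_cell2 ?Q ?A" "is_cell2 ?Q (dom3 ?Q (u, v, t))" "is_cell2 ?Q (cod3 ?Q (u, v, t))"
    "tgt1 ?Q ?A = src1 ?Q (dom3 ?Q (u, v, t))" "tgt1 ?Q ?A = src1 ?Q (cod3 ?Q (u, v, t))"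
    using par unfolding is_cell2.simps by blast+
  have "filler ?Q (Id2 (Inv2 ?A) \<bullet>\<^sub>1 \<Psi> (u, v, t)) (Inv2 ?A \<star>\<^sub>1 ?A \<star>\<^sub>1 dom3 ?Q (u, v, t))
      (Inv2 ?A \<star>\<^sub>1 ?A \<star>\<^sub>1 cod3 ?Q (u, v, t))"
    using \<Psi>(2) by (intro filler_comp1 Q filler_Id2 \<Psi>(1)) (simp_all del: row_coh_sel \<Psi>.simps)
  then have "filler ?Q (Id2 (Inv2 ?A) \<bullet>\<^sub>1 \<Psi> (u, v, t)) (dom3 ?Q (u, v, t)) (cod3 ?Q (u, v, t))"
    by (rule filler_eq2) (intro eq2_cancel_inverse s)+
  then show ?thesis by (simp add: \<tau> Let_def del: \<Psi>.simps)
qed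

end

section \<open>The order on critical triples\<close>

lemma gens3_is_cell3: "is_cell3 P A \<Longrightarrow> gens3 A \<subseteq> gen3 P"
  by (induction A) auto

text \<open>The only triples in the source of \<open>\<Omega> (u, v, t)\<close> whose first row may have the length of \<open>u\<close> are
  \<open>(x # a, b, t)\<close> and \<open>(x # i, j, d)\<close>.  If \<open>x # a = u\<close>, then \<open>b\<close> properly contains \<open>v\<close>; if \<open>x # i = u\<close>, then
  either \<open>d\<close> properly contains \<open>t\<close>, or \<open>d = t\<close> and \<open>j\<close> need not contain \<open>v\<close>, but trades its minimum for a
  larger letter.  Hence sums of letters rather than lengths.\<close>

fun triple_rank :: "nat \<Rightarrow> row \<times> row \<times> row \<Rightarrow> nat \<times> nat \<times> nat" where
  "triple_rank n (u, v, t) = (length u, \<Sum>{1..n} - \<Sum>(set t), \<Sum>{1..n} - \<Sum>(set v))"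

text \<open>The restriction to critical triples makes the relation one between generating 3-cells,
  as a collapsible part demands.\<close>

definition triple_less :: "nat \<Rightarrow> ((row \<times> row \<times> row) \<times> (row \<times> row \<times> row)) set" where
  "triple_less n = inv_image (less_than <*lex*> less_than <*lex*> less_than) (triple_rank n)
     \<inter> critical n \<times> critical n"

lemma wf_triple_less: "wf (triple_less n)"
  unfolding triple_less_def by (intro wf_Int1 wf_inv_image wf_lex_prod wf_less_than)

lemma trans_triple_less: "Relation.trans (triple_less n)"
  unfolding triple_less_def
  by (intro trans_Int trans_inv_image trans_lex_prod trans_less_than) (auto simp: trans_def)

lemma triple_less_critical: "(\<sigma>, \<tau>) \<in> triple_less n \<Longrightarrow> \<sigma> \<in> critical n"
  by (simp add: triple_less_def)

text \<open>This bound keeps the truncated subtraction in \<open>triple_rank\<close> strictly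
  decreasing in the letter sums.\<close>

lemma sum_row_le: "u \<in> rows n \<Longrightarrow> \<Sum>(set u) \<le> \<Sum>{1..n}"
  by (intro sum_mono2) (auto simp: rows_def)

lemma sum_row_less:
  assumes "v \<in> rows n" "set v \<subseteq> set b" "set b \<noteq> set v" "b \<in> rows n"
  shows "\<Sum>(set v) < \<Sum>(set b)"
proof -
  obtain y where y: "y \<in> set b - set v" using assms(2,3) by blast
  then have "0 < y" using assms(4) by (auto simp: rows_def)
  then show ?thesis using y assms(2) by (intro sum_strict_mono2[where b = y]) auto
qed

lemma triple_lessI:
  assumes "\<sigma> \<in> critical n" "(u, v, t) \<in> critical n" "\<sigma> = (u', v', t')"
    "length u' < length u \<or> length u' = length u \<and>
     (\<Sum>(set t) < \<Sum>(set t') \<or> t' = t \<and> \<Sum>(set v) < \<Sum>(set v'))"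
  shows "(\<sigma>, (u, v, t)) \<in> triple_less n"
proof -
  have "t' \<in> rows n" "v' \<in> rows n" using assms by (auto simp: critical_def)
  with assms sum_row_le[of t' n] sum_row_le[of v' n] show ?thesis
    by (auto simp: triple_less_def)
qed

section \<open>Generators occurring in the spheres and their ranks\<close>

lemma length_upper_less: "upper_row u v \<noteq> u \<Longrightarrow> length (upper_row u v) < length u"
proof -
  have "length (filter P u) < length u" if "filter P u \<noteq> u" for P
    using that length_filter_less[of _ u P] by (auto simp: filter_id_conv)
  then show "upper_row u v \<noteq> u \<Longrightarrow> ?thesis" unfolding upper_row_def .
qed

text \<open>Generators whose first row is \<open>[x]\<close> need no closer description: the first
  row of a splittable triple has at least two letters, so length alone makes them smaller.\<close>

lemma gens3_\<Theta>L:
  assumes "u \<in> rows n" "v \<in> rows n" "t \<in> rows n" "\<sigma> \<in> gens3 (\<Theta>L x u v t)"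
  shows "fst \<sigma> = [x] \<or> \<sigma> = (x # upper_row u v, lower_row u v, t)"
  using assms(4) N_rows_cases[OF assms(1,2)] N_rows_cases[OF lower_rows[OF assms(1,2)] assms(3)]
  by (auto simp: \<Theta>L_def Xhat_def Let_def split: if_splits)

text \<open>The second alternative retains its side conditions because the comparison of letter sums
  in \<open>lower_upper_above_less\<close> rests on them.\<close>

lemma gens3_\<Theta>R:
  assumes "u \<in> rows n" "v \<in> rows n" "t \<in> rows n" "\<sigma> \<in> gens3 (\<Theta>R x u v t)"
  shows "fst \<sigma> = [x] \<or> upper_row v t \<noteq> [] \<and> upper_row u (upper_row v t) \<noteq> [] \<and> \<not> lower_row u (upper_row v t) \<triangleleft> lower_row v t \<and>
    \<sigma> = (x # upper_row u (upper_row v t), lower_row u (upper_row v t), lower_row v t)"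
  using assms(4) N_rows_cases[OF assms(2,3)] N_rows_cases[OF assms(1) upper_rows[OF assms(2), of t]]
  by (auto simp: \<Theta>R_def Xhat_def Let_def split: if_splits)

text \<open>If all of \<open>u\<close> is bumped, then \<open>u\<close> lies below the union of the
  two rows. Since it does not lie below \<open>v\<close>, the union is strictly larger than
  \<open>v\<close>.\<close>

lemma lower_above_less:
  assumes r: "u \<in> rows n" "v \<in> rows n" "t \<in> rows n" and uv: "\<not> u \<triangleleft> v"
  shows "length (upper_row u v) < length u \<or> \<Sum>(set v) < \<Sum>(set (lower_row u v))"
proof (cases "upper_row u v = u")
  case True
  have "\<not> set u \<subseteq> set v"
  proof
    assume "set u \<subseteq> set v"
    then have "lower_row u v = v" using r by (auto simp: lower_row_def rows_def Un_absorb1)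
    with upper_below_lower[of u v] True r uv show False by (auto simp: rows_def)
  qed
  then have "\<Sum>(set v) < \<Sum>(set (lower_row u v))" using r lower_rows[OF r(1,2)]
    by (intro sum_row_less) auto
  then show ?thesis ..
qed (simp add: length_upper_less)

lemma lower_upper_above_less:
  assumes r: "u \<in> rows n" "v \<in> rows n" "t \<in> rows n" and vt: "\<not> v \<triangleleft> t"
    and c: "upper_row v t \<noteq> []" and i: "upper_row u (upper_row v t) \<noteq> []"
    and j: "\<not> lower_row u (upper_row v t) \<triangleleft> lower_row v t"
  shows "length (upper_row u (upper_row v t)) < length u \<or> \<Sum>(set t) < \<Sum>(set (lower_row v t)) \<or>
    lower_row v t = t \<and> \<Sum>(set v) < \<Sum>(set (lower_row u (upper_row v t)))"
proof (cases "upper_row u (upper_row v t) = u \<and> set v \<subseteq> set t")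
  case False
  then show ?thesis
    using sum_row_less[OF r(3) _ _ lower_rows[OF r(2,3)]] length_upper_less[of u "upper_row v t"] by auto
next
  case True
  let ?c = "upper_row v t" and ?m = "Min (set v)"
  note ne = r[THEN rows_ne]
  have t: "lower_row v t = t" using True r by (auto simp: lower_row_def rows_def Un_absorb1)
  have "?m \<in> set v" using ne by (intro Min_in) auto
  \<comment> \<open>With \<open>v\<close> contained in \<open>t\<close>, only the condition on the
    minima can keep \<open>v\<close> from lying below \<open>t\<close>.\<close>
  have min: "Min (set t) = ?m"
  proof (rule order.antisym)
    show "Min (set t) \<le> ?m" using True ne by (intro Min_antimono) auto
    show "?m \<le> Min (set t)" using vt True unfolding below_def by linarith
  qed
  have c_greater: "?m < y" if "y \<in> set ?c" for y
  proof -
    obtain z where "z \<in> set t" "z < y" using \<open>y \<in> set ?c\<close> unfolding set_upper by auto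
    then show ?thesis using min Min_le[of "set t" z] by simp
  qed
  \<comment> \<open>Every letter of \<open>v\<close> except its minimum is bumped by its predecessor
    in \<open>v\<close>, which belongs to \<open>t\<close>. So the upper row is \<open>v\<close>
    without its minimum.\<close>
  have v: "set v \<subseteq> insert ?m (set ?c)"
  proof
    fix y assume y: "y \<in> set v"
    show "y \<in> insert ?m (set ?c)"
    proof (cases "y = ?m")
      case False
      let ?S = "{w \<in> set v. w < y}"
      have "?m \<le> y" using y by (intro Min_le) auto
      with False have "?m < y" by simp
      then have S: "finite ?S" "?S \<noteq> {}" using \<open>?m \<in> set v\<close> by auto
      then have "Max ?S \<in> ?S" by (rule Max_in)
      moreover have "\<forall>w\<in>set v. w < y \<longrightarrow> w \<le> Max ?S" using S(1) by auto
      ultimately have "y \<in> set ?c" unfolding set_upper using y True by blast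
      then show ?thesis by simp
    qed simp
  qed
  have "Min (set u) \<in> set (upper_row u ?c)" using True ne by (intro subsetD[OF eq_refl Min_in]) auto
  then obtain z where z: "z \<in> set ?c" "z < Min (set u)" unfolding set_upper by auto
  have u_greater: "?m < w" if "w \<in> set u" for w
    using c_greater[OF z(1)] z(2) Min_le[OF _ that] by simp
  have "?m < Min (set (lower_row u ?c))"
    using u_greater c_greater ne by (subst Min_gr_iff) auto
  \<comment> \<open>The condition on the minima is satisfied, so it is the inclusion in
    \<open>t\<close> that fails. The witness w comes from \<open>u\<close> and, in the sum, more
    than replaces the lost minimum of \<open>v\<close>.\<close>
  then obtain w where w: "w \<in> set (lower_row u ?c)" "w \<notin> set t"
    using j unfolding t below_def min by blast
  have "set ?c \<subseteq> set t" using True upper_subset[of v t] by auto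
  with w have "w \<in> set u" "w \<notin> set ?c" by auto
  have "\<Sum>(set v) \<le> \<Sum>(insert ?m (set ?c))" using v by (intro sum_mono2) auto
  also have "\<dots> = ?m + \<Sum>(set ?c)" using c_greater by (subst sum.insert) auto
  also have "\<dots> < w + \<Sum>(set ?c)" using u_greater[OF \<open>w \<in> set u\<close>] by simp
  also have "\<dots> = \<Sum>(insert w (set ?c))" using \<open>w \<notin> set ?c\<close> by simp
  also have "\<dots> \<le> \<Sum>(set (lower_row u ?c))" using \<open>w \<in> set u\<close> by (intro sum_mono2) auto
  finally show ?thesis using t by simp
qed

lemma gens3_\<Omega>:
  assumes "\<tau> \<in> splittable n" "\<sigma> \<in> gens3 (fst (\<Omega> \<tau>))"
  shows "(\<sigma>, \<tau>) \<in> triple_less n"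
proof -
  obtain u v t where \<tau>: "\<tau> = (u, v, t)" by (cases \<tau>) auto
  define x u' where "x = hd u" and "u' = tl u"
  have len: "length u \<ge> 2" and crit: "(u, v, t) \<in> critical n" and u'v: "\<not> u' \<triangleleft> v"
    using assms(1) by (auto simp: splittable_def \<tau> u'_def)
  have u: "u = x # u'" "u' \<noteq> []" using len by (cases u; auto simp: x_def u'_def)+
  have r: "x # u' \<in> rows n" "v \<in> rows n" "t \<in> rows n" and vt: "\<not> v \<triangleleft> t"
    using crit by (auto simp: critical_def u)
  have u': "u' \<in> rows n" using rows_Cons[OF r(1) u(2)] by simp
  have \<sigma>: "\<sigma> \<in> critical n"
    using gens3_is_cell3[of "row_coh n" "fst (\<Omega> \<tau>)"] filler_\<Omega>[OF assms(1)] assms(2)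
    by (auto simp: filler_def simp del: \<Omega>.simps)
  obtain u1 v1 t1 where \<sigma>1: "\<sigma> = (u1, v1, t1)" by (cases \<sigma>) auto
  have "\<sigma> = ([x], u', v) \<or> \<sigma> = (u', v, t) \<or> \<sigma> \<in> gens3 (\<Theta>L x u' v t) \<or> \<sigma> \<in> gens3 (\<Theta>R x u' v t)"
    using assms(2) by (auto simp: \<tau> Let_def x_def[symmetric] u'_def[symmetric])
  then consider "u1 = [x]" | "u1 = u'" | "\<sigma> = (x # upper_row u' v, lower_row u' v, t)"
    | "upper_row v t \<noteq> []" "upper_row u' (upper_row v t) \<noteq> []" "\<not> lower_row u' (upper_row v t) \<triangleleft> lower_row v t"
      "\<sigma> = (x # upper_row u' (upper_row v t), lower_row u' (upper_row v t), lower_row v t)"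
    using gens3_\<Theta>L[OF u' r(2,3)] gens3_\<Theta>R[OF u' r(2,3)] \<sigma>1 by fastforce
  then show ?thesis unfolding \<tau>
  proof cases
    case 1
    then show "(\<sigma>, (u, v, t)) \<in> triple_less n"
      using len by (intro triple_lessI[OF \<sigma> crit \<sigma>1]) simp
  next
    case 2
    then show "(\<sigma>, (u, v, t)) \<in> triple_less n"
      using u by (intro triple_lessI[OF \<sigma> crit \<sigma>1]) simp
  next
    case 3
    have "length (upper_row u' v) \<le> length u'" by (simp add: upper_row_def)
    then show "(\<sigma>, (u, v, t)) \<in> triple_less n"
      using lower_above_less[OF u' r(2,3) u'v] u by (intro triple_lessI[OF \<sigma> crit 3]) auto
  next
    case 4
    have "length (upper_row u' (upper_row v t)) \<le> length u'" by (simp add: upper_row_def)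
    then show "(\<sigma>, (u, v, t)) \<in> triple_less n"
      using lower_upper_above_less[OF u' r(2,3) vt 4(1-3)] u by (intro triple_lessI[OF \<sigma> crit 4(4)]) auto
  qed
qed

section \<open>The presented monoid\<close>

definition word_class :: "'a set \<Rightarrow> ('a list \<times> 'a list) set \<Rightarrow> 'a list \<Rightarrow> 'a list set" where
  "word_class X R v = {w. word_cong X R v w}"

lemma word_class_eq:
  assumes "v \<in> lists X"
  shows "word_class X R v = word_class X R w \<longleftrightarrow> word_cong X R v w"
proof
  assume "word_class X R v = word_class X R w"
  moreover have "v \<in> word_class X R v" using assms by (simp add: word_class_def word_cong.refl)
  ultimately show "word_cong X R v w" by (simp add: word_class_def word_cong.sym)
qed (auto simp: word_class_def intro: word_cong.trans word_cong.sym)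

lemma word_cong_append:
  assumes "word_cong X R v v'" "word_cong X R w w'"
  shows "word_cong X R (v @ w) (v' @ w')"
  using word_cong_context[OF assms(1), of "[]" w] word_cong_context[OF assms(2), of v' "[]"]
    word_cong_lists[OF assms(1)] word_cong_lists[OF assms(2)] by (auto intro: word_cong.trans)

lemma carrier_presented_monoid: "carrier (presented_monoid X R) = word_class X R ` lists X"
  by (auto simp: presented_monoid_def word_class_def)

lemma mult_presented_monoid:
  assumes "v \<in> lists X" "w \<in> lists X"
  shows "word_class X R v \<otimes>\<^bsub>presented_monoid X R\<^esub> word_class X R w = word_class X R (v @ w)"
proof -
  have "word_cong X R (v @ w) z \<longleftrightarrow> (\<exists>a b. word_cong X R v a \<and> word_cong X R w b \<and> word_cong X R (a @ b) z)" for z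
    using word_cong.refl[OF assms(1)] word_cong.refl[OF assms(2)] word_cong_append[of X R v _ w]
    by (meson word_cong.trans)
  then show ?thesis by (auto simp: presented_monoid_def word_class_def)
qed

section \<open>Row congruence and stylic congruence\<close>

definition row_rel :: "nat \<Rightarrow> (row list \<times> row list) set" where
  "row_rel n = (\<lambda>b. (dom2 (row_coh n) b, cod2 (row_coh n) b)) ` gen2 (row_coh n)"

lemma row_rel_iff: "(l, r) \<in> row_rel n \<longleftrightarrow>
    (\<exists>u v. u \<in> rows n \<and> v \<in> rows n \<and> \<not> u \<triangleleft> v \<and> l = [u, v] \<and> r = N (u @ v))"
  unfolding row_rel_def by (auto simp: image_iff)

lemma concat_rows: "w \<in> lists (rows n) \<Longrightarrow> set (concat w) \<subseteq> {1..n}"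
  by (auto simp: rows_def)

lemma row_cong_concat:
  "word_cong (rows n) (row_rel n) v w \<Longrightarrow> word_cong {1..n} (styl_rel n) (concat v) (concat w)"
proof (induction rule: word_cong.induct)
  case (refl w)
  then show ?case using concat_rows by (intro styl_cong_refl) auto
next
  case (rel l r p s)
  then obtain u v where uv: "u \<in> rows n" "v \<in> rows n" "l = [u, v]" "r = N (u @ v)"
    by (auto simp: row_rel_iff)
  have "word_cong {1..n} (styl_rel n) (u @ v) (concat (N (u @ v)))"
    using uv by (intro cong_concat_N) (auto simp: rows_def)
  from styl_cong_context[OF this concat_rows[OF rel(4)] concat_rows[OF rel(5)]] show ?case
    by (simp add: uv)
qed (auto intro: word_cong.sym word_cong.trans)

lemma row_cong_nf: "w \<in> lists (rows n) \<Longrightarrow> word_cong (rows n) (row_rel n) w (N (concat w))"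
proof -
  have "word_cong (rows n) (row_rel n) w (N (concat w))" if "leftmost_path w f" "w \<in> lists (rows n)" for f
    using that
  proof (induction rule: leftmost_path.induct)
    case (1 w)
    then show ?case using N_concat_normal[of w n] by (simp add: word_cong.refl del: in_lists_conv_set)
  next
    case (2 p u v s f)
    have "word_cong (rows n) (row_rel n) (p @ [u, v] @ s) (p @ N (u @ v) @ s)"
      using 2(2,5) N_rows[of u n v] by (intro word_cong.rel) (auto simp: row_rel_iff)
    also have "word_cong (rows n) (row_rel n) \<dots> (N (concat (p @ [u, v] @ s)))"
      using 2(4,5) reduct_rows[of p u v s n] nf_reduct[of p u v s n] by simp
    finally show ?case .
  qed
  then show "w \<in> lists (rows n) \<Longrightarrow> ?thesis" using leftmost_path_\<Lambda>[of w n] by blast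
qed

text \<open>Tableaux decide both congruences: stylically congruent words have the same tableau, and
  a word of rows is row-congruent to the tableau of its concatenation.\<close>

lemma row_cong_iff:
  assumes "v \<in> lists (rows n)" "w \<in> lists (rows n)"
  shows "word_cong (rows n) (row_rel n) v w \<longleftrightarrow> word_cong {1..n} (styl_rel n) (concat v) (concat w)"
proof
  assume "word_cong {1..n} (styl_rel n) (concat v) (concat w)"
  then have "N (concat v) = N (concat w)" by (rule N_cong)
  then show "word_cong (rows n) (row_rel n) v w"
    using row_cong_nf[OF assms(1)] row_cong_nf[OF assms(2)] by (metis word_cong.sym word_cong.trans)
qed (rule row_cong_concat)

lemma row_monoid_iso: "presented_monoid (rows n) (row_rel n) \<cong> stylic_monoid n"
proof -
  let ?G = "presented_monoid (rows n) (row_rel n)" and ?H = "presented_monoid {1..n} (styl_rel n)"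
  let ?c = "word_class (rows n) (row_rel n)" and ?d = "word_class {1..n} (styl_rel n)"
  \<comment> \<open>Closing the concatenations under the stylic congruence avoids choosing a
    representative of the class.\<close>
  define h where "h A = {w. \<exists>v\<in>A. word_cong {1..n} (styl_rel n) (concat v) w}" for A :: "row list set"
  have concat: "concat v \<in> lists {1..n}" if "v \<in> lists (rows n)" for v
    using concat_rows[OF that] by auto
  have h: "h (?c v) = ?d (concat v)" if "v \<in> lists (rows n)" for v
    using row_cong_concat[of n v] word_cong.refl[OF that]
    unfolding h_def word_class_def by (blast intro: word_cong.trans)
  have "h \<in> hom ?G ?H"
  proof (rule homI)
    show "h A \<in> carrier ?H" if A: "A \<in> carrier ?G" for A
    proof -
      obtain v where v: "v \<in> lists (rows n)" "A = ?c v" using A unfolding carrier_presented_monoid by blast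
      show ?thesis unfolding carrier_presented_monoid v(2) h[OF v(1)] using concat[OF v(1)] by (rule imageI)
    qed
    show "h (A \<otimes>\<^bsub>?G\<^esub> B) = h A \<otimes>\<^bsub>?H\<^esub> h B" if AB: "A \<in> carrier ?G" "B \<in> carrier ?G" for A B
    proof -
      obtain v w where vw: "v \<in> lists (rows n)" "w \<in> lists (rows n)" "A = ?c v" "B = ?c w"
        using AB unfolding carrier_presented_monoid by blast
      then have "v @ w \<in> lists (rows n)" by simp
      with vw show ?thesis by (simp add: mult_presented_monoid h concat del: in_lists_conv_set)
    qed
  qed
  moreover have "bij_betw h (carrier ?G) (carrier ?H)"
  proof (rule bij_betw_imageI)
    show "inj_on h (carrier ?G)"
    proof (rule inj_onI)
      fix A B assume AB: "A \<in> carrier ?G" "B \<in> carrier ?G" "h A = h B"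
      then obtain v w where vw: "v \<in> lists (rows n)" "w \<in> lists (rows n)" "A = ?c v" "B = ?c w"
        unfolding carrier_presented_monoid by blast
      with AB(3) have "?d (concat v) = ?d (concat w)" by (simp add: h del: in_lists_conv_set)
      then have "word_cong (rows n) (row_rel n) v w"
        using word_class_eq[OF concat[OF vw(1)]] row_cong_iff[OF vw(1,2)] by metis
      then show "A = B" using word_class_eq[OF vw(1)] vw by metis
    qed
    show "h ` carrier ?G = carrier ?H"
    proof
      show "h ` carrier ?G \<subseteq> carrier ?H"
        unfolding carrier_presented_monoid using h concat by blast
      show "carrier ?H \<subseteq> h ` carrier ?G"
      proof
        fix B assume "B \<in> carrier ?H"
        then obtain w where w: "w \<in> lists {1..n}" "B = ?d w"
          unfolding carrier_presented_monoid by blast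
        \<comment> \<open>Rows with one letter suffice for surjectivity, since their concatenation
          returns the word.\<close>
        let ?w = "map (\<lambda>x. [x]) w"
        have "?w \<in> lists (rows n)" using w(1) by (auto simp: rows_def)
        moreover from this have "B = h (?c ?w)" using w h by simp
        ultimately show "B \<in> h ` carrier ?G" unfolding carrier_presented_monoid by blast
      qed
    qed
  qed
  ultimately have "h \<in> iso ?G ?H" by (simp add: iso_def)
  then have "?G \<cong> ?H" unfolding is_iso_def by blast
  then show ?thesis by (simp add: stylic_monoid_def styl_rel_def)
qed

section \<open>The reduced presentation\<close>

lemma snd_\<Omega>: "snd (\<Omega> \<tau>) = Gen3 \<tau>"
  by (cases \<tau>) (simp add: Let_def del: \<Psi>.simps)

lemma subst2_id: "subst2 (\<lambda>x. [x]) Gen2 f = f"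
  by (induction f) simp_all

lemma red1_empty: "red1 \<nu>2 {} = (\<lambda>x. [x])"
  unfolding red1_def by (rule ext) (subst wfrec, auto)

lemma red2_empty: "red2 P \<rho> {} \<nu>3 {} = Gen2"
  unfolding red2_def by (rule ext) (subst wfrec, auto)

text \<open>With no generating 2- or 3-cell in the part, the recursions defining the functor on 1-
  and 2-cells stop at once, and all boundaries stay literally the same.\<close>

lemma row_scoh_eq: "row_scoh n = (row_coh n)\<lparr>gen3 := critical n - splittable n\<rparr>"
proof -
  have "{x. \<exists>\<gamma>\<in>{\<Omega> \<tau> |\<tau>. \<tau> \<in> splittable n}. snd \<gamma> = Gen3 x} = splittable n"
    by (auto simp: snd_\<Omega>)
  then show ?thesis
    by (simp add: row_scoh_def no_nielsen_def spl_part_def red1_empty red2_empty subst2_id Let_def)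
qed

lemma splittable_subset: "splittable n \<subseteq> critical n"
  by (auto simp: splittable_def)

text \<open>A non-splittable triple is filled by its own generator. For a splittable one the source
  of its sphere is refilled, all generators in it being smaller.\<close>

lemma splittable_filled:
  assumes "\<tau> \<in> critical n"
  shows "filled ((row_coh n)\<lparr>gen3 := critical n - splittable n\<rparr>) (dom3 (row_coh n) \<tau>) (cod3 (row_coh n) \<tau>)"
  using assms
proof (induction \<tau> rule: wf_induct_rule[OF wf_triple_less[of n]])
  case (1 \<tau>)
  let ?P = "(row_coh n)\<lparr>gen3 := critical n - splittable n\<rparr>"
  have P: "is_polygraph3 ?P" by (intro is_polygraph3_gen3 is_polygraph3_row_coh) auto
  show ?case
  proof (cases "\<tau> \<in> splittable n")
    case False
    then show ?thesis using filler_Gen[OF P, of \<tau>] 1(2) unfolding filled_def by auto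
  next
    case True
    note \<Omega> = filler_\<Omega>[OF True, unfolded filler_def]
    have "filled ?P (dom3 (row_coh n) \<tau>) (src2 (row_coh n) (fst (\<Omega> \<tau>)))"
      using \<Omega> by (intro filled_sym[OF filled_eq2[OF P]]) (simp only: eq2_gen3)
    also have "filled ?P \<dots> (tgt2 (row_coh n) (fst (\<Omega> \<tau>)))"
    proof (rule filled_cell3[OF P _ is_polygraph3_row_coh])
      show "is_cell3 (row_coh n) (fst (\<Omega> \<tau>))" using \<Omega> by blast
      show "filled ?P (dom3 (row_coh n) \<sigma>) (cod3 (row_coh n) \<sigma>)" if "\<sigma> \<in> gens3 (fst (\<Omega> \<tau>))" for \<sigma>
        using gens3_\<Omega>[OF True that] by (intro 1(1) triple_less_critical)
    qed
    also have "filled ?P \<dots> (cod3 (row_coh n) \<tau>)"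
      using \<Omega> by (intro filled_eq2[OF P]) (simp only: eq2_gen3)
    finally show ?thesis .
  qed
qed

lemma finite_rows: "finite (rows n)"
proof (rule finite_subset)
  show "rows n \<subseteq> sorted_list_of_set ` Pow {1..n}"
    by (auto simp: rows_def intro!: image_eqI[of _ _ "set _"] simp flip: strict_sorted_sl)
qed simp

lemma collapsible_spl_part: "collapsible_part (row_coh n) (no_nielsen (row_coh n)) (spl_part n)"
proof -
  let ?Q = "row_coh n"
  note Q = is_polygraph3_row_coh[of n]
  have sphere: "sphere3 ?Q (\<Omega> \<tau>)" if "\<tau> \<in> splittable n" for \<tau>
  proof -
    have "\<tau> \<in> critical n" using that splittable_subset by blast
    then have "filler ?Q (Gen3 \<tau>) (dom3 ?Q \<tau>) (cod3 ?Q \<tau>)" using filler_Gen[OF Q] by simp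
    with filler_\<Omega>[OF that] show ?thesis
      unfolding sphere3_def filler_def by (cases "\<Omega> \<tau>") (use snd_\<Omega>[of \<tau>] in \<open>auto intro: eq2.trans eq2.sym\<close>)
  qed
  have cell: "is_cell3 (?Q\<lparr>gen3 := critical n - {\<tau>}\<rparr>) (fst (\<Omega> \<tau>))" if "\<tau> \<in> splittable n" for \<tau>
  proof (rule is_cell3_gen3)
    show "is_cell3 ?Q (fst (\<Omega> \<tau>))" using filler_\<Omega>[OF that] by (simp add: filler_def)
    \<comment> \<open>A well-founded order is irreflexive, so the target of a sphere does not occur
      in its source.\<close>
    have "\<sigma> \<in> critical n" "\<sigma> \<noteq> \<tau>" if "\<sigma> \<in> gens3 (fst (\<Omega> \<tau>))" for \<sigma>
      using gens3_\<Omega>[OF \<open>\<tau> \<in> splittable n\<close> that] wf_not_refl[OF wf_triple_less[of n]] triple_less_critical by blast+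
    then show "gens3 (fst (\<Omega> \<tau>)) \<subseteq> critical n - {\<tau>}" by blast
  qed
  have \<Gamma>4: "(\<forall>\<gamma>\<in>{\<Omega> \<tau> |\<tau>. \<tau> \<in> splittable n}. R \<gamma>) \<longleftrightarrow> (\<forall>\<tau>\<in>splittable n. R (\<Omega> \<tau>))" for R
    by blast
  show ?thesis
    unfolding no_nielsen_def spl_part_def collapsible_part.simps \<Gamma>4 snd_\<Omega>
  proof (intro conjI, goal_cases)
    case 1
    show ?case by (rule Q)
  next
    case 4
    show ?case using sphere by blast
  next
    case 7
    show ?case using nielsen4_refl[OF Q sphere] by blast
  next
    case 10
    show ?case using cell splittable_subset[of n] by auto
  next
    case 15
    show ?case
      using gens3_\<Omega>[of _ n] wf_triple_less[of n] trans_triple_less[of n]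
      by (intro exI[of _ "triple_less n"]) (auto simp: triple_less_def)
  \<comment> \<open>The other conditions concern the two empty families, for which the empty order
    suffices.\<close>
  qed (auto simp: trans_def intro: exI[of _ "{}"])
qed

theorem theorem4p2p8:
  fixes n :: nat
  assumes "n \<ge> 1"
  shows "collapsible_part (row_coh n) (no_nielsen (row_coh n)) (spl_part n) \<and>
    coherent_presentation (row_scoh n) (stylic_monoid n) \<and>
    finite_polygraph (row_scoh n) \<and>
    polygraph2.truncate (row_scoh n) = row_pres n \<and>
    gen3 (row_scoh n) = critical n - splittable n \<and>
    (\<forall>\<tau>\<in>gen3 (row_scoh n).
      dom3 (row_scoh n) \<tau> = dom3 (row_coh n) \<tau> \<and> cod3 (row_scoh n) \<tau> = cod3 (row_coh n) \<tau>)"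
proof (intro conjI)
  \<comment> \<open>Squier's argument with only the non-splittable triples as generators.\<close>
  interpret row_filling n "critical n - splittable n"
    by unfold_locales (use splittable_filled in auto)
  have "presents (row_scoh n) (stylic_monoid n)"
    using row_monoid_iso[of n] by (simp add: presents_def row_scoh_eq row_rel_def)
  moreover have "\<exists>A. is_cell3 P A \<and> eq2 P (src2 P A) f \<and> eq2 P (tgt2 P A) g" if "parallel2 P f g" for f g
  proof -
    have "parallel2 (row_coh n) f g" using that by (simp add: parallel2_def)
    from filled_parallel2[OF this] show ?thesis unfolding filled_def filler_def .
  qed
  ultimately show "coherent_presentation (row_scoh n) (stylic_monoid n)"
    unfolding coherent_presentation_def row_scoh_eq using P by blast
  have "finite (rows n \<times> rows n)" "finite (rows n \<times> rows n \<times> rows n)" by (simp_all add: finite_rows)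
  moreover have "gen2 (row_coh n) \<subseteq> rows n \<times> rows n" "critical n \<subseteq> rows n \<times> rows n \<times> rows n"
    by (auto simp: critical_def)
  ultimately show "finite_polygraph (row_scoh n)"
    unfolding finite_polygraph_def row_scoh_eq
    by (auto simp: finite_rows intro: finite_subset simp del: row_coh_sel(2))
  show "polygraph2.truncate (row_scoh n) = row_pres n"
    by (simp add: row_scoh_eq row_coh_def polygraph2.truncate_def polygraph2.extend_def)
qed (simp_all add: row_scoh_eq collapsible_spl_part)

end
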